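(* Let $f_2,f_3,f_4$ and $G$ be as defined in the context, and let \begin{align*} s_2(q)&=q^{-1}(-q;q^2)_\infty^{24},\\ s_3(q)&=\frac1q\left(27q\frac{(q^3;q^3)_\infty^6}{(q;q)_\infty^6}+\frac{(q;q)_\infty^6}{(q^3;q^3)_\infty^6}\right)^2,\\ s_4(q)&=\frac1q\frac{(q^2;q^2)_\infty^{24}}{(q;q)_\infty^{24}}\left(16q\frac{(q;q)_\infty^4(q^4;q^4)_\infty^8}{(q^2;q^2)_\infty^{12}}+\frac{(q^2;q^2)_\infty^{12}}{(q;q)_\infty^4(q^4;q^4)_\infty^8}\right)^4. \end{align*} Then for $|q|$ sufficiently small \begin{align*} f_2(s_2(q))&=-\tfrac{2}{15}G(q)-\tfrac1{15}G(-q)+\tfrac35G(q^2),\\ f_3(s_3(q))&=-\tfrac18G(q)+\tfrac38G(q^3),\\ f_4(s_4(q))&=-\tfrac13G(q)+\tfrac23G(q^2), \end{align*} and, for $|q|$ sufficiently small, the following inverse relations hold: \begin{align*} G(q)&=-19f_2(s_2(q))-4f_2(s_2(-q))+24f_2(s_2(q^2))-12f_2(s_2(-q^2)),\\ G(q)&=-\tfrac{19}{2}f_3(s_3(q))-\tfrac32f_3(s_3(e^{2\pi i/3}q))-\tfrac32f_3(s_3(e^{4\pi i/3}q))+\tfrac92f_3(s_3(q^3)),\\ G(q)&=-5f_4(s_4(q))-2f_4(s_4(-q))+4f_4(s_4(q^2)). \end{align*}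
   Context: Mahler measure of a Laurent polynomial: $\mathrm{m}(P)=\int_{[0,1]^n}\log|P(e^{2\pi i\theta_1},\dots,e^{2\pi i\theta_n})|\,d\theta$. Define (with any choice of roots) $f_2(u)=2\,\mathrm{m}(u^{1/2}+(x+x^{-1})(y+y^{-1})(z+z^{-1}))$, $f_3(u)=\mathrm{m}(u-(x+x^{-1})^2(y+y^{-1})^2(1+z)^3z^{-2})$, $f_4(u)=4\,\mathrm{m}(x^4+y^4+z^4+1+u^{1/4}xyz)$. The $q$-Pochhammer symbol is $(x;q)_\infty=\prod_{j\ge0}(1-xq^j)$. Define $G(q)=\mathrm{Re}\left[-\log(q)+240\sum_{n=1}^\infty n^2\log(1-q^n)\right]$. *)

theory Defs
  imports "HOL-Analysis.Analysis"
begin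

text \<open>
  A Laurent polynomial in \<open>n = CARD('n)\<close> variables enters the Mahler measure only through its
  values on the unit torus, so it is represented by its evaluation function.
\<close>

definition mahler :: "(complex ^ 'n \<Rightarrow> complex) \<Rightarrow> real" where
  "mahler P = (LINT \<theta>:cbox 0 1|lborel. ln (cmod (P (\<chi> i. cis (2 * pi * (\<theta> $ i))))))"

text \<open>
  \<open>f2\<close> and \<open>f4\<close> take the chosen root (of \<open>u\<close>, of order 2 and 4 respectively) as a function
  argument, so that statements about them can quantify over every choice of roots.
\<close>

definition f2 :: "(complex \<Rightarrow> complex) \<Rightarrow> complex \<Rightarrow> real" where
  "f2 rt u = 2 * mahler (\<lambda>v :: complex ^ 3. let x = v $ 1; y = v $ 2; z = v $ 3 in
     rt u + (x + inverse x) * (y + inverse y) * (z + inverse z))"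

definition f3 :: "complex \<Rightarrow> real" where
  "f3 u = mahler (\<lambda>v :: complex ^ 3. let x = v $ 1; y = v $ 2; z = v $ 3 in
     u - (x + inverse x)^2 * (y + inverse y)^2 * (1 + z)^3 * inverse z ^ 2)"

definition f4 :: "(complex \<Rightarrow> complex) \<Rightarrow> complex \<Rightarrow> real" where
  "f4 rt u = 4 * mahler (\<lambda>v :: complex ^ 3. let x = v $ 1; y = v $ 2; z = v $ 3 in
     x^4 + y^4 + z^4 + 1 + rt u * x * y * z)"

definition qpoch :: "complex \<Rightarrow> complex \<Rightarrow> complex" where
  "qpoch x q = (\<Prod>j. 1 - x * q ^ j)"

definition G :: "complex \<Rightarrow> real" where
  "G q = Re (- ln q + 240 * (\<Sum>n. of_nat (Suc n) ^ 2 * ln (1 - q ^ Suc n)))"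

definition s2 :: "complex \<Rightarrow> complex" where
  "s2 q = inverse q * qpoch (- q) (q^2) ^ 24"

definition s3 :: "complex \<Rightarrow> complex" where
  "s3 q = 1 / q *
     (27 * q * (qpoch (q^3) (q^3) ^ 6 / qpoch q q ^ 6)
        + qpoch q q ^ 6 / qpoch (q^3) (q^3) ^ 6) ^ 2"

definition s4 :: "complex \<Rightarrow> complex" where
  "s4 q = 1 / q * (qpoch (q^2) (q^2) ^ 24 / qpoch q q ^ 24) *
     (16 * q * (qpoch q q ^ 4 * qpoch (q^4) (q^4) ^ 8 / qpoch (q^2) (q^2) ^ 12)
        + qpoch (q^2) (q^2) ^ 12 / (qpoch q q ^ 4 * qpoch (q^4) (q^4) ^ 8)) ^ 4"

end

(*
  For large |u| the Mahler measures are f(u) = Re (log u - sum_n a_n u^(-n) / n), where a_n is the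
  constant term of a power of the Laurent polynomial: a product of binomial coefficients, and the
  coefficient sequence of a 3F2 series F.  Put t = 1 / s(q).  Then F(t) is a weight-2 Eisenstein
  series Z of level N = 4, 3, 2 respectively, and q dt/dq = Z w t with
  (N^2 - 1) Z^2 w = N^2 E_4(q^N) - E_4(q).  Hence q d/dq of the series behind f(s(q)) is a combination
  of E_4(q) and E_4(q^N), that is, f(s(q)) = (N G(q^N) - G(q)) / (N^2 - 1).

  No theory of modular forms is needed.  Ramanujan's equations for the derivatives of E_2, E_4, E_6
  come from a bijection on the solutions of a x + b y = n.  All relations between Eisenstein series
  of level 3 and 4 satisfy linear differential systems over formal power series, so they hold as
  soon as a few coefficients agree; eta quotients are recognised by their logarithmic derivatives.
  The remaining terms are eliminated with the Hecke relations for T_2 and T_3.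
*)

theory Submission
  imports Defs "HOL-Complex_Analysis.Complex_Analysis"
begin

section \<open>Convolution sums of divisor functions\<close>

text \<open>Since log q has no power series, the central identity is proved in the exponential form
  \<open>t = fps_X * fexp E\<close>; logarithms return only as logarithms of absolute values, where
  no branch has to be chosen. One argument serves all levels thanks to a common normal form: a
  weight-2 series Z with \<open>qD Z = Z * h\<close>, \<open>2 * qD w = - (1 - w ^ 2) * Z\<close>
  and \<open>2 * qD h = h ^ 2 + \<alpha> * (1 - w ^ 2) * Z ^ 2\<close>, in which only
  \<open>\<alpha>\<close> and the constant c of \<open>t = (1 - w ^ 2) / c\<close> depend on the
  level. The hypergeometric parameters are 1/2, r, 1 - r with r = 1/2, 1/3, 1/4, so
  \<open>\<alpha>\<close> = r (1 - r) is 1/4, 2/9, 3/16; c = 64, 108, 256 is the limit ratio of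
  consecutive coefficients. A relation between Eisenstein series is tested through its defect, the
  difference of its two sides. Defects must enter the differential equations before they are known
  to vanish, hence the correction terms in the derivative formulas of levels 4 and 3. Level 2 is
  obtained from level 4 through the symmetric functions of \<open>a4\<close> and
  \<open>b4\<close>.\<close>

definition quads :: "nat \<Rightarrow> (nat \<times> nat \<times> nat \<times> nat) set" where
  "quads n = {(a,b,x,y). a > 0 \<and> b > 0 \<and> x > 0 \<and> y > 0 \<and> a * x + b * y = n}"

lemma finite_quads [simp, intro]: "finite (quads n)"
proof (rule finite_subset)
  show "quads n \<subseteq> {..n} \<times> {..n} \<times> {..n} \<times> {..n}"
  proof
    fix p assume "p \<in> quads n"
    moreover obtain a b x y where p: "p = (a, b, x, y)"
      by (cases p)
    ultimately have "(a, b, x, y) \<in> quads n"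
      by simp
    then have pos: "a > 0" "b > 0" "x > 0" "y > 0" and n: "a * x + b * y = n"
      by (auto simp: quads_def)
    have "a \<le> a * x" "x \<le> a * x" "b \<le> b * y" "y \<le> b * y"
      using pos by simp_all
    with n have "a \<le> n" "x \<le> n" "b \<le> n" "y \<le> n"
      by linarith+
    then show "p \<in> {..n} \<times> {..n} \<times> {..n} \<times> {..n}"
      by (simp add: p)
  qed
qed auto

lemma sum_quads_split:
  fixes h :: "nat \<Rightarrow> nat \<Rightarrow> nat \<Rightarrow> nat \<Rightarrow> complex"
  shows "(\<Sum>(a,b,x,y)\<in>quads n. h a b x y) =
     (\<Sum>(a,b,x,y)\<in>{(a,b,x,y)\<in>quads n. u a b x y < v a b x y}. h a b x y)
   + (\<Sum>(a,b,x,y)\<in>{(a,b,x,y)\<in>quads n. u a b x y > v a b x y}. h a b x y)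
   + (\<Sum>(a,b,x,y)\<in>{(a,b,x,y)\<in>quads n. (u a b x y :: nat) = v a b x y}. h a b x y)"
proof -
  have *: "quads n = {(a,b,x,y)\<in>quads n. u a b x y < v a b x y} \<union>
     ({(a,b,x,y)\<in>quads n. u a b x y > v a b x y} \<union> {(a,b,x,y)\<in>quads n. u a b x y = v a b x y})"
    by auto
  show ?thesis
    apply (subst *)
    apply (subst sum.union_disjoint)
    apply (auto intro: finite_subset[OF _ finite_quads[of n]])[3]
    apply (subst sum.union_disjoint)
    apply (auto intro: finite_subset[OF _ finite_quads[of n]])
    done
qed

text \<open>
  The bijection \<open>(a, b, x, y) \<mapsto> (a + b, b, x, y - x)\<close> of the solutions with \<open>x < y\<close>
  onto those with \<open>b < a\<close>, and its mirror image, carry the whole combinatorial content.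
\<close>

lemma sum_quads_gt:
  "(\<Sum>(a,b,x,y)\<in>{(a,b,x,y)\<in>quads n. b < a}. h a b) =
   (\<Sum>(a,b,x,y)\<in>{(a,b,x,y)\<in>quads n. x < y}. h (a + b) b)"
  by (rule sum.reindex_bij_witness[where
        i = "\<lambda>(a,b,x,y). (a + b, b, x, y - x)" and j = "\<lambda>(a,b,x,y). (a - b, b, x, x + y)"])
     (auto simp: quads_def algebra_simps diff_mult_distrib2 diff_mult_distrib
         intro!: le_add_diff_inverse trans_le_add1 mult_le_mono)

lemma sum_quads_lt:
  "(\<Sum>(a,b,x,y)\<in>{(a,b,x,y)\<in>quads n. a < b}. h a b) =
   (\<Sum>(a,b,x,y)\<in>{(a,b,x,y)\<in>quads n. y < x}. h a (a + b))"
  by (rule sum.reindex_bij_witness[where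
        i = "\<lambda>(a,b,x,y). (a, a + b, x - y, y)" and j = "\<lambda>(a,b,x,y). (a, b - a, x + y, y)"])
     (auto simp: quads_def algebra_simps diff_mult_distrib2 diff_mult_distrib
         intro!: le_add_diff_inverse trans_le_add1 mult_le_mono)

lemma sum_quads_swap:
  "(\<Sum>(a,b,x,y)\<in>{(a,b,x,y)\<in>quads n. y < x}. h a b) =
   (\<Sum>(a,b,x,y)\<in>{(a,b,x,y)\<in>quads n. x < y}. h b a)"
  by (rule sum.reindex_bij_witness[where
        i = "\<lambda>(a,b,x,y). (b,a,y,x)" and j = "\<lambda>(a,b,x,y). (b,a,y,x)"])
     (auto simp: quads_def algebra_simps)

text \<open>With a = b = d the equation reads x + y = n div d, which has \<open>n div d - 1\<close>
  solutions in positive integers.\<close>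

lemma sum_quads_diag1:
  fixes f :: "nat \<Rightarrow> complex"
  assumes "n > 0"
  shows "(\<Sum>(a,b,x,y)\<in>{(a,b,x,y)\<in>quads n. a = b}. f a) = (\<Sum>d | d dvd n. of_nat (n div d - 1) * f d)"
proof -
  have fin: "finite {d. d dvd n}" using assms by simp
  have "(\<Sum>d | d dvd n. of_nat (n div d - 1) * f d) = (\<Sum>d | d dvd n. \<Sum>x\<in>{1..<n div d}. f d)"
    by simp
  also have "\<dots> = (\<Sum>(d,x)\<in>(SIGMA d:{d. d dvd n}. {1..<n div d}). f d)"
    using fin by (subst sum.Sigma) auto
  also have "\<dots> = (\<Sum>(a,b,x,y)\<in>{(a,b,x,y)\<in>quads n. a = b}. f a)"
    using assms
    by (intro sum.reindex_bij_witness[where j = "\<lambda>(d,x). (d, d, x, n div d - x)" and i = "\<lambda>(a,b,x,y). (a, x)"])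
       (auto simp: quads_def dvd_def simp flip: distrib_left)
  finally show ?thesis ..
qed

lemma sum_quads_diag2:
  fixes h :: "nat \<Rightarrow> nat \<Rightarrow> complex"
  assumes "n > 0"
  shows "(\<Sum>(a,b,x,y)\<in>{(a,b,x,y)\<in>quads n. x = y}. h a b) = (\<Sum>d | d dvd n. \<Sum>a\<in>{1..<d}. h a (d - a))"
proof -
  have fin: "finite {d. d dvd n}" using assms by simp
  have "(\<Sum>d | d dvd n. \<Sum>a\<in>{1..<d}. h a (d - a)) = (\<Sum>(d,a)\<in>(SIGMA d:{d. d dvd n}. {1..<d}). h a (d - a))"
    using fin by (subst sum.Sigma) auto
  also have "\<dots> = (\<Sum>(a,b,x,y)\<in>{(a,b,x,y)\<in>quads n. x = y}. h a b)"
    using assms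
    by (intro sum.reindex_bij_witness[where j = "\<lambda>(d,a). (a, d - a, n div d, n div d)" and i = "\<lambda>(a,b,x,y). (a + b, a)"])
       (auto simp: quads_def dvd_def simp flip: distrib_right)
  finally show ?thesis ..
qed

abbreviation lsum :: "nat \<Rightarrow> (nat \<Rightarrow> nat \<Rightarrow> complex) \<Rightarrow> complex" where
  "lsum n h \<equiv> (\<Sum>(a,b,x,y)\<in>quads n. h a b)"

text \<open>
  Choosing \<open>g\<close> so that the left-hand summand is an odd-odd monomial in \<open>a\<close> and \<open>b\<close> evaluates
  convolutions of divisor sums: \<open>b\<^sup>2\<close>, \<open>b\<^sup>4\<close>, \<open>b\<^sup>6\<close> and \<open>a\<^sup>2b\<^sup>4\<close> are enough for
  Ramanujan's differential equations.
\<close>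

theorem skoruppa_identity:
  fixes g :: "complex \<Rightarrow> complex \<Rightarrow> complex"
  assumes even: "\<And>a b. g (- a) (- b) = g a b" and n: "n > 0"
  defines "g' \<equiv> (\<lambda>a b. g (of_nat a) (of_nat b))"
  shows "lsum n (\<lambda>a b. g (of_nat a) (of_nat b) - g (of_nat a) (- of_nat b)
            + g (of_nat a) (of_nat a - of_nat b) - g (of_nat a) (of_nat a + of_nat b)
            + g (of_nat b - of_nat a) (of_nat b) - g (of_nat a + of_nat b) (of_nat b))
       = (\<Sum>d | d dvd n. of_nat (n div d - 1) * (g (of_nat d) (of_nat d) + g (of_nat d) 0 + g 0 (of_nat d)))
         - (\<Sum>d | d dvd n. \<Sum>a\<in>{1..<d}. g (of_nat a) (of_nat d) + g (of_nat d) (of_nat d - of_nat a)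
              + g (of_nat a) (of_nat a - of_nat d))"
proof -
  have even': "g (- a) b = g a (- b)" for a b using even[of a "- b"] by simp
  define gt where "gt = (\<lambda>h :: nat \<Rightarrow> nat \<Rightarrow> complex. \<Sum>(a,b,x,y)\<in>{(a,b,x,y)\<in>quads n. b < a}. h a b)"
  define lt where "lt = (\<lambda>h :: nat \<Rightarrow> nat \<Rightarrow> complex. \<Sum>(a,b,x,y)\<in>{(a,b,x,y)\<in>quads n. a < b}. h a b)"
  define eq where "eq = (\<lambda>h :: nat \<Rightarrow> nat \<Rightarrow> complex. \<Sum>(a,b,x,y)\<in>{(a,b,x,y)\<in>quads n. a = b}. h a b)"
  define xgt where "xgt = (\<lambda>h :: nat \<Rightarrow> nat \<Rightarrow> complex. \<Sum>(a,b,x,y)\<in>{(a,b,x,y)\<in>quads n. y < x}. h a b)"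
  define xlt where "xlt = (\<lambda>h :: nat \<Rightarrow> nat \<Rightarrow> complex. \<Sum>(a,b,x,y)\<in>{(a,b,x,y)\<in>quads n. x < y}. h a b)"
  define xeq where "xeq = (\<lambda>h :: nat \<Rightarrow> nat \<Rightarrow> complex. \<Sum>(a,b,x,y)\<in>{(a,b,x,y)\<in>quads n. x = y}. h a b)"
  have split1: "lsum n h = lt h + gt h + eq h" for h
    unfolding lt_def gt_def eq_def by (rule sum_quads_split)
  have split2: "lsum n h = xlt h + xgt h + xeq h" for h
    unfolding xlt_def xgt_def xeq_def by (rule sum_quads_split)
  have gt: "gt h = xlt (\<lambda>a b. h (a + b) b)" for h
    unfolding gt_def xlt_def by (rule sum_quads_gt)
  have lt: "lt h = xgt (\<lambda>a b. h a (a + b))" for h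
    unfolding lt_def xgt_def by (rule sum_quads_lt)
  have swap: "xgt h = xlt (\<lambda>a b. h b a)" for h
    unfolding xgt_def xlt_def by (rule sum_quads_swap)
  have add: "lsum n (\<lambda>a b. h1 a b + h2 a b) = lsum n h1 + lsum n h2"
    and diff: "lsum n (\<lambda>a b. h1 a b - h2 a b) = lsum n h1 - lsum n h2" for h1 h2
    by (simp_all add: sum.distrib sum_subtractf case_prod_unfold)
  have xadd: "xeq (\<lambda>a b. h1 a b + h2 a b) = xeq h1 + xeq h2" for h1 h2
    by (simp_all add: xeq_def sum.distrib case_prod_unfold)
  have eadd: "eq (\<lambda>a b. h1 a b + h2 a b) = eq h1 + eq h2" for h1 h2
    by (simp_all add: eq_def sum.distrib case_prod_unfold)
  let ?N = "of_nat :: nat \<Rightarrow> complex"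
  \<comment> \<open>The six sums are cut alternately by a against b and by x against y. Everything
    is moved to the region x < y, where the twelve terms cancel in pairs; only the diagonals a = b
    and x = y survive. Evenness of g is used in the fifth sum.\<close>
  have 1: "lsum n (\<lambda>a b. g (?N a) (?N b)) = xlt (\<lambda>a b. g (?N b) (?N a + ?N b)) +
      xlt (\<lambda>a b. g (?N a + ?N b) (?N b)) + eq (\<lambda>a b. g (?N a) (?N b))"
    unfolding split1 gt lt swap by (simp add: add_ac)
  have 2: "lsum n (\<lambda>a b. g (?N a) (- ?N b)) = xlt (\<lambda>a b. g (?N a) (- ?N b)) +
      xlt (\<lambda>a b. g (?N b) (- ?N a)) + xeq (\<lambda>a b. g (?N a) (- ?N b))"
    unfolding split2 swap by simp
  have 3: "lsum n (\<lambda>a b. g (?N a) (?N a - ?N b)) = xlt (\<lambda>a b. g (?N b) (- ?N a)) +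
      xlt (\<lambda>a b. g (?N a + ?N b) (?N a)) + eq (\<lambda>a b. g (?N a) (?N a - ?N b))"
    unfolding split1 gt lt swap by simp
  have 4: "lsum n (\<lambda>a b. g (?N a) (?N a + ?N b)) = xlt (\<lambda>a b. g (?N a) (?N a + ?N b)) +
      xlt (\<lambda>a b. g (?N b) (?N a + ?N b)) + xeq (\<lambda>a b. g (?N a) (?N a + ?N b))"
    unfolding split2 swap by (simp add: add_ac)
  have 5: "lsum n (\<lambda>a b. g (?N b - ?N a) (?N b)) = xlt (\<lambda>a b. g (?N a) (?N a + ?N b)) +
      xlt (\<lambda>a b. g (?N a) (- ?N b)) + eq (\<lambda>a b. g (?N b - ?N a) (?N b))"
    unfolding split1 gt lt swap by (simp add: add_ac even')
  have 6: "lsum n (\<lambda>a b. g (?N a + ?N b) (?N b)) = xlt (\<lambda>a b. g (?N a + ?N b) (?N b)) +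
      xlt (\<lambda>a b. g (?N a + ?N b) (?N a)) + xeq (\<lambda>a b. g (?N a + ?N b) (?N b))"
    unfolding split2 swap by (simp add: add_ac)
  have eq: "eq h = (\<Sum>d | d dvd n. of_nat (n div d - 1) * h d d)" for h
    unfolding eq_def sum_quads_diag1[OF n, symmetric] by (intro sum.cong) auto
  have xeq: "xeq h = (\<Sum>d | d dvd n. \<Sum>a\<in>{1..<d}. h a (d - a))" for h
    unfolding xeq_def by (rule sum_quads_diag2[OF n])
  have "lsum n (\<lambda>a b. g (of_nat a) (of_nat b) - g (of_nat a) (- of_nat b)
            + g (of_nat a) (of_nat a - of_nat b) - g (of_nat a) (of_nat a + of_nat b)
            + g (of_nat b - of_nat a) (of_nat b) - g (of_nat a + of_nat b) (of_nat b))
     = eq (\<lambda>a b. g (?N a) (?N b) + g (?N a) (?N a - ?N b) + g (?N b - ?N a) (?N b))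
     - xeq (\<lambda>a b. g (?N a) (?N a + ?N b) + g (?N a + ?N b) (?N b) + g (?N a) (- ?N b))"
    unfolding add diff 1 2 3 4 5 6 xadd eadd by simp
  also have "xeq (\<lambda>a b. g (?N a) (?N a + ?N b) + g (?N a + ?N b) (?N b) + g (?N a) (- ?N b)) =
     (\<Sum>d | d dvd n. \<Sum>a\<in>{1..<d}. g (of_nat a) (of_nat d) + g (of_nat d) (of_nat d - of_nat a)
              + g (of_nat a) (of_nat a - of_nat d))"
    unfolding xeq by (intro sum.cong refl) (auto simp: of_nat_diff)
  also have "eq (\<lambda>a b. g (?N a) (?N b) + g (?N a) (?N a - ?N b) + g (?N b - ?N a) (?N b)) =
     (\<Sum>d | d dvd n. of_nat (n div d - 1) * (g (of_nat d) (of_nat d) + g (of_nat d) 0 + g 0 (of_nat d)))"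
    by (simp add: eq)
  finally show ?thesis .
qed

definition dsig :: "nat \<Rightarrow> nat \<Rightarrow> complex" where
  "dsig k n = (\<Sum>d | d dvd n. of_nat d ^ k)"

text \<open>Every number divides 0, so the sum runs over an infinite set and is 0 by convention. The
  end terms of the convolutions over \<open>k \<le> n\<close> therefore drop out.\<close>

lemma dsig_0 [simp]: "dsig k 0 = 0"
  by (simp add: dsig_def)

section \<open>Power sums and the four specialisations of the convolution identity\<close>

lemma sum_power_1: "d > 0 \<Longrightarrow> (\<Sum>a\<in>{1..<d}. of_nat a :: complex) = of_nat d * (of_nat d - 1) / 2"
  by (induction d rule: nat_induct_non_zero) (auto simp: field_simps)

lemma sum_power_2: "d > 0 \<Longrightarrow> (\<Sum>a\<in>{1..<d}. of_nat a ^ 2 :: complex) = (2 * of_nat d ^ 3 - 3 * of_nat d ^ 2 + of_nat d) / 6"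
  by (induction d rule: nat_induct_non_zero) (auto simp: field_simps power_numeral_reduce)

lemma sum_power_3: "d > 0 \<Longrightarrow> (\<Sum>a\<in>{1..<d}. of_nat a ^ 3 :: complex) = (of_nat d ^ 4 - 2 * of_nat d ^ 3 + of_nat d ^ 2) / 4"
  by (induction d rule: nat_induct_non_zero) (auto simp: field_simps power_numeral_reduce)

lemma sum_power_4: "d > 0 \<Longrightarrow> (\<Sum>a\<in>{1..<d}. of_nat a ^ 4 :: complex) =
    (6 * of_nat d ^ 5 - 15 * of_nat d ^ 4 + 10 * of_nat d ^ 3 - of_nat d) / 30"
  by (induction d rule: nat_induct_non_zero) (auto simp: field_simps power_numeral_reduce)

lemma sum_power_5: "d > 0 \<Longrightarrow> (\<Sum>a\<in>{1..<d}. of_nat a ^ 5 :: complex) =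
    (2 * of_nat d ^ 6 - 6 * of_nat d ^ 5 + 5 * of_nat d ^ 4 - of_nat d ^ 2) / 12"
  by (induction d rule: nat_induct_non_zero) (auto simp: field_simps power_numeral_reduce)

lemma sum_power_6: "d > 0 \<Longrightarrow> (\<Sum>a\<in>{1..<d}. of_nat a ^ 6 :: complex) =
    (6 * of_nat d ^ 7 - 21 * of_nat d ^ 6 + 21 * of_nat d ^ 5 - 7 * of_nat d ^ 3 + of_nat d) / 42"
  by (induction d rule: nat_induct_non_zero) (auto simp: field_simps power_numeral_reduce)

lemma sum_divisors_codivisor:
  assumes "n > 0" "k > 0"
  shows "(\<Sum>d | d dvd n. of_nat (n div d - 1) * (c * of_nat d ^ k)) = c * (of_nat n * dsig (k - 1) n - dsig k n)"
proof -
  have "(\<Sum>d | d dvd n. of_nat (n div d - 1) * (c * of_nat d ^ k) :: complex) =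
        (\<Sum>d | d dvd n. c * (of_nat n * of_nat d ^ (k - 1) - of_nat d ^ k))"
  proof (intro sum.cong refl)
    fix d assume "d \<in> {d. d dvd n}"
    then obtain m where m: "n = d * m" by auto
    with assms have "d > 0" "m > 0" by auto
    then show "(of_nat (n div d - 1) * (c * of_nat d ^ k) :: complex) = c * (of_nat n * of_nat d ^ (k - 1) - of_nat d ^ k)"
      using assms(2) by (cases k) (simp_all add: m of_nat_diff algebra_simps)
  qed
  then show ?thesis by (simp add: dsig_def sum_subtractf flip: sum_distrib_left)
qed

text \<open>Sorting the quadruples by k = a x leaves a divisor a of k and an independent divisor b
  of n - k.\<close>

lemma lsum_dsig:
  assumes "n > 0"
  shows "lsum n (\<lambda>a b. of_nat a ^ i * of_nat b ^ j) = (\<Sum>k\<le>n. dsig i k * dsig j (n - k))"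
proof -
  have fin: "finite {d. d dvd k}" if "k \<in> {1..<n}" for k :: nat using that by simp
  have "(\<Sum>k\<le>n. dsig i k * dsig j (n - k)) = (\<Sum>k\<in>{1..<n}. dsig i k * dsig j (n - k))"
    using assms by (intro sum.mono_neutral_right) (auto simp: Suc_le_eq)
  also have "\<dots> = (\<Sum>k\<in>{1..<n}. \<Sum>(a,b)\<in>{d. d dvd k} \<times> {d. d dvd (n - k)}. of_nat a ^ i * of_nat b ^ j)"
    by (simp add: dsig_def sum_product sum.cartesian_product)
  also have "\<dots> = (\<Sum>(k,a,b)\<in>(SIGMA k:{1..<n}. {d. d dvd k} \<times> {d. d dvd (n - k)}). of_nat a ^ i * of_nat b ^ j)"
    using fin by (subst sum.Sigma) (auto simp: case_prod_unfold)
  also have "\<dots> = lsum n (\<lambda>a b. of_nat a ^ i * of_nat b ^ j)"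
    by (intro sum.reindex_bij_witness[where j = "\<lambda>(k,a,b). (a, b, k div a, (n - k) div b)"
          and i = "\<lambda>(a,b,x,y). (a * x, a, b)"])
       (auto simp: quads_def elim!: dvdE intro!: Nat.gr0I split: if_splits)
  finally show ?thesis ..
qed

lemma sum_atLeast1_const: "d > 0 \<Longrightarrow> (\<Sum>a\<in>{1..<d}. c) = (of_nat d - 1) * (c :: complex)"
  by (simp add: of_nat_diff)

lemmas power_sums = sum_power_1 sum_power_2 sum_power_3 sum_power_4 sum_power_5 sum_power_6

text \<open>For \<open>g a b = b ^ 2\<close> the six terms collapse to -4 a b. The right-hand side
  is left as the identity delivers it: the factors 5/3, -2, 1/3 come from summing powers of a below
  d, and the \<open>dsig 2\<close> terms cancel. The divisor sums of even index cancel in the same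
  way in the three companions below.\<close>

lemma skoruppa_b2:
  assumes "n > 0"
  shows "-4 * (\<Sum>k\<le>n. dsig 1 k * dsig 1 (n - k)) = 2 * (of_nat n * dsig 1 n - dsig 2 n) - (5/3) * dsig 3 n - (-2) * dsig 2 n - (1/3) * dsig 1 n"
proof -
  have inner: "(\<Sum>a\<in>{1..<d}. of_nat d ^ 2 + (of_nat d - of_nat a) ^ 2 + (of_nat a - of_nat d) ^ 2) =
      ((5/3) * (of_nat d ^ 3) + (-2) * (of_nat d ^ 2) + (1/3) * (of_nat d ^ 1) :: complex)" if "d > 0" for d :: nat
  proof -
    have "(\<Sum>a\<in>{1..<d}. of_nat d ^ 2 + (of_nat d - of_nat a) ^ 2 + (of_nat a - of_nat d) ^ 2 :: complex) =
      (\<Sum>a\<in>{1..<d}. (3) * of_nat d ^ 2 + ((-4) * of_nat d ^ 1) * of_nat a + ((2) * of_nat d ^ 0) * of_nat a ^ 2)"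
      by (intro sum.cong refl) algebra
    also have "\<dots> = (5/3) * (of_nat d ^ 3) + (-2) * (of_nat d ^ 2) + (1/3) * (of_nat d ^ 1)"
      unfolding sum.distrib sum_subtractf sum_distrib_left[symmetric] power_sums[OF that] sum_atLeast1_const[OF that]
      by (simp add: field_simps power_numeral_reduce)
    finally show ?thesis .
  qed
  have "-4 * lsum n (\<lambda>a b. of_nat a ^ 1 * of_nat b ^ 1) =
     lsum n (\<lambda>a b. of_nat b ^ 2 - (- of_nat b) ^ 2 + (of_nat a - of_nat b) ^ 2 - (of_nat a + of_nat b) ^ 2 + of_nat b ^ 2 - of_nat b ^ 2)"
    unfolding case_prod_unfold sum_distrib_left sum_subtractf[symmetric]
    by (intro sum.cong refl) algebra
  also have "\<dots> =
     (\<Sum>d | d dvd n. of_nat (n div d - 1) * (of_nat d ^ 2 + 0 ^ 2 + of_nat d ^ 2))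
     - (\<Sum>d | d dvd n. \<Sum>a\<in>{1..<d}. of_nat d ^ 2 + (of_nat d - of_nat a) ^ 2 + (of_nat a - of_nat d) ^ 2)"
    by (rule skoruppa_identity[of "\<lambda>a b. b ^ 2", OF _ assms]) simp
  also have "(\<Sum>d | d dvd n. \<Sum>a\<in>{1..<d}. of_nat d ^ 2 + (of_nat d - of_nat a) ^ 2 + (of_nat a - of_nat d) ^ 2) =
     (5/3) * dsig 3 n + (-2) * dsig 2 n + (1/3) * dsig 1 n"
    unfolding dsig_def sum_distrib_left sum.distrib[symmetric] sum_subtractf[symmetric]
    using assms by (intro sum.cong refl inner) (auto intro!: Nat.gr0I)
  also have "(\<Sum>d | d dvd n. of_nat (n div d - 1) * (of_nat d ^ 2 + 0 ^ 2 + of_nat d ^ 2)) =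
     (\<Sum>d | d dvd n. of_nat (n div d - 1) * (2 * of_nat d ^ 2) :: complex)"
    by (intro sum.cong refl) (simp flip: power_add mult_2)
  also have "\<dots> = 2 * (of_nat n * dsig 1 n - dsig 2 n)"
    by (subst sum_divisors_codivisor[OF assms]) simp_all
  finally show ?thesis
    unfolding lsum_dsig[OF assms] by (simp only: diff_diff_eq add.assoc)
qed

lemma skoruppa_b4:
  assumes "n > 0"
  shows "-8 * (\<Sum>k\<le>n. dsig 3 k * dsig 1 (n - k)) - 8 * (\<Sum>k\<le>n. dsig 1 k * dsig 3 (n - k)) = 2 * (of_nat n * dsig 3 n - dsig 4 n) - (7/5) * dsig 5 n - (-2) * dsig 4 n - (2/3) * dsig 3 n - (-1/15) * dsig 1 n"
proof -
  have inner: "(\<Sum>a\<in>{1..<d}. of_nat d ^ 4 + (of_nat d - of_nat a) ^ 4 + (of_nat a - of_nat d) ^ 4) =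
      ((7/5) * (of_nat d ^ 5) + (-2) * (of_nat d ^ 4) + (2/3) * (of_nat d ^ 3) + (-1/15) * (of_nat d ^ 1) :: complex)" if "d > 0" for d :: nat
  proof -
    have "(\<Sum>a\<in>{1..<d}. of_nat d ^ 4 + (of_nat d - of_nat a) ^ 4 + (of_nat a - of_nat d) ^ 4 :: complex) =
      (\<Sum>a\<in>{1..<d}. (3) * of_nat d ^ 4 + ((-8) * of_nat d ^ 3) * of_nat a + ((12) * of_nat d ^ 2) * of_nat a ^ 2 + ((-8) * of_nat d ^ 1) * of_nat a ^ 3 + ((2) * of_nat d ^ 0) * of_nat a ^ 4)"
      by (intro sum.cong refl) algebra
    also have "\<dots> = (7/5) * (of_nat d ^ 5) + (-2) * (of_nat d ^ 4) + (2/3) * (of_nat d ^ 3) + (-1/15) * (of_nat d ^ 1)"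
      unfolding sum.distrib sum_subtractf sum_distrib_left[symmetric] power_sums[OF that] sum_atLeast1_const[OF that]
      by (simp add: field_simps power_numeral_reduce)
    finally show ?thesis .
  qed
  have "-8 * lsum n (\<lambda>a b. of_nat a ^ 3 * of_nat b ^ 1) - 8 * lsum n (\<lambda>a b. of_nat a ^ 1 * of_nat b ^ 3) =
     lsum n (\<lambda>a b. of_nat b ^ 4 - (- of_nat b) ^ 4 + (of_nat a - of_nat b) ^ 4 - (of_nat a + of_nat b) ^ 4 + of_nat b ^ 4 - of_nat b ^ 4)"
    unfolding case_prod_unfold sum_distrib_left sum_subtractf[symmetric]
    by (intro sum.cong refl) algebra
  also have "\<dots> =
     (\<Sum>d | d dvd n. of_nat (n div d - 1) * (of_nat d ^ 4 + 0 ^ 4 + of_nat d ^ 4))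
     - (\<Sum>d | d dvd n. \<Sum>a\<in>{1..<d}. of_nat d ^ 4 + (of_nat d - of_nat a) ^ 4 + (of_nat a - of_nat d) ^ 4)"
    by (rule skoruppa_identity[of "\<lambda>a b. b ^ 4", OF _ assms]) simp
  also have "(\<Sum>d | d dvd n. \<Sum>a\<in>{1..<d}. of_nat d ^ 4 + (of_nat d - of_nat a) ^ 4 + (of_nat a - of_nat d) ^ 4) =
     (7/5) * dsig 5 n + (-2) * dsig 4 n + (2/3) * dsig 3 n + (-1/15) * dsig 1 n"
    unfolding dsig_def sum_distrib_left sum.distrib[symmetric] sum_subtractf[symmetric]
    using assms by (intro sum.cong refl inner) (auto intro!: Nat.gr0I)
  also have "(\<Sum>d | d dvd n. of_nat (n div d - 1) * (of_nat d ^ 4 + 0 ^ 4 + of_nat d ^ 4)) =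
     (\<Sum>d | d dvd n. of_nat (n div d - 1) * (2 * of_nat d ^ 4) :: complex)"
    by (intro sum.cong refl) (simp flip: power_add mult_2)
  also have "\<dots> = 2 * (of_nat n * dsig 3 n - dsig 4 n)"
    by (subst sum_divisors_codivisor[OF assms]) simp_all
  finally show ?thesis
    unfolding lsum_dsig[OF assms] by (simp only: diff_diff_eq add.assoc)
qed

lemma skoruppa_b6:
  assumes "n > 0"
  shows "-12 * (\<Sum>k\<le>n. dsig 5 k * dsig 1 (n - k)) - 40 * (\<Sum>k\<le>n. dsig 3 k * dsig 3 (n - k)) - 12 * (\<Sum>k\<le>n. dsig 1 k * dsig 5 (n - k)) = 2 * (of_nat n * dsig 5 n - dsig 6 n) - (9/7) * dsig 7 n - (-2) * dsig 6 n - (1) * dsig 5 n - (-1/3) * dsig 3 n - (1/21) * dsig 1 n"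
proof -
  have inner: "(\<Sum>a\<in>{1..<d}. of_nat d ^ 6 + (of_nat d - of_nat a) ^ 6 + (of_nat a - of_nat d) ^ 6) =
      ((9/7) * (of_nat d ^ 7) + (-2) * (of_nat d ^ 6) + (1) * (of_nat d ^ 5) + (-1/3) * (of_nat d ^ 3) + (1/21) * (of_nat d ^ 1) :: complex)" if "d > 0" for d :: nat
  proof -
    have "(\<Sum>a\<in>{1..<d}. of_nat d ^ 6 + (of_nat d - of_nat a) ^ 6 + (of_nat a - of_nat d) ^ 6 :: complex) =
      (\<Sum>a\<in>{1..<d}. (3) * of_nat d ^ 6 + ((-12) * of_nat d ^ 5) * of_nat a + ((30) * of_nat d ^ 4) * of_nat a ^ 2 + ((-40) * of_nat d ^ 3) * of_nat a ^ 3 + ((30) * of_nat d ^ 2) * of_nat a ^ 4 + ((-12) * of_nat d ^ 1) * of_nat a ^ 5 + ((2) * of_nat d ^ 0) * of_nat a ^ 6)"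
      by (intro sum.cong refl) algebra
    also have "\<dots> = (9/7) * (of_nat d ^ 7) + (-2) * (of_nat d ^ 6) + (1) * (of_nat d ^ 5) + (-1/3) * (of_nat d ^ 3) + (1/21) * (of_nat d ^ 1)"
      unfolding sum.distrib sum_subtractf sum_distrib_left[symmetric] power_sums[OF that] sum_atLeast1_const[OF that]
      by (simp add: field_simps power_numeral_reduce)
    finally show ?thesis .
  qed
  have "-12 * lsum n (\<lambda>a b. of_nat a ^ 5 * of_nat b ^ 1) - 40 * lsum n (\<lambda>a b. of_nat a ^ 3 * of_nat b ^ 3) - 12 * lsum n (\<lambda>a b. of_nat a ^ 1 * of_nat b ^ 5) =
     lsum n (\<lambda>a b. of_nat b ^ 6 - (- of_nat b) ^ 6 + (of_nat a - of_nat b) ^ 6 - (of_nat a + of_nat b) ^ 6 + of_nat b ^ 6 - of_nat b ^ 6)"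
    unfolding case_prod_unfold sum_distrib_left sum_subtractf[symmetric]
    by (intro sum.cong refl) algebra
  also have "\<dots> =
     (\<Sum>d | d dvd n. of_nat (n div d - 1) * (of_nat d ^ 6 + 0 ^ 6 + of_nat d ^ 6))
     - (\<Sum>d | d dvd n. \<Sum>a\<in>{1..<d}. of_nat d ^ 6 + (of_nat d - of_nat a) ^ 6 + (of_nat a - of_nat d) ^ 6)"
    by (rule skoruppa_identity[of "\<lambda>a b. b ^ 6", OF _ assms]) simp
  also have "(\<Sum>d | d dvd n. \<Sum>a\<in>{1..<d}. of_nat d ^ 6 + (of_nat d - of_nat a) ^ 6 + (of_nat a - of_nat d) ^ 6) =
     (9/7) * dsig 7 n + (-2) * dsig 6 n + (1) * dsig 5 n + (-1/3) * dsig 3 n + (1/21) * dsig 1 n"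
    unfolding dsig_def sum_distrib_left sum.distrib[symmetric] sum_subtractf[symmetric]
    using assms by (intro sum.cong refl inner) (auto intro!: Nat.gr0I)
  also have "(\<Sum>d | d dvd n. of_nat (n div d - 1) * (of_nat d ^ 6 + 0 ^ 6 + of_nat d ^ 6)) =
     (\<Sum>d | d dvd n. of_nat (n div d - 1) * (2 * of_nat d ^ 6) :: complex)"
    by (intro sum.cong refl) (simp flip: power_add mult_2)
  also have "\<dots> = 2 * (of_nat n * dsig 5 n - dsig 6 n)"
    by (subst sum_divisors_codivisor[OF assms]) simp_all
  finally show ?thesis
    unfolding lsum_dsig[OF assms] by (simp only: diff_diff_eq add.assoc)
qed

text \<open>In weight 8 two unknown convolutions occur, of types (1,5) and (3,3). The relation from
  b^6 cannot determine both; this is a second, independent one.\<close>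

lemma skoruppa_a2b4:
  assumes "n > 0"
  shows "-8 * (\<Sum>k\<le>n. dsig 5 k * dsig 1 (n - k)) - 8 * (\<Sum>k\<le>n. dsig 3 k * dsig 3 (n - k)) - 4 * (\<Sum>k\<le>n. dsig 1 k * dsig 5 (n - k)) = 1 * (of_nat n * dsig 5 n - dsig 6 n) - (19/35) * dsig 7 n - (-1) * dsig 6 n - (1/2) * dsig 5 n - (-1/15) * dsig 3 n - (1/42) * dsig 1 n"
proof -
  have inner: "(\<Sum>a\<in>{1..<d}. of_nat a ^ 2 * of_nat d ^ 4 + of_nat d ^ 2 * (of_nat d - of_nat a) ^ 4 + of_nat a ^ 2 * (of_nat a - of_nat d) ^ 4) =
      ((19/35) * (of_nat d ^ 7) + (-1) * (of_nat d ^ 6) + (1/2) * (of_nat d ^ 5) + (-1/15) * (of_nat d ^ 3) + (1/42) * (of_nat d ^ 1) :: complex)" if "d > 0" for d :: nat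
  proof -
    have "(\<Sum>a\<in>{1..<d}. of_nat a ^ 2 * of_nat d ^ 4 + of_nat d ^ 2 * (of_nat d - of_nat a) ^ 4 + of_nat a ^ 2 * (of_nat a - of_nat d) ^ 4 :: complex) =
      (\<Sum>a\<in>{1..<d}. (1) * of_nat d ^ 6 + ((-4) * of_nat d ^ 5) * of_nat a + ((8) * of_nat d ^ 4) * of_nat a ^ 2 + ((-8) * of_nat d ^ 3) * of_nat a ^ 3 + ((7) * of_nat d ^ 2) * of_nat a ^ 4 + ((-4) * of_nat d ^ 1) * of_nat a ^ 5 + ((1) * of_nat d ^ 0) * of_nat a ^ 6)"
      by (intro sum.cong refl) algebra
    also have "\<dots> = (19/35) * (of_nat d ^ 7) + (-1) * (of_nat d ^ 6) + (1/2) * (of_nat d ^ 5) + (-1/15) * (of_nat d ^ 3) + (1/42) * (of_nat d ^ 1)"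
      unfolding sum.distrib sum_subtractf sum_distrib_left[symmetric] power_sums[OF that] sum_atLeast1_const[OF that]
      by (simp add: field_simps power_numeral_reduce)
    finally show ?thesis .
  qed
  have "-8 * lsum n (\<lambda>a b. of_nat a ^ 5 * of_nat b ^ 1) - 8 * lsum n (\<lambda>a b. of_nat a ^ 3 * of_nat b ^ 3) - 4 * lsum n (\<lambda>a b. of_nat a ^ 1 * of_nat b ^ 5) =
     lsum n (\<lambda>a b. of_nat a ^ 2 * of_nat b ^ 4 - of_nat a ^ 2 * (- of_nat b) ^ 4 + of_nat a ^ 2 * (of_nat a - of_nat b) ^ 4 - of_nat a ^ 2 * (of_nat a + of_nat b) ^ 4 + (of_nat b - of_nat a) ^ 2 * of_nat b ^ 4 - (of_nat a + of_nat b) ^ 2 * of_nat b ^ 4)"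
    unfolding case_prod_unfold sum_distrib_left sum_subtractf[symmetric]
    by (intro sum.cong refl) algebra
  also have "\<dots> =
     (\<Sum>d | d dvd n. of_nat (n div d - 1) * (of_nat d ^ 2 * of_nat d ^ 4 + of_nat d ^ 2 * 0 ^ 4 + 0 ^ 2 * of_nat d ^ 4))
     - (\<Sum>d | d dvd n. \<Sum>a\<in>{1..<d}. of_nat a ^ 2 * of_nat d ^ 4 + of_nat d ^ 2 * (of_nat d - of_nat a) ^ 4 + of_nat a ^ 2 * (of_nat a - of_nat d) ^ 4)"
    by (rule skoruppa_identity[of "\<lambda>a b. a ^ 2 * b ^ 4", OF _ assms]) simp
  also have "(\<Sum>d | d dvd n. \<Sum>a\<in>{1..<d}. of_nat a ^ 2 * of_nat d ^ 4 + of_nat d ^ 2 * (of_nat d - of_nat a) ^ 4 + of_nat a ^ 2 * (of_nat a - of_nat d) ^ 4) =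
     (19/35) * dsig 7 n + (-1) * dsig 6 n + (1/2) * dsig 5 n + (-1/15) * dsig 3 n + (1/42) * dsig 1 n"
    unfolding dsig_def sum_distrib_left sum.distrib[symmetric] sum_subtractf[symmetric]
    using assms by (intro sum.cong refl inner) (auto intro!: Nat.gr0I)
  also have "(\<Sum>d | d dvd n. of_nat (n div d - 1) * (of_nat d ^ 2 * of_nat d ^ 4 + of_nat d ^ 2 * 0 ^ 4 + 0 ^ 2 * of_nat d ^ 4)) =
     (\<Sum>d | d dvd n. of_nat (n div d - 1) * (1 * of_nat d ^ 6) :: complex)"
    by (intro sum.cong refl) (simp flip: power_add mult_2)
  also have "\<dots> = 1 * (of_nat n * dsig 5 n - dsig 6 n)"
    by (subst sum_divisors_codivisor[OF assms]) simp_all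
  finally show ?thesis
    unfolding lsum_dsig[OF assms] by (simp only: diff_diff_eq add.assoc)
qed

section \<open>Eisenstein series as formal power series\<close>

text \<open>The operator q d/dq. Unlike \<open>fps_deriv\<close> it does not shift coefficients, so
  comparing coefficients of order n turns a linear system into an eigenvalue problem for n.\<close>

definition qD :: "complex fps \<Rightarrow> complex fps" where
  "qD f = fps_X * fps_deriv f"

lemma qD_nth [simp]: "fps_nth (qD f) n = of_nat n * fps_nth f n"
  by (cases n) (simp_all add: qD_def)

lemma qD_add: "qD (f + g) = qD f + qD g"
  and qD_diff: "qD (f - g) = qD f - qD g"
  and qD_minus: "qD (- f) = - qD f"
  and qD_mult: "qD (f * g) = f * qD g + qD f * g"
  by (simp_all add: qD_def algebra_simps)

lemma qD_const [simp]: "qD (fps_const c) = 0" "qD 1 = 0" "qD 0 = 0" "qD (numeral k) = 0"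
  by (simp_all add: qD_def fps_eq_iff)

lemma qD_power: "qD (f ^ n) = of_nat n * f ^ (n - 1) * qD f"
  by (simp add: qD_def fps_deriv_power mult_ac fps_of_nat)

definition eis :: "complex \<Rightarrow> nat \<Rightarrow> complex fps" where
  "eis c k = Abs_fps (\<lambda>n. if n = 0 then 1 else c * dsig k n)"

lemma eis_nth_0 [simp]: "fps_nth (eis c k) 0 = 1"
  by (simp add: eis_def)

lemma eis_nth: "n > 0 \<Longrightarrow> fps_nth (eis c k) n = c * dsig k n"
  by (simp add: eis_def)

lemma eis_mult_nth:
  assumes "n > 0"
  shows "fps_nth (eis c k * eis d l) n = c * dsig k n + d * dsig l n + c * d * (\<Sum>i\<le>n. dsig k i * dsig l (n - i))"
proof -
  have eq: "eis c k = 1 + Abs_fps (\<lambda>n. c * dsig k n)" for c k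
    by (rule fps_ext) (auto simp: eis_def)
  show ?thesis
    unfolding eq using assms
    by (simp add: algebra_simps fps_mult_nth sum_distrib_left atLeast0AtMost)
qed

definition P_eis :: "complex fps" where "P_eis = eis (-24) 1"
definition Q_eis :: "complex fps" where "Q_eis = eis 240 3"
definition R_eis :: "complex fps" where "R_eis = eis (-504) 5"

lemma conv_comm: "(\<Sum>k\<le>n. dsig i k * dsig j (n - k)) = (\<Sum>k\<le>n. dsig j k * dsig i (n - k))"
  by (rule sum.reindex_bij_witness[where i = "\<lambda>k. n - k" and j = "\<lambda>k. n - k"]) auto

lemma fps_eqI_pos:
  assumes "fps_nth f 0 = fps_nth g 0" "\<And>n. n > 0 \<Longrightarrow> fps_nth f n = fps_nth g n"
  shows "f = g"
  using assms by (intro fps_ext) (metis neq0_conv)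

lemma conv_11:
  assumes "n > 0"
  shows "(\<Sum>k\<le>n. dsig 1 k * dsig 1 (n - k)) = (5 * dsig 3 n + dsig 1 n - 6 * of_nat n * dsig 1 n) / 12" (is "?C = ?R")
proof -
  have "?C = (-4 * ?C) / (-4)"
    by simp
  also have "\<dots> = ?R"
    unfolding skoruppa_b2[OF assms] by (simp add: field_simps)
  finally show ?thesis .
qed

lemma conv_13:
  assumes "n > 0"
  shows "(\<Sum>k\<le>n. dsig 1 k * dsig 3 (n - k)) = (21 * dsig 5 n + 10 * dsig 3 n - dsig 1 n - 30 * of_nat n * dsig 3 n) / 240"
    (is "?C = _")
proof -
  have "?C = (-8 * (\<Sum>k\<le>n. dsig 3 k * dsig 1 (n - k)) - 8 * ?C) / (-16)"
    unfolding conv_comm[of 3 1 n] by simp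
  then show ?thesis
    unfolding skoruppa_b4[OF assms] by (simp add: field_simps)
qed

lemma conv_33:
  assumes "n > 0"
  shows "(\<Sum>k\<le>n. dsig 3 k * dsig 3 (n - k)) = (dsig 7 n - dsig 3 n) / 120" (is "?C = ?R")
proof -
  \<comment> \<open>The (5,1) and (1,5) sums agree, so this combination eliminates them and leaves
    24 times the (3,3) sum.\<close>
  have "?C = (2 * (-8 * (\<Sum>k\<le>n. dsig 5 k * dsig 1 (n - k)) - 8 * ?C - 4 * (\<Sum>k\<le>n. dsig 1 k * dsig 5 (n - k)))
    - (-12 * (\<Sum>k\<le>n. dsig 5 k * dsig 1 (n - k)) - 40 * ?C - 12 * (\<Sum>k\<le>n. dsig 1 k * dsig 5 (n - k)))) / 24"
    unfolding conv_comm[of 5 1 n] by simp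
  also have "\<dots> = ?R"
    unfolding skoruppa_b6[OF assms] skoruppa_a2b4[OF assms] by (simp add: field_simps)
  finally show ?thesis .
qed

lemma conv_15:
  assumes "n > 0"
  shows "(\<Sum>k\<le>n. dsig 1 k * dsig 5 (n - k)) = (20 * dsig 7 n + 21 * dsig 5 n + dsig 1 n - 42 * of_nat n * dsig 5 n) / 504"
    (is "?C = ?R")
proof -
  \<comment> \<open>Subtracting five times the second relation removes the (3,3) sum and leaves 36
    times the (1,5) sum.\<close>
  have "?C = ((-12 * (\<Sum>k\<le>n. dsig 5 k * dsig 1 (n - k)) - 40 * (\<Sum>k\<le>n. dsig 3 k * dsig 3 (n - k)) - 12 * ?C)
    - 5 * (-8 * (\<Sum>k\<le>n. dsig 5 k * dsig 1 (n - k)) - 8 * (\<Sum>k\<le>n. dsig 3 k * dsig 3 (n - k)) - 4 * ?C)) / 36"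
    unfolding conv_comm[of 5 1 n] by simp
  also have "\<dots> = ?R"
    unfolding skoruppa_b6[OF assms] skoruppa_a2b4[OF assms] by (simp add: field_simps)
  finally show ?thesis .
qed

theorem qD_P: "qD P_eis = fps_const (1/12) * (P_eis ^ 2 - Q_eis)"
proof (rule fps_eqI_pos)
  fix n :: nat assume n: "n > 0"
  show "fps_nth (qD P_eis) n = fps_nth (fps_const (1/12) * (P_eis ^ 2 - Q_eis)) n"
    unfolding P_eis_def Q_eis_def power2_eq_square fps_mult_left_const_nth fps_sub_nth eis_mult_nth[OF n] qD_nth eis_nth[OF n] conv_11[OF n]
    by (simp add: field_simps)
qed (simp_all add: P_eis_def Q_eis_def fps_nth_power_0)

theorem qD_Q: "qD Q_eis = fps_const (1/3) * (P_eis * Q_eis - R_eis)"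
proof (rule fps_eqI_pos)
  fix n :: nat assume n: "n > 0"
  show "fps_nth (qD Q_eis) n = fps_nth (fps_const (1/3) * (P_eis * Q_eis - R_eis)) n"
    unfolding P_eis_def Q_eis_def R_eis_def fps_mult_left_const_nth fps_sub_nth eis_mult_nth[OF n] qD_nth eis_nth[OF n] conv_13[OF n]
    by (simp add: field_simps)
qed (simp_all add: P_eis_def Q_eis_def R_eis_def fps_nth_power_0)

theorem qD_R: "qD R_eis = fps_const (1/2) * (P_eis * R_eis - Q_eis ^ 2)"
proof (rule fps_eqI_pos)
  fix n :: nat assume n: "n > 0"
  show "fps_nth (qD R_eis) n = fps_nth (fps_const (1/2) * (P_eis * R_eis - Q_eis ^ 2)) n"
    unfolding P_eis_def Q_eis_def R_eis_def power2_eq_square fps_mult_left_const_nth fps_sub_nth eis_mult_nth[OF n] qD_nth eis_nth[OF n] conv_15[OF n] conv_33[OF n]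
    by (simp add: field_simps)
qed (simp_all add: P_eis_def Q_eis_def R_eis_def fps_nth_power_0)

section \<open>Linear differential systems for formal power series\<close>

text \<open>
  Comparing coefficients of order \<open>n\<close> gives an eigenvalue equation for the value of the
  matrix at \<open>q = 0\<close>, so a solution vanishing beyond the largest integral eigenvalue is zero.
\<close>

lemma qD_linear_system_zero:
  fixes v :: "'i \<Rightarrow> complex fps"
  assumes "finite I" and N: "N \<noteq> 0"
    and ode: "\<And>i. i \<in> I \<Longrightarrow> fps_const N * qD (v i) = (\<Sum>j\<in>I. M i j * v j)"
    and init: "\<And>i n. i \<in> I \<Longrightarrow> n < n0 \<Longrightarrow> fps_nth (v i) n = 0"
    and nonsing: "\<And>n c i. n \<ge> n0 \<Longrightarrow>
       (\<And>i. i \<in> I \<Longrightarrow> N * (of_nat n * c i) = (\<Sum>j\<in>I. fps_nth (M i j) 0 * c j)) \<Longrightarrow> i \<in> I \<Longrightarrow> c i = 0"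
    and "i \<in> I"
  shows "v i = 0"
proof -
  have "\<forall>i\<in>I. fps_nth (v i) n = 0" for n
  proof (induction n rule: less_induct)
    case (less n)
    show ?case
    proof (cases "n < n0")
      case True
      then show ?thesis using init by simp
    next
      case False
      have *: "N * (of_nat n * fps_nth (v i) n) = (\<Sum>j\<in>I. fps_nth (M i j) 0 * fps_nth (v j) n)" if "i \<in> I" for i
      proof -
        have *: "N * (of_nat n * fps_nth (v i) n) = fps_nth (fps_const N * qD (v i)) n"
          by simp
        also have "\<dots> = (\<Sum>j\<in>I. fps_nth (M i j * v j) n)"
          unfolding ode[OF that] by (simp add: fps_sum_nth)
        also have "\<dots> = (\<Sum>j\<in>I. fps_nth (M i j) 0 * fps_nth (v j) n)"
        proof (intro sum.cong refl)
          fix j assume j: "j \<in> I"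
          have "fps_nth (M i j * v j) n = (\<Sum>k\<in>{0..n}. fps_nth (M i j) k * fps_nth (v j) (n - k))"
            by (rule fps_mult_nth)
          also have "\<dots> = (\<Sum>k\<in>{0}. fps_nth (M i j) k * fps_nth (v j) (n - k))"
            using less.IH j by (intro sum.mono_neutral_right) auto
          finally show "fps_nth (M i j * v j) n = fps_nth (M i j) 0 * fps_nth (v j) n"
            by simp
        qed
        finally show ?thesis .
      qed
      from False have "n0 \<le> n"
        by simp
      then show ?thesis
        by (intro ballI) (rule nonsing[of n "\<lambda>i. fps_nth (v i) n", OF _ *])
    qed
  qed
  then show ?thesis using \<open>i \<in> I\<close> by (intro fps_ext) simp
qed

section \<open>The substitution q -> q^m and tables of initial coefficients\<close>

definition dil :: "nat \<Rightarrow> complex fps \<Rightarrow> complex fps" where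
  "dil m f = fps_compose f (fps_X ^ m)"

lemma dil_simps:
  assumes "m > 0"
  shows "dil m (f + g) = dil m f + dil m g" "dil m (f - g) = dil m f - dil m g"
    "dil m (f * g) = dil m f * dil m g" "dil m (f ^ k) = dil m f ^ k"
    "dil m (fps_const c) = fps_const c" "dil m (numeral l) = numeral l" "dil m 1 = 1"
  using assms
  by (simp_all add: dil_def fps_compose_add_distrib fps_compose_sub_distrib fps_compose_mult_distrib
       fps_compose_power fps_X_power_nth numeral_fps_const del: fps_X_power_iff)

lemma dil_nth: "m > 0 \<Longrightarrow> fps_nth (dil m f) n = (if m dvd n then fps_nth f (n div m) else 0)"
  by (simp add: dil_def fps_nth_compose_X_power)

lemma qD_dil: "m > 0 \<Longrightarrow> qD (dil m f) = of_nat m * dil m (qD f)"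
  by (rule fps_ext) (auto simp: dil_nth fps_of_nat[symmetric] elim!: dvdE)

lemma dsig_eval: "n > 0 \<Longrightarrow> dsig k n = (\<Sum>d\<in>{1..n}. if d dvd n then of_nat d ^ k else 0)"
  unfolding dsig_def by (subst sum.inter_filter[symmetric]) (auto intro!: sum.cong dest: dvd_imp_le intro: Nat.gr0I)

text \<open>Orders 0 to 4 are those that the initial checks \<open>n < 5\<close> of the two linear
  systems read off.\<close>

lemma fps_mult_nth_le4:
  fixes f g :: "complex fps"
  shows "fps_nth (f * g) 0 = fps_nth f 0 * fps_nth g 0"
    "fps_nth (f * g) (Suc 0) = fps_nth f 0 * fps_nth g (Suc 0) + fps_nth f (Suc 0) * fps_nth g 0"
    "fps_nth (f * g) 2 = fps_nth f 0 * fps_nth g 2 + fps_nth f (Suc 0) * fps_nth g (Suc 0) + fps_nth f 2 * fps_nth g 0"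
    "fps_nth (f * g) 3 = fps_nth f 0 * fps_nth g 3 + fps_nth f (Suc 0) * fps_nth g 2 + fps_nth f 2 * fps_nth g (Suc 0) + fps_nth f 3 * fps_nth g 0"
    "fps_nth (f * g) 4 = fps_nth f 0 * fps_nth g 4 + fps_nth f (Suc 0) * fps_nth g 3 + fps_nth f 2 * fps_nth g 2 + fps_nth f 3 * fps_nth g (Suc 0) + fps_nth f 4 * fps_nth g 0"
  by (simp_all add: fps_mult_nth numeral_eq_Suc atLeast0_atMost_Suc)

lemma dsig_values:
  "dsig k (Suc 0) = 1" "dsig k 2 = 1 + 2 ^ k" "dsig k 3 = 1 + 3 ^ k" "dsig k 4 = 1 + 2 ^ k + 4 ^ k"
proof -
  have "{1..2} = {1, 2::nat}" "{1..3} = {1, 2, 3::nat}" "{1..4} = {1, 2, 3, 4::nat}"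
    by auto
  then show "dsig k (Suc 0) = 1" "dsig k 2 = 1 + 2 ^ k" "dsig k 3 = 1 + 3 ^ k" "dsig k 4 = 1 + 2 ^ k + 4 ^ k"
    by (simp_all add: dsig_eval)
qed
lemma P_eis_nth:
  "fps_nth P_eis 0 = 1" "fps_nth P_eis (Suc 0) = -24" "fps_nth P_eis 2 = -72" "fps_nth P_eis 3 = -96" "fps_nth P_eis 4 = -168"
  by (simp_all add: P_eis_def eis_nth dsig_values)

lemma Q_eis_nth:
  "fps_nth Q_eis 0 = 1" "fps_nth Q_eis (Suc 0) = 240" "fps_nth Q_eis 2 = 2160" "fps_nth Q_eis 3 = 6720" "fps_nth Q_eis 4 = 17520"
  by (simp_all add: Q_eis_def eis_nth dsig_values)

lemma R_eis_nth:
  "fps_nth R_eis 0 = 1" "fps_nth R_eis (Suc 0) = -504" "fps_nth R_eis 2 = -16632" "fps_nth R_eis 3 = -122976" "fps_nth R_eis 4 = -532728"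
  by (simp_all add: R_eis_def eis_nth dsig_values)

abbreviation "P1 \<equiv> P_eis"
abbreviation "P2 \<equiv> dil 2 P_eis"
abbreviation "P3 \<equiv> dil 3 P_eis"
abbreviation "P4 \<equiv> dil 4 P_eis"
abbreviation "Q1 \<equiv> Q_eis"
abbreviation "Q2 \<equiv> dil 2 Q_eis"
abbreviation "Q3 \<equiv> dil 3 Q_eis"
abbreviation "Q4 \<equiv> dil 4 Q_eis"
abbreviation "R1 \<equiv> R_eis"
abbreviation "R2 \<equiv> dil 2 R_eis"
abbreviation "R3 \<equiv> dil 3 R_eis"
abbreviation "R4 \<equiv> dil 4 R_eis"
lemma P2_nth:
  "fps_nth P2 0 = 1" "fps_nth P2 (Suc 0) = 0" "fps_nth P2 2 = -24" "fps_nth P2 3 = 0" "fps_nth P2 4 = -72"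
  by (simp_all add: dil_nth P_eis_nth)

lemma Q2_nth:
  "fps_nth Q2 0 = 1" "fps_nth Q2 (Suc 0) = 0" "fps_nth Q2 2 = 240" "fps_nth Q2 3 = 0" "fps_nth Q2 4 = 2160"
  by (simp_all add: dil_nth Q_eis_nth)

lemma R2_nth:
  "fps_nth R2 0 = 1" "fps_nth R2 (Suc 0) = 0" "fps_nth R2 2 = -504" "fps_nth R2 3 = 0" "fps_nth R2 4 = -16632"
  by (simp_all add: dil_nth R_eis_nth)

lemma P3_nth:
  "fps_nth P3 0 = 1" "fps_nth P3 (Suc 0) = 0" "fps_nth P3 2 = 0" "fps_nth P3 3 = -24" "fps_nth P3 4 = 0"
  by (simp_all add: dil_nth P_eis_nth)

lemma Q3_nth:
  "fps_nth Q3 0 = 1" "fps_nth Q3 (Suc 0) = 0" "fps_nth Q3 2 = 0" "fps_nth Q3 3 = 240" "fps_nth Q3 4 = 0"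
  by (simp_all add: dil_nth Q_eis_nth)

lemma R3_nth:
  "fps_nth R3 0 = 1" "fps_nth R3 (Suc 0) = 0" "fps_nth R3 2 = 0" "fps_nth R3 3 = -504" "fps_nth R3 4 = 0"
  by (simp_all add: dil_nth R_eis_nth)

lemma P4_nth:
  "fps_nth P4 0 = 1" "fps_nth P4 (Suc 0) = 0" "fps_nth P4 2 = 0" "fps_nth P4 3 = 0" "fps_nth P4 4 = -24"
  by (simp_all add: dil_nth P_eis_nth)

lemma Q4_nth:
  "fps_nth Q4 0 = 1" "fps_nth Q4 (Suc 0) = 0" "fps_nth Q4 2 = 0" "fps_nth Q4 3 = 0" "fps_nth Q4 4 = 240"
  by (simp_all add: dil_nth Q_eis_nth)

lemma R4_nth:
  "fps_nth R4 0 = 1" "fps_nth R4 (Suc 0) = 0" "fps_nth R4 2 = 0" "fps_nth R4 3 = 0" "fps_nth R4 4 = -504"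
  by (simp_all add: dil_nth R_eis_nth)

lemma fps_numeral_mult_const: "numeral k * (fps_const c * f) = fps_const (numeral k * c) * (f :: complex fps)"
  by (simp add: numeral_fps_const mult.assoc[symmetric])

lemma qD_eis1:
  "12 * qD P1 = P1 ^ 2 - Q1"
  "3 * qD Q1 = P1 * Q1 - R1"
  "2 * qD R1 = P1 * R1 - Q1 ^ 2"
  by (simp_all add: qD_P qD_Q qD_R fps_numeral_mult_const right_diff_distrib
       flip: numeral_fps_const)

lemma qD_eis2:
  "12 * qD P2 = 2 * (P2 ^ 2 - Q2)"
  "3 * qD Q2 = 2 * (P2 * Q2 - R2)"
  "2 * qD R2 = 2 * (P2 * R2 - Q2 ^ 2)"
  by (simp_all add: qD_dil dil_simps qD_P qD_Q qD_R mult.left_commute[of "numeral _" "2"] fps_numeral_mult_const right_diff_distrib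
       flip: numeral_fps_const)

lemma qD_eis3:
  "12 * qD P3 = 3 * (P3 ^ 2 - Q3)"
  "3 * qD Q3 = 3 * (P3 * Q3 - R3)"
  "2 * qD R3 = 3 * (P3 * R3 - Q3 ^ 2)"
  by (simp_all add: qD_dil dil_simps qD_P qD_Q qD_R mult.left_commute[of "numeral _" "3"] fps_numeral_mult_const right_diff_distrib
       flip: numeral_fps_const)

lemma qD_eis4:
  "12 * qD P4 = 4 * (P4 ^ 2 - Q4)"
  "3 * qD Q4 = 4 * (P4 * Q4 - R4)"
  "2 * qD R4 = 4 * (P4 * R4 - Q4 ^ 2)"
  by (simp_all add: qD_dil dil_simps qD_P qD_Q qD_R mult.left_commute[of "numeral _" "4"] fps_numeral_mult_const right_diff_distrib
       flip: numeral_fps_const)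

section \<open>Eisenstein series of level 4\<close>

text \<open>
  In terms of Jacobi's theta functions, \<open>A4 = 3 \<theta>\<^sub>2(q)\<^sup>4\<close> and \<open>B4 = 3 \<theta>\<^sub>3(q)\<^sup>4\<close>.
\<close>

definition A4 :: "complex fps" where "A4 = 6 * P2 - 2 * P1 - 4 * P4"
definition B4 :: "complex fps" where "B4 = 4 * P4 - P1"

lemma A4_nth:
  "fps_nth (A4) 0 = 0" "fps_nth (A4) (Suc 0) = 48" "fps_nth (A4) 2 = 0" "fps_nth (A4) 3 = 192" "fps_nth (A4) 4 = 0"
  by (simp_all add: fps_numeral_nth A4_def P_eis_nth P2_nth P4_nth)

lemma B4_nth:
  "fps_nth (B4) 0 = 3" "fps_nth (B4) (Suc 0) = 24" "fps_nth (B4) 2 = 72" "fps_nth (B4) 3 = 96" "fps_nth (B4) 4 = 72"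
  by (simp_all add: fps_numeral_nth B4_def P_eis_nth P2_nth P4_nth)

lemma AA_nth:
  "fps_nth (A4 * A4) 0 = 0" "fps_nth (A4 * A4) (Suc 0) = 0" "fps_nth (A4 * A4) 2 = 2304" "fps_nth (A4 * A4) 3 = 0" "fps_nth (A4 * A4) 4 = 18432"
  by (simp_all only: fps_mult_nth_le4 A4_nth, simp_all)

lemma AB_nth:
  "fps_nth (A4 * B4) 0 = 0" "fps_nth (A4 * B4) (Suc 0) = 144" "fps_nth (A4 * B4) 2 = 1152" "fps_nth (A4 * B4) 3 = 4032" "fps_nth (A4 * B4) 4 = 9216"
  by (simp_all only: fps_mult_nth_le4 A4_nth B4_nth, simp_all)

lemma BB_nth:
  "fps_nth (B4 * B4) 0 = 9" "fps_nth (B4 * B4) (Suc 0) = 144" "fps_nth (B4 * B4) 2 = 1008" "fps_nth (B4 * B4) 3 = 4032" "fps_nth (B4 * B4) 4 = 10224"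
  by (simp_all only: fps_mult_nth_le4 B4_nth, simp_all)

text \<open>Triple products are associated to the right, the shape that \<open>mult.assoc\<close>
  produces in \<open>rel4_nth\<close>.\<close>

lemma AAA_nth:
  "fps_nth (A4 * (A4 * A4)) 0 = 0" "fps_nth (A4 * (A4 * A4)) (Suc 0) = 0" "fps_nth (A4 * (A4 * A4)) 2 = 0" "fps_nth (A4 * (A4 * A4)) 3 = 110592" "fps_nth (A4 * (A4 * A4)) 4 = 0"
  by (simp_all only: fps_mult_nth_le4 A4_nth AA_nth, simp_all)

lemma AAB_nth:
  "fps_nth (A4 * (A4 * B4)) 0 = 0" "fps_nth (A4 * (A4 * B4)) (Suc 0) = 0" "fps_nth (A4 * (A4 * B4)) 2 = 6912" "fps_nth (A4 * (A4 * B4)) 3 = 55296" "fps_nth (A4 * (A4 * B4)) 4 = 221184"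
  by (simp_all only: fps_mult_nth_le4 A4_nth B4_nth AB_nth, simp_all)

lemma ABB_nth:
  "fps_nth (A4 * (B4 * B4)) 0 = 0" "fps_nth (A4 * (B4 * B4)) (Suc 0) = 432" "fps_nth (A4 * (B4 * B4)) 2 = 6912" "fps_nth (A4 * (B4 * B4)) 3 = 50112" "fps_nth (A4 * (B4 * B4)) 4 = 221184"
  by (simp_all only: fps_mult_nth_le4 A4_nth B4_nth BB_nth, simp_all)

lemma BBB_nth:
  "fps_nth (B4 * (B4 * B4)) 0 = 27" "fps_nth (B4 * (B4 * B4)) (Suc 0) = 648" "fps_nth (B4 * (B4 * B4)) 2 = 7128" "fps_nth (B4 * (B4 * B4)) 3 = 47520" "fps_nth (B4 * (B4 * B4)) 4 = 214488"
  by (simp_all only: fps_mult_nth_le4 B4_nth BB_nth, simp_all)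

text \<open>The defects of the expected expressions of E_4 and E_6 at q, q^2, q^4 as quadratic and
  cubic forms in the two theta series; the factors 9, 144, 27, 54, 1728 clear denominators.\<close>

definition rQ1 :: "complex fps" where "rQ1 = 9 * Q1 - (A4^2 + 14 * A4 * B4 + B4^2)"
definition rQ2 :: "complex fps" where "rQ2 = 9 * Q2 - (A4^2 - A4 * B4 + B4^2)"
definition rQ4 :: "complex fps" where "rQ4 = 144 * Q4 - (A4^2 - 16 * A4 * B4 + 16 * B4^2)"
definition rR1 :: "complex fps" where "rR1 = 27 * R1 - (A4^3 - 33 * A4^2 * B4 - 33 * A4 * B4^2 + B4^3)"
definition rR2 :: "complex fps" where "rR2 = 54 * R2 - (2 * A4^3 - 3 * A4^2 * B4 - 3 * A4 * B4^2 + 2 * B4^3)"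
definition rR4 :: "complex fps" where "rR4 = 1728 * R4 - (A4^3 + 30 * A4^2 * B4 - 96 * A4 * B4^2 + 64 * B4^3)"

lemmas rel4_defs = rQ1_def rQ2_def rQ4_def rR1_def rR2_def rR4_def

lemma qD_square: "qD (f ^ 2) = 2 * f * qD f"
  by (simp add: qD_power)

lemma qD_cube: "qD (f ^ 3) = 3 * f ^ 2 * qD f"
  by (simp add: qD_power)

lemma P1_A4: "3 * P1 = 6 * P2 - A4 - B4"
  by (simp add: A4_def B4_def)

lemma P4_A4: "12 * P4 = 6 * P2 + 2 * B4 - A4"
  by (simp add: A4_def B4_def)

text \<open>Ramanujan's equation for P produces \<open>Q1\<close>, \<open>Q2\<close>,
  \<open>Q4\<close>. Each is replaced by its quadratic form plus its defect; without the last three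
  terms the equation closes up in \<open>P2\<close>, \<open>A4\<close>, \<open>B4\<close>.\<close>

lemma qD_A4: "108 * qD A4 = 12 * A4 * (3 * P2 + 2 * B4 - A4) + 2 * rQ1 - 12 * rQ2 + rQ4"
  using qD_eis1(1) qD_eis2(1) qD_eis4(1) unfolding A4_def B4_def rel4_defs qD_diff qD_mult qD_const by algebra

lemma qD_B4: "108 * qD B4 = 12 * B4 * (3 * P2 + 2 * A4 - B4) + rQ1 - rQ4"
  using qD_eis1(1) qD_eis2(1) qD_eis4(1) unfolding A4_def B4_def rel4_defs qD_diff qD_mult qD_const by algebra

text \<open>A row of the system by the chain rule: \<open>2 * A4 + 14 * B4\<close> and
  \<open>14 * A4 + 2 * B4\<close> are the partial derivatives of the quadratic form in
  \<open>rQ1\<close>, multiplied by the defect terms of \<open>qD_A4\<close> and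
  \<open>qD_B4\<close>. The remainder, with \<open>36 * P1\<close> and -12, is Ramanujan's equation
  for Q.\<close>

lemma qD_rQ1:
  "108 * qD rQ1 = (36 * P1 - 2 * (2 * A4 + 14 * B4) - (14 * A4 + 2 * B4)) * rQ1 + (0 + 12 * (2 * A4 + 14 * B4)) * rQ2 + (0 - (2 * A4 + 14 * B4) + (14 * A4 + 2 * B4)) * rQ4 + (-12) * rR1 + (0) * rR2 + (0) * rR4"
  using qD_eis1(2) qD_A4 qD_B4 P1_A4 P4_A4
  unfolding rel4_defs qD_diff qD_add qD_mult qD_square qD_cube qD_const
  by algebra

lemma qD_rQ2:
  "108 * qD rQ2 = (0 - 2 * (2 * A4 - B4) - (2 * B4 - A4)) * rQ1 + (72 * P2 + 12 * (2 * A4 - B4)) * rQ2 + (0 - (2 * A4 - B4) + (2 * B4 - A4)) * rQ4 + (0) * rR1 + (-12) * rR2 + (0) * rR4"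
  using qD_eis2(2) qD_A4 qD_B4 P1_A4 P4_A4
  unfolding rel4_defs qD_diff qD_add qD_mult qD_square qD_cube qD_const
  by algebra

lemma qD_rQ4:
  "108 * qD rQ4 = (0 - 2 * (2 * A4 - 16 * B4) - (32 * B4 - 16 * A4)) * rQ1 + (0 + 12 * (2 * A4 - 16 * B4)) * rQ2 + (144 * P4 - (2 * A4 - 16 * B4) + (32 * B4 - 16 * A4)) * rQ4 + (0) * rR1 + (0) * rR2 + (-12) * rR4"
  using qD_eis4(2) qD_A4 qD_B4 P1_A4 P4_A4
  unfolding rel4_defs qD_diff qD_add qD_mult qD_square qD_cube qD_const
  by algebra

text \<open>The square \<open>Q1 ^ 2\<close> in Ramanujan's third equation is linearised by a
  difference of squares: (9 Q1)^2 minus the square of the form is their sum times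
  \<open>rQ1\<close>. So Q1 itself may appear in a coefficient while the system stays linear in the
  defects.\<close>

lemma qD_rR1:
  "108 * qD rR1 = (-18 * (9 * Q1 + A4^2 + 14 * A4 * B4 + B4^2) - 2 * (3 * A4^2 - 66 * A4 * B4 - 33 * B4^2) - (3 * B4^2 - 66 * A4 * B4 - 33 * A4^2)) * rQ1 + (0 + 12 * (3 * A4^2 - 66 * A4 * B4 - 33 * B4^2)) * rQ2 + (0 - (3 * A4^2 - 66 * A4 * B4 - 33 * B4^2) + (3 * B4^2 - 66 * A4 * B4 - 33 * A4^2)) * rQ4 + (54 * P1) * rR1 + (0) * rR2 + (0) * rR4"
  using qD_eis1(3) qD_A4 qD_B4 P1_A4 P4_A4
  unfolding rel4_defs qD_diff qD_add qD_mult qD_square qD_cube qD_const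
  by algebra

lemma qD_rR2:
  "108 * qD rR2 = (0 - 2 * (6 * A4^2 - 6 * A4 * B4 - 3 * B4^2) - (6 * B4^2 - 6 * A4 * B4 - 3 * A4^2)) * rQ1 + (-72 * (9 * Q2 + A4^2 - A4 * B4 + B4^2) + 12 * (6 * A4^2 - 6 * A4 * B4 - 3 * B4^2)) * rQ2 + (0 - (6 * A4^2 - 6 * A4 * B4 - 3 * B4^2) + (6 * B4^2 - 6 * A4 * B4 - 3 * A4^2)) * rQ4 + (0) * rR1 + (108 * P2) * rR2 + (0) * rR4"
  using qD_eis2(3) qD_A4 qD_B4 P1_A4 P4_A4
  unfolding rel4_defs qD_diff qD_add qD_mult qD_square qD_cube qD_const
  by algebra

lemma qD_rR4:
  "108 * qD rR4 = (0 - 2 * (3 * A4^2 + 60 * A4 * B4 - 96 * B4^2) - (30 * A4^2 - 192 * A4 * B4 + 192 * B4^2)) * rQ1 + (0 + 12 * (3 * A4^2 + 60 * A4 * B4 - 96 * B4^2)) * rQ2 + (-18 * (144 * Q4 + A4^2 - 16 * A4 * B4 + 16 * B4^2) - (3 * A4^2 + 60 * A4 * B4 - 96 * B4^2) + (30 * A4^2 - 192 * A4 * B4 + 192 * B4^2)) * rQ4 + (0) * rR1 + (0) * rR2 + (216 * P4) * rR4"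
  using qD_eis4(3) qD_A4 qD_B4 P1_A4 P4_A4
  unfolding rel4_defs qD_diff qD_add qD_mult qD_square qD_cube qD_const
  by algebra

definition rel4 :: "nat \<Rightarrow> complex fps" where
  "rel4 i = [rQ1, rQ2, rQ4, rR1, rR2, rR4] ! i"

text \<open>
  The matrix results from Ramanujan's equations by substituting \<open>9 Q1 = \<dots> + rQ1\<close> and so on.
  At \<open>q = 0\<close> the eigenvalues of \<open>mat4 / 108\<close> are 0, 2 and 4, which is why five coefficients are checked.
\<close>

definition mat4 :: "nat \<Rightarrow> nat \<Rightarrow> complex fps" where
  "mat4 i j = [[36 * P1 - 2 * (2 * A4 + 14 * B4) - (14 * A4 + 2 * B4), 0 + 12 * (2 * A4 + 14 * B4), 0 - (2 * A4 + 14 * B4) + (14 * A4 + 2 * B4), -12, 0, 0],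
     [0 - 2 * (2 * A4 - B4) - (2 * B4 - A4), 72 * P2 + 12 * (2 * A4 - B4), 0 - (2 * A4 - B4) + (2 * B4 - A4), 0, -12, 0],
     [0 - 2 * (2 * A4 - 16 * B4) - (32 * B4 - 16 * A4), 0 + 12 * (2 * A4 - 16 * B4), 144 * P4 - (2 * A4 - 16 * B4) + (32 * B4 - 16 * A4), 0, 0, -12],
     [-18 * (9 * Q1 + A4^2 + 14 * A4 * B4 + B4^2) - 2 * (3 * A4^2 - 66 * A4 * B4 - 33 * B4^2) - (3 * B4^2 - 66 * A4 * B4 - 33 * A4^2), 0 + 12 * (3 * A4^2 - 66 * A4 * B4 - 33 * B4^2), 0 - (3 * A4^2 - 66 * A4 * B4 - 33 * B4^2) + (3 * B4^2 - 66 * A4 * B4 - 33 * A4^2), 54 * P1, 0, 0],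
     [0 - 2 * (6 * A4^2 - 6 * A4 * B4 - 3 * B4^2) - (6 * B4^2 - 6 * A4 * B4 - 3 * A4^2), -72 * (9 * Q2 + A4^2 - A4 * B4 + B4^2) + 12 * (6 * A4^2 - 6 * A4 * B4 - 3 * B4^2), 0 - (6 * A4^2 - 6 * A4 * B4 - 3 * B4^2) + (6 * B4^2 - 6 * A4 * B4 - 3 * A4^2), 0, 108 * P2, 0],
     [0 - 2 * (3 * A4^2 + 60 * A4 * B4 - 96 * B4^2) - (30 * A4^2 - 192 * A4 * B4 + 192 * B4^2), 0 + 12 * (3 * A4^2 + 60 * A4 * B4 - 96 * B4^2), -18 * (144 * Q4 + A4^2 - 16 * A4 * B4 + 16 * B4^2) - (3 * A4^2 + 60 * A4 * B4 - 96 * B4^2) + (30 * A4^2 - 192 * A4 * B4 + 192 * B4^2), 0, 0, 216 * P4]] ! i ! j"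

lemma less_6_iff: "i < 6 \<longleftrightarrow> i = 0 \<or> i = Suc 0 \<or> i = 2 \<or> i = 3 \<or> i = 4 \<or> i = (5::nat)"
  by auto

lemma sum_6: "(\<Sum>i<6. f i) = f 0 + f (Suc 0) + f 2 + f 3 + f 4 + f (5::nat)" for f :: "nat \<Rightarrow> 'a :: comm_monoid_add"
  by (simp add: numeral_eq_Suc)

lemma less_5_iff: "i < 5 \<longleftrightarrow> i = 0 \<or> i = Suc 0 \<or> i = 2 \<or> i = 3 \<or> i = (4::nat)"
  by auto

lemma rel4_nth:
  assumes "i < 6" "n < 5"
  shows "fps_nth (rel4 i) n = 0"
proof -
  have cube: "f ^ 3 = f * (f * f)" and square: "f ^ 2 = f * f" for f :: "complex fps"
    by (simp_all add: power2_eq_square power3_eq_cube mult.assoc)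
  have "fps_nth rQ1 n = 0 \<and> fps_nth rQ2 n = 0 \<and> fps_nth rQ4 n = 0 \<and> fps_nth rR1 n = 0 \<and> fps_nth rR2 n = 0 \<and> fps_nth rR4 n = 0"
    using assms(2) unfolding less_5_iff
    by (elim disjE; simp only: rel4_defs cube square mult.assoc fps_sub_nth fps_add_nth fps_mult_numeral_left
       AA_nth AB_nth BB_nth AAA_nth AAB_nth ABB_nth BBB_nth P_eis_nth Q_eis_nth R_eis_nth Q2_nth Q4_nth R2_nth R4_nth) simp_all
  then show ?thesis
    using assms(1) by (auto simp: less_6_iff rel4_def)
qed

lemma rel4_ode:
  assumes "i < 6"
  shows "fps_const 108 * qD (rel4 i) = (\<Sum>j<6. mat4 i j * rel4 j)"
  using assms unfolding less_6_iff sum_6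
  by (elim disjE) (simp_all add: rel4_def mat4_def qD_rQ1 qD_rQ2 qD_rQ4 qD_rR1 qD_rR2 qD_rR4 flip: numeral_fps_const)

lemma of_nat_neq: "m \<noteq> n \<Longrightarrow> (of_nat m :: complex) - of_nat n \<noteq> 0"
  by simp

text \<open>At q = 0 one has \<open>A4\<close> = 0, \<open>B4\<close> = 3 and all P, Q equal to 1.
  The unknowns 1, 2, 4, 5 (levels 2 and 4) then form a closed block with characteristic polynomial
  N^2 (N - 2) (N - 4); once they vanish, 0 and 3 satisfy a system with characteristic polynomial
  N^2.\<close>

lemma rel4_nonsing:
  fixes c :: "nat \<Rightarrow> complex"
  assumes n: "n \<ge> 5"
    and eq: "\<And>i. i < 6 \<Longrightarrow> 108 * (of_nat n * c i) = (\<Sum>j<6. fps_nth (mat4 i j) 0 * c j)"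
    and i: "i < 6"
  shows "c i = 0"
proof -
  define N :: complex where "N = of_nat n"
  have N: "N \<noteq> 0" "N - 2 \<noteq> 0" "N - 4 \<noteq> 0"
    using n of_nat_neq[of n 0] of_nat_neq[of n 2] of_nat_neq[of n 4] by (simp_all add: N_def)
  have e: "108 * (N * c 0) = -54 * c 0 + 504 * c (Suc 0) - 36 * c 2 - 12 * c 3"
    "108 * (N * c (Suc 0)) = 36 * c (Suc 0) + 9 * c 2 - 12 * c 4"
    "108 * (N * c 2) = -576 * c (Suc 0) + 288 * c 2 - 12 * c 5"
    "108 * (N * c 3) = 243 * c 0 - 3564 * c (Suc 0) + 324 * c 2 + 54 * c 3"
    "108 * (N * c 4) = -1620 * c (Suc 0) + 81 * c 2 + 108 * c 4"
    "108 * (N * c 5) = -10368 * c (Suc 0) - 2592 * c 2 + 216 * c 5"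
    using eq[of 0] eq[of "Suc 0"] eq[of 2] eq[of 3] eq[of 4] eq[of 5]
    unfolding N_def sum_6
    by (simp_all add: mat4_def fps_nth_power_0 A4_nth B4_nth P_eis_nth Q_eis_nth P2_nth P4_nth Q2_nth Q4_nth)
  have "N * (N * ((N - 2) * ((N - 4) * c (Suc 0)))) = 0"
    using e by algebra
  then have c1: "c (Suc 0) = 0" using N by simp
  have "N * (N * ((N - 2) * ((N - 4) * c 2))) = 0"
    using e by algebra
  then have c2: "c 2 = 0" using N by simp
  have c4: "c 4 = 0" using e(2) c1 c2 by simp
  have c5: "c 5 = 0" using e(3) c1 c2 by simp
  have "N * (N * c 0) = 0"
    using e(1,4) c1 c2 by algebra
  then have c0: "c 0 = 0" using N by simp
  have c3: "c 3 = 0" using e(1) c0 c1 c2 by simp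
  show ?thesis
    using i c0 c1 c2 c3 c4 c5 unfolding less_6_iff by auto
qed

lemma rel4_zero: "rQ1 = 0" "rQ2 = 0" "rQ4 = 0" "rR1 = 0" "rR2 = 0" "rR4 = 0"
proof -
  have *: "rel4 i = 0" if "i < 6" for i
    using that rel4_ode rel4_nth rel4_nonsing
    by (intro qD_linear_system_zero[where I = "{..<6}" and N = 108 and v = rel4 and M = mat4 and ?n0.0 = 5]) auto
  from *[of 0] *[of "Suc 0"] *[of 2] *[of 3] *[of 4] *[of 5]
  show "rQ1 = 0" "rQ2 = 0" "rQ4 = 0" "rR1 = 0" "rR2 = 0" "rR4 = 0"
    by (simp_all add: rel4_def)
qed

definition a4 :: "complex fps" where "a4 = fps_const (1/3) * A4"
definition b4 :: "complex fps" where "b4 = fps_const (1/3) * B4"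

lemma fps_numeral_cancel: "numeral k * f = numeral k * g \<Longrightarrow> f = (g :: complex fps)"
  by simp

lemma A4_a4: "A4 = 3 * a4" and B4_b4: "B4 = 3 * b4"
  by (simp_all add: a4_def b4_def fps_numeral_mult_const)

lemma qD_a4: "3 * qD a4 = a4 * (P2 + 2 * b4 - a4)"
proof -
  have "324 * qD a4 = 36 * a4 * (3 * P2 + 6 * b4 - 3 * a4)"
    using qD_A4 unfolding rel4_zero A4_a4 B4_b4 qD_mult qD_const by simp
  then have "108 * (3 * qD a4) = 108 * (a4 * (P2 + 2 * b4 - a4))"
    by algebra
  then show ?thesis
    by (rule fps_numeral_cancel)
qed

lemma qD_b4: "3 * qD b4 = b4 * (P2 + 2 * a4 - b4)"
proof -
  have "324 * qD b4 = 36 * b4 * (3 * P2 + 6 * a4 - 3 * b4)"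
    using qD_B4 unfolding rel4_zero A4_a4 B4_b4 qD_mult qD_const by simp
  then have "108 * (3 * qD b4) = 108 * (b4 * (P2 + 2 * a4 - b4))"
    by algebra
  then show ?thesis
    by (rule fps_numeral_cancel)
qed

lemma Q1_4: "Q1 = a4 ^ 2 + 14 * a4 * b4 + b4 ^ 2"
proof -
  have "9 * Q1 = 9 * (a4 ^ 2 + 14 * a4 * b4 + b4 ^ 2)"
    using rel4_zero(1) unfolding rQ1_def A4_a4 B4_b4 by algebra
  then show ?thesis
    by (rule fps_numeral_cancel)
qed

lemma Q2_4: "Q2 = a4 ^ 2 - a4 * b4 + b4 ^ 2"
proof -
  have "9 * Q2 = 9 * (a4 ^ 2 - a4 * b4 + b4 ^ 2)"
    using rel4_zero(2) unfolding rQ2_def A4_a4 B4_b4 by algebra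
  then show ?thesis
    by (rule fps_numeral_cancel)
qed

lemma Q4_4: "16 * Q4 = a4 ^ 2 - 16 * a4 * b4 + 16 * b4 ^ 2"
proof -
  have "9 * (16 * Q4) = 9 * (a4 ^ 2 - 16 * a4 * b4 + 16 * b4 ^ 2)"
    using rel4_zero(3) unfolding rQ4_def A4_a4 B4_b4 by algebra
  then show ?thesis
    by (rule fps_numeral_cancel)
qed

lemma P1_4: "P1 = 2 * P2 - a4 - b4"
proof -
  have "3 * P1 = 3 * (2 * P2 - a4 - b4)"
    using P1_A4 unfolding A4_a4 B4_b4 by algebra
  then show ?thesis
    by (rule fps_numeral_cancel)
qed

lemma P4_4: "4 * P4 = 2 * P2 + 2 * b4 - a4"
proof -
  have "3 * (4 * P4) = 3 * (2 * P2 + 2 * b4 - a4)"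
    using P4_A4 unfolding A4_a4 B4_b4 by algebra
  then show ?thesis
    by (rule fps_numeral_cancel)
qed

lemma qD_P2_4: "6 * qD P2 = P2 ^ 2 - a4 ^ 2 + a4 * b4 - b4 ^ 2"
proof -
  have "2 * (6 * qD P2) = 2 * (P2 ^ 2 - a4 ^ 2 + a4 * b4 - b4 ^ 2)"
    using qD_eis2(1) unfolding Q2_4 by algebra
  then show ?thesis
    by (rule fps_numeral_cancel)
qed

lemma ab4_nth: "fps_nth a4 0 = 0" "fps_nth a4 (Suc 0) = 16" "fps_nth b4 0 = 1"
  by (simp_all add: a4_def b4_def A4_nth B4_nth)

section \<open>Eisenstein series of level 3\<close>

text \<open>
  With the cubic theta function \<open>a(q)\<close> of the Borweins, \<open>Y3 = 2 a(q)\<^sup>2\<close>.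
\<close>

definition Y3 :: "complex fps" where "Y3 = 3 * P3 - P1"
definition K3 :: "complex fps" where "K3 = 9 * Q3 - Q1"
text \<open>Weight 6 in level 3 has dimension three, while \<open>Y3 ^ 3\<close> and
  \<open>Y3 * K3\<close> span only two dimensions. The third direction used here is
  \<open>K3 ^ 2 / Y3\<close>, which brings in the inverse.\<close>

definition I3 :: "complex fps" where "I3 = inverse Y3"

lemma Y3_nth:
  "fps_nth (Y3) 0 = 2" "fps_nth (Y3) (Suc 0) = 24" "fps_nth (Y3) 2 = 72" "fps_nth (Y3) 3 = 24" "fps_nth (Y3) 4 = 168"
  by (simp_all add: fps_numeral_nth Y3_def P_eis_nth P3_nth)

lemma K3_nth:
  "fps_nth (K3) 0 = 8" "fps_nth (K3) (Suc 0) = (-240)" "fps_nth (K3) 2 = (-2160)" "fps_nth (K3) 3 = (-4560)" "fps_nth (K3) 4 = (-17520)"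
  by (simp_all add: fps_numeral_nth K3_def Q_eis_nth Q3_nth)

lemma YY_nth:
  "fps_nth (Y3 * Y3) 0 = 4" "fps_nth (Y3 * Y3) (Suc 0) = 96" "fps_nth (Y3 * Y3) 2 = 864" "fps_nth (Y3 * Y3) 3 = 3552" "fps_nth (Y3 * Y3) 4 = 7008"
  by (simp_all only: fps_mult_nth_le4 Y3_nth, simp_all)

lemma YYYY_nth:
  "fps_nth ((Y3 * Y3) * (Y3 * Y3)) 0 = 16" "fps_nth ((Y3 * Y3) * (Y3 * Y3)) (Suc 0) = 768" "fps_nth ((Y3 * Y3) * (Y3 * Y3)) 2 = 16128" "fps_nth ((Y3 * Y3) * (Y3 * Y3)) 3 = 194304" "fps_nth ((Y3 * Y3) * (Y3 * Y3)) 4 = 1484544"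
  by (simp_all only: fps_mult_nth_le4 Y3_nth YY_nth, simp_all)

lemma YYK_nth:
  "fps_nth ((Y3 * Y3) * K3) 0 = 32" "fps_nth ((Y3 * Y3) * K3) (Suc 0) = (-192)" "fps_nth ((Y3 * Y3) * K3) 2 = (-24768)" "fps_nth ((Y3 * Y3) * K3) 3 = (-404544)" "fps_nth ((Y3 * Y3) * K3) 4 = (-3170496)"
  by (simp_all only: fps_mult_nth_le4 Y3_nth K3_nth YY_nth, simp_all)

lemma KK_nth:
  "fps_nth (K3 * K3) 0 = 64" "fps_nth (K3 * K3) (Suc 0) = (-3840)" "fps_nth (K3 * K3) 2 = 23040" "fps_nth (K3 * K3) 3 = 963840" "fps_nth (K3 * K3) 4 = 6574080"
  by (simp_all only: fps_mult_nth_le4 K3_nth, simp_all)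

lemma YR1_nth:
  "fps_nth (Y3 * R1) 0 = 2" "fps_nth (Y3 * R1) (Suc 0) = (-984)" "fps_nth (Y3 * R1) 2 = (-45288)" "fps_nth (Y3 * R1) 3 = (-681384)" "fps_nth (Y3 * R1) 4 = (-5226312)"
  by (simp_all only: fps_mult_nth_le4 Y3_nth R_eis_nth, simp_all)

lemma YR3_nth:
  "fps_nth (Y3 * R3) 0 = 2" "fps_nth (Y3 * R3) (Suc 0) = 24" "fps_nth (Y3 * R3) 2 = 72" "fps_nth (Y3 * R3) 3 = (-984)" "fps_nth (Y3 * R3) 4 = (-11928)"
  by (simp_all only: fps_mult_nth_le4 Y3_nth R3_nth, simp_all)

text \<open>A single defect covers weight 4: \<open>K3\<close> is by definition another combination
  of \<open>Q1\<close> and \<open>Q3\<close>, so the two together determine both.\<close>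

definition tQ :: "complex fps" where "tQ = 2 * Q1 + 18 * Q3 - 5 * Y3^2"
definition tR1 :: "complex fps" where "tR1 = 16 * R1 + 22 * Y3^3 - 14 * Y3 * K3 + K3^2 * I3"
definition tR3 :: "complex fps" where "tR3 = 432 * R3 - 22 * Y3^3 - 14 * Y3 * K3 - K3^2 * I3"

lemmas rel3_defs = tQ_def tR1_def tR3_def

lemma Y3_I3: "Y3 * I3 = 1"
  unfolding I3_def by (rule inverse_mult_eq_1') (simp add: Y3_nth)

lemma I3_nth: "fps_nth I3 0 = 1 / 2"
  by (simp add: I3_def Y3_nth)

lemma Y3_P3: "3 * P3 = Y3 + P1"
  by (simp add: Y3_def)

lemma qD_I3: "qD I3 = - (I3 ^ 2) * qD Y3"
proof -
  have "Y3 * qD I3 + qD Y3 * I3 = 0"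
    using arg_cong[OF Y3_I3, of qD] unfolding qD_mult qD_const .
  then show ?thesis
    using Y3_I3 by algebra
qed

lemma qD_Y3: "12 * qD Y3 = Y3 ^ 2 + 2 * Y3 * P1 - K3"
  using qD_eis1(1) qD_eis3(1) unfolding Y3_def K3_def qD_diff qD_mult qD_const by algebra

lemma qD_K3: "48 * qD K3 = -24 * Y3 ^ 3 + 8 * Y3 * K3 + 16 * P1 * K3 - 2 * K3 ^ 2 * I3 + 4 * Y3 * tQ + tR1 - tR3"
proof -
  have "48 * qD K3 = 144 * 3 * (P3 * Q3 - R3) - 16 * (P1 * Q1 - R1)"
    using qD_eis1(2) qD_eis3(2) unfolding K3_def qD_diff qD_mult qD_const by algebra
  then show ?thesis
    using Y3_P3 K3_def unfolding rel3_defs by algebra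
qed

lemma qD_tQ:
  "48 * qD tQ = (8 * P1 + 24 * P3) * tQ + (-2) * tR1 + (-2) * tR3"
  using qD_eis1(2) qD_eis3(2) qD_Y3 Y3_P3 K3_def Y3_I3
  unfolding rel3_defs qD_diff qD_add qD_mult qD_square qD_cube qD_const qD_I3
  by algebra

lemma qD_tR1:
  "48 * qD tR1 = (-24 * (4 * Q1 + 5 * Y3^2 - 2 * K3) + (2 * K3 * I3 - 14 * Y3) * (4 * Y3)) * tQ + (24 * P1 + (2 * K3 * I3 - 14 * Y3)) * tR1 + (- (2 * K3 * I3 - 14 * Y3)) * tR3"
  using qD_eis1(3) qD_Y3 qD_K3 Y3_P3 K3_def Y3_I3
  unfolding rel3_defs qD_diff qD_add qD_mult qD_square qD_cube qD_const qD_I3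
  by algebra

lemma qD_tR3:
  "48 * qD tR3 = (-24 * (36 * Q3 + 5 * Y3^2 + 2 * K3) - (14 * Y3 + 2 * K3 * I3) * (4 * Y3)) * tQ + (- (14 * Y3 + 2 * K3 * I3)) * tR1 + (72 * P3 + (14 * Y3 + 2 * K3 * I3)) * tR3"
  using qD_eis3(3) qD_Y3 qD_K3 Y3_P3 K3_def Y3_I3
  unfolding rel3_defs qD_diff qD_add qD_mult qD_square qD_cube qD_const qD_I3
  by algebra

definition rel3 :: "nat \<Rightarrow> complex fps" where
  "rel3 i = [tQ, tR1, tR3] ! i"

definition mat3 :: "nat \<Rightarrow> nat \<Rightarrow> complex fps" where
  "mat3 i j = [[8 * P1 + 24 * P3, -2, -2],
     [-24 * (4 * Q1 + 5 * Y3^2 - 2 * K3) + (2 * K3 * I3 - 14 * Y3) * (4 * Y3), 24 * P1 + (2 * K3 * I3 - 14 * Y3), - (2 * K3 * I3 - 14 * Y3)],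
     [-24 * (36 * Q3 + 5 * Y3^2 + 2 * K3) - (14 * Y3 + 2 * K3 * I3) * (4 * Y3), - (14 * Y3 + 2 * K3 * I3), 72 * P3 + (14 * Y3 + 2 * K3 * I3)]] ! i ! j"

lemma less_3_iff: "i < 3 \<longleftrightarrow> i = 0 \<or> i = Suc 0 \<or> i = (2::nat)"
  by auto

lemma sum_3: "(\<Sum>i<3. f i) = f 0 + f (Suc 0) + f (2::nat)" for f :: "nat \<Rightarrow> 'a :: comm_monoid_add"
  by (simp add: numeral_eq_Suc)

lemma rel3_nth:
  assumes "i < 3" "n < 5"
  shows "fps_nth (rel3 i) n = 0"
proof -
  have e1: "tQ = 2 * Q1 + 18 * Q3 - 5 * (Y3 * Y3)"
    by (simp add: tQ_def power2_eq_square)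
  \<comment> \<open>Multiplication by \<open>Y3\<close> removes \<open>I3\<close>, so the tabulated
    products suffice. As \<open>Y3\<close> has constant term 2, it is a unit and vanishing below
    order 5 carries back to the defects.\<close>
  have e2: "Y3 * tR1 = 16 * (Y3 * R1) + 22 * ((Y3 * Y3) * (Y3 * Y3)) - 14 * ((Y3 * Y3) * K3) + K3 * K3"
    using Y3_I3 unfolding tR1_def by algebra
  have e3: "Y3 * tR3 = 432 * (Y3 * R3) - 22 * ((Y3 * Y3) * (Y3 * Y3)) - 14 * ((Y3 * Y3) * K3) - K3 * K3"
    using Y3_I3 unfolding tR3_def by algebra
  have *: "fps_nth tQ n = 0 \<and> fps_nth (Y3 * tR1) n = 0 \<and> fps_nth (Y3 * tR3) n = 0" if "n < 5" for n
    using that unfolding less_5_iff e2 e3 e1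
    by (elim disjE; simp only: fps_sub_nth fps_add_nth fps_mult_numeral_left
       YY_nth YYYY_nth YYK_nth KK_nth YR1_nth YR3_nth Q_eis_nth Q3_nth) simp_all
  have **: "fps_nth f n = 0" if "\<And>n. n < 5 \<Longrightarrow> fps_nth (Y3 * f) n = 0" for f
  proof -
    have "f = I3 * (Y3 * f)"
      using Y3_I3 by algebra
    then have "fps_nth f n = fps_nth (I3 * (Y3 * f)) n"
      by (rule arg_cong[of _ _ "\<lambda>h. fps_nth h n"])
    also have "\<dots> = 0"
      unfolding fps_mult_nth[of I3] using that assms(2) by (intro sum.neutral) auto
    finally show ?thesis .
  qed
  show ?thesis
    using assms *[OF assms(2)] **[of tR1] **[of tR3] * by (auto simp: less_3_iff rel3_def)
qed

lemma rel3_ode: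
  assumes "i < 3"
  shows "fps_const 48 * qD (rel3 i) = (\<Sum>j<3. mat3 i j * rel3 j)"
  using assms unfolding less_3_iff sum_3
  by (elim disjE) (simp_all add: rel3_def mat3_def qD_tQ qD_tR1 qD_tR3 flip: numeral_fps_const)

text \<open>The matrix at q = 0, divided by 48, has the eigenvalues 0, 0, 3; elimination leaves the
  factor N^2 (N - 3).\<close>

lemma rel3_nonsing:
  fixes c :: "nat \<Rightarrow> complex"
  assumes n: "n \<ge> 5"
    and eq: "\<And>i. i < 3 \<Longrightarrow> 48 * (of_nat n * c i) = (\<Sum>j<3. fps_nth (mat3 i j) 0 * c j)"
    and i: "i < 3"
  shows "c i = 0"
proof -
  define N :: complex where "N = of_nat n"
  have N: "N \<noteq> 0" "N - 3 \<noteq> 0"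
    using n of_nat_neq[of n 0] of_nat_neq[of n 3] by (simp_all add: N_def)
  have e: "48 * (N * c 0) = (32) * c 0 + (-2) * c (Suc 0) + (-2) * c 2"
    "48 * (N * c (Suc 0)) = (-352) * c 0 + (4) * c (Suc 0) + (20) * c 2"
    "48 * (N * c 2) = (-2016) * c 0 + (-36) * c (Suc 0) + (108) * c 2"
    using eq[of 0] eq[of "Suc 0"] eq[of 2]
    unfolding N_def sum_3
    by (simp_all add: mat3_def fps_nth_power_0 Y3_nth K3_nth I3_nth P_eis_nth Q_eis_nth P3_nth Q3_nth)
  have "N * (N * ((N - 3) * c 0)) = 0" "N * (N * ((N - 3) * c (Suc 0))) = 0" "N * (N * ((N - 3) * c 2)) = 0"
    using e by algebra+
  then show ?thesis
    using i N unfolding less_3_iff by auto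
qed

lemma rel3_zero: "tQ = 0" "tR1 = 0" "tR3 = 0"
proof -
  have *: "rel3 i = 0" if "i < 3" for i
    using that rel3_ode rel3_nth rel3_nonsing
    by (intro qD_linear_system_zero[where I = "{..<3}" and N = 48 and v = rel3 and M = mat3 and ?n0.0 = 5]) auto
  from *[of 0] *[of "Suc 0"] *[of 2]
  show "tQ = 0" "tR1 = 0" "tR3 = 0"
    by (simp_all add: rel3_def)
qed

text \<open>
  \<open>w3 = (1 - x) / (1 + x)\<close> for the eta quotient \<open>x = 27 \<eta>(q\<^sup>3)\<^sup>1\<^sup>2 / \<eta>(q)\<^sup>1\<^sup>2\<close>.
\<close>

definition Z3 :: "complex fps" where "Z3 = fps_const (1/2) * Y3"
definition w3 :: "complex fps" where "w3 = fps_const (1/2) * K3 * I3 ^ 2"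

lemma Y3_Z3: "Y3 = 2 * Z3"
  by (simp add: Z3_def fps_numeral_mult_const)

lemma K3_w3: "K3 = 8 * (Z3 ^ 2 * w3)"
proof -
  have "2 * w3 = K3 * I3 ^ 2"
    by (simp add: w3_def fps_numeral_mult_const mult.assoc)
  then have "K3 = 2 * w3 * Y3 ^ 2"
    using Y3_I3 by algebra
  then show ?thesis
    unfolding Y3_Z3 by algebra
qed

lemma I3_Z3: "2 * (Z3 * I3) = 1"
  using Y3_I3 unfolding Y3_Z3 by algebra

lemma Z3_w3_Eisenstein: "8 * (Z3 ^ 2 * w3) = 9 * Q3 - Q1"
  using K3_w3 K3_def by simp

lemma Q1_3: "Q1 = Z3 ^ 2 * (5 - 4 * w3)"
proof -
  have "4 * Q1 = 4 * (Z3 ^ 2 * (5 - 4 * w3))"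
    using rel3_zero(1) K3_w3 unfolding tQ_def Y3_Z3 K3_def by algebra
  then show ?thesis by (rule fps_numeral_cancel)
qed

lemma qD_Z3: "6 * qD Z3 = Z3 * (Z3 + P1 - 2 * w3 * Z3)"
proof -
  have "4 * (6 * qD Z3) = 4 * (Z3 * (Z3 + P1 - 2 * w3 * Z3))"
    using qD_Y3 unfolding K3_w3 Y3_Z3 qD_mult qD_const by algebra
  then show ?thesis by (rule fps_numeral_cancel)
qed

text \<open>Compare \<open>qD_K3\<close>, with defects now zero, to the derivative of
  \<open>8 * (Z3 ^ 2 * w3)\<close>. The terms containing \<open>P1\<close> cancel, as they must for
  a function of weight 0.\<close>

lemma qD_w3: "2 * qD w3 = - (1 - w3 ^ 2) * Z3"
proof -
  have K: "qD K3 = 8 * (2 * Z3 * qD Z3 * w3 + Z3 ^ 2 * qD w3)"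
    unfolding K3_w3 qD_mult qD_square qD_const by algebra
  have "384 * (Z3 ^ 2 * qD w3) = - 192 * (Z3 ^ 3 * (1 - w3 ^ 2))"
    using qD_K3 qD_Z3 I3_Z3 unfolding rel3_zero K unfolding Y3_Z3 K3_w3 by algebra
  then have "192 * (2 * qD w3) = 192 * (- (1 - w3 ^ 2) * Z3)"
    using I3_Z3 by algebra
  then show ?thesis by (rule fps_numeral_cancel)
qed

lemma Zw3_nth: "fps_nth Z3 0 = 1" "fps_nth w3 0 = 1"
  by (simp_all add: Z3_def w3_def Y3_nth K3_nth I3_nth fps_nth_power_0 power2_eq_square)

section \<open>Hypergeometric parametrizations\<close>

text \<open>The chain rule for q d/dq. It is phrased with the logarithmic derivative u because t has
  constant term 0 and cannot be inverted as a power series.\<close>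

lemma qD_compose:
  assumes "fps_nth t 0 = 0" "qD t = u * t"
  shows "qD (fps_compose f t) = u * fps_compose (qD f) t"
proof -
  have "qD (fps_compose f t) = fps_compose (fps_deriv f) t * qD t"
    by (simp add: qD_def fps_compose_deriv[OF assms(1)] mult_ac)
  also have "\<dots> = u * (fps_compose fps_X t * fps_compose (fps_deriv f) t)"
    using assms by (simp add: mult_ac)
  also have "fps_compose fps_X t * fps_compose (fps_deriv f) t = fps_compose (qD f) t"
    unfolding qD_def by (simp add: fps_compose_mult_distrib[OF assms(1)])
  finally show ?thesis .
qed

text \<open>
  The third-order hypergeometric equation is a symmetric square; with \<open>h\<close> the logarithmic
  derivative of \<open>Z\<close> it becomes the Riccati equation for \<open>h\<close>, in which the recurrence of \<open>a\<close>
  appears as the constant \<open>\<alpha>\<close>.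
\<close>

theorem hypergeometric_modular_parametrization:
  fixes Z w h t :: "complex fps" and a :: "nat \<Rightarrow> complex"
  assumes Z0: "fps_nth Z 0 = 1" and w0: "fps_nth w 0 = 1" and c: "c \<noteq> 0"
    and DZ: "qD Z = Z * h"
    and Dw: "2 * qD w = - (1 - w ^ 2) * Z"
    and Dh: "2 * qD h = h ^ 2 + fps_const \<alpha> * (1 - w ^ 2) * Z ^ 2"
    and t: "t = fps_const (1 / c) * (1 - w ^ 2)"
    and a0: "a 0 = 1"
    and rec: "\<And>n. of_nat (Suc n) ^ 3 * a (Suc n) = c * (of_nat n + 1/2) * (of_nat n ^ 2 + of_nat n + \<alpha>) * a n"
  shows "fps_compose (Abs_fps a) t = Z" "qD t = Z * w * t"
proof -
  have t0: "fps_nth t 0 = 0"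
    by (simp add: t w0 fps_nth_power_0)
  have ct: "1 - w ^ 2 = fps_const c * t"
    using c by (simp add: t flip: mult.assoc)
  have "qD t = fps_const (1 / c) * (- (w * (2 * qD w)))"
    by (simp add: t qD_mult qD_diff qD_square algebra_simps)
  also have "\<dots> = Z * w * t"
    unfolding Dw by (simp add: t algebra_simps)
  finally show Dt: "qD t = Z * w * t" .
  define F where "F = Abs_fps a"
  define F0 where "F0 = fps_compose F t"
  define F1 where "F1 = fps_compose (qD F) t"
  define F2 where "F2 = fps_compose (qD (qD F)) t"
  define F3 where "F3 = fps_compose (qD (qD (qD F))) t"
  have DF: "qD F0 = Z * w * F1" "qD F1 = Z * w * F2" "qD F2 = Z * w * F3"
    unfolding F0_def F1_def F2_def F3_def by (rule qD_compose[OF t0 Dt])+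
  \<comment> \<open>The recurrence as a differential equation: the bracket is twice (D + 1/2) (D^2 +
    D + \<open>\<alpha>\<close>) F, expanded, with D = \<open>qD\<close>.\<close>
  have "2 * qD (qD (qD F)) = fps_const c * fps_X *
     (2 * qD (qD (qD F)) + 3 * qD (qD F) + fps_const (2 * \<alpha> + 1) * qD F + fps_const \<alpha> * F)"
  proof (rule fps_ext)
    fix n
    show "fps_nth (2 * qD (qD (qD F))) n = fps_nth (fps_const c * fps_X *
     (2 * qD (qD (qD F)) + 3 * qD (qD F) + fps_const (2 * \<alpha> + 1) * qD F + fps_const \<alpha> * F)) n"
    proof (cases n)
      case (Suc m)
      have "2 * (of_nat (Suc m) ^ 3 * a (Suc m)) = 2 * (c * (of_nat m + 1/2) * (of_nat m ^ 2 + of_nat m + \<alpha>) * a m)"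
        unfolding rec ..
      then show ?thesis
        by (simp add: Suc F_def mult.assoc del: of_nat_Suc) (simp add: power2_eq_square power3_eq_cube algebra_simps del: of_nat_Suc)
    qed (simp add: mult.assoc)
  qed
  from arg_cong[OF this, of "\<lambda>f. fps_compose f t"]
  have F3: "2 * F3 = fps_const c * t * (2 * F3 + 3 * F2 + fps_const (2 * \<alpha> + 1) * F1 + fps_const \<alpha> * F0)"
    unfolding F0_def F1_def F2_def F3_def
    by (simp add: fps_compose_mult_distrib[OF t0] fps_compose_add_distrib fps_X_fps_compose_startby0[OF t0])
  define \<alpha>' where "\<alpha>' = fps_const \<alpha>"
  have \<alpha>': "fps_const (2 * \<alpha> + 1) = 2 * \<alpha>' + 1"
    by (simp add: \<alpha>'_def numeral_fps_const)
  define T where "T = 1 - w ^ 2"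
  have Dw': "2 * qD w = - T * Z"
    by (simp add: Dw T_def)
  have DT: "qD T = Z * w * T"
    unfolding T_def ct by (simp add: qD_mult Dt algebra_simps)
  define J where "J = inverse Z"
  have J: "Z * J = 1"
    unfolding J_def by (rule inverse_mult_eq_1') (simp add: Z0)
  have h0: "fps_nth h 0 = 0"
    using arg_cong[OF DZ, of "\<lambda>f. fps_nth f 0"] by (simp add: Z0)
  \<comment> \<open>Division by Z makes the Riccati equation linear: on differentiating
    \<open>2 * Z * h2 = h ^ 2 + \<dots>\<close>, the contributions of \<open>h ^ 2\<close> and of
    \<open>qD Z\<close> cancel.\<close>
  define h2 where "h2 = J * qD h"
  have Dh1: "qD h = Z * h2"
    unfolding h2_def using J by algebra
  have h2: "2 * Z * h2 = h ^ 2 + \<alpha>' * T * Z ^ 2"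
    using Dh Dh1 by (simp add: T_def \<alpha>'_def mult.assoc)
  have Dh2: "2 * qD h2 = Z * (2 * \<alpha>' * T * h + \<alpha>' * T * w * Z)"
  proof -
    have "2 * (Z * h) * h2 + 2 * Z * qD h2 = 2 * h * (Z * h2) + \<alpha>' * (Z * w * T) * Z ^ 2 + \<alpha>' * T * (2 * Z * (Z * h))"
      using arg_cong[OF h2, of qD] unfolding qD_mult qD_add qD_square qD_const DZ Dh1 DT \<alpha>'_def
      by (simp add: algebra_simps)
    then show ?thesis
      using J by algebra
  qed
  \<comment> \<open>The counterpart of \<open>h2\<close> on the hypergeometric side, chosen so that
    \<open>qD (w * F1) = Z * g2\<close>.\<close>
  define g2 where "g2 = w ^ 2 * F2 - fps_const (1/2) * T * F1"
  have g2: "2 * g2 = 2 * w ^ 2 * F2 - T * F1"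
    by (simp add: g2_def algebra_simps fps_numeral_mult_const)
  have Dg1: "qD (w * F1) = Z * g2"
  proof -
    have "2 * qD (w * F1) = 2 * (Z * g2)"
      unfolding qD_mult DF using Dw' g2 by algebra
    then show ?thesis by (rule fps_numeral_cancel)
  qed
  have Dg2: "2 * qD g2 = Z * (2 * \<alpha>' * T * (w * F1) + \<alpha>' * T * w * F0)"
  proof -
    have "2 * qD g2 = 2 * w ^ 2 * qD F2 + 2 * w * (2 * qD w) * F2 - qD T * F1 - T * qD F1"
      using arg_cong[OF g2, of qD] unfolding qD_mult qD_diff qD_square qD_const by algebra
    also have "\<dots> = 2 * w ^ 2 * (Z * w * F3) + 2 * w * (- T * Z) * F2 - Z * w * T * F1 - T * (Z * w * F2)"
      unfolding DF DT Dw' ..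
    also have "\<dots> = Z * w * ((1 - T) * (2 * F3) - 3 * T * F2 - T * F1)"
      unfolding T_def by algebra
    also have "\<dots> = Z * (2 * \<alpha>' * T * (w * F1) + \<alpha>' * T * w * F0)"
      using F3 unfolding ct[symmetric] T_def[symmetric] \<alpha>' \<alpha>'_def[symmetric] by algebra
    finally show ?thesis .
  qed
  \<comment> \<open>The triples (F0, w F1, g2) and (Z, h, h2) solve the same linear system, so their
    differences do too. Since T vanishes at q = 0, its constant matrix is nilpotent, and agreement
    of the constant terms decides.\<close>
  define v where "v = (\<lambda>i::nat. [F0 - Z, w * F1 - h, g2 - h2] ! i)"
  define M where "M = (\<lambda>i j::nat. [[0, 2 * Z, 0], [0, 0, 2 * Z], [Z * \<alpha>' * T * w, 2 * Z * \<alpha>' * T, 0]] ! i ! j)"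
  have T0: "fps_nth T 0 = 0"
    by (simp add: T_def w0 fps_nth_power_0)
  have "v 0 = 0"
  proof (rule qD_linear_system_zero[where I = "{..<3}" and N = 2 and v = v and M = M and ?n0.0 = 1])
    fix i :: nat assume "i \<in> {..<3}"
    then show "fps_const 2 * qD (v i) = (\<Sum>j<3. M i j * v j)"
      unfolding lessThan_iff less_3_iff sum_3 using Dg1 Dg2 Dh1 Dh2 DF(1) DZ
      by (elim disjE) (simp_all add: v_def M_def qD_diff algebra_simps flip: numeral_fps_const)
  next
    fix i n :: nat assume "i \<in> {..<3}" "n < 1"
    moreover have "fps_nth h2 0 = 0"
      by (simp add: h2_def)
    ultimately show "fps_nth (v i) n = 0"
      unfolding lessThan_iff less_3_iff
      by (elim disjE) (simp_all add: v_def F0_def F1_def F2_def F_def a0 Z0 h0 g2_def T0)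
  next
    fix n i :: nat and c :: "nat \<Rightarrow> complex"
    assume n: "1 \<le> n" and "i \<in> {..<3}"
      and eq: "\<And>i. i \<in> {..<3} \<Longrightarrow> 2 * (of_nat n * c i) = (\<Sum>j<3. fps_nth (M i j) 0 * c j)"
    have "c 2 = 0"
      using eq[of 2] n by (simp add: sum_3 M_def T0)
    moreover from this have "c 1 = 0"
      using eq[of 1] n by (simp add: sum_3 M_def T0)
    moreover from this have "c 0 = 0"
      using eq[of 0] n by (simp add: sum_3 M_def T0)
    ultimately show "c i = 0"
      using \<open>i \<in> {..<3}\<close> unfolding lessThan_iff less_3_iff by auto
  qed auto
  then show "fps_compose (Abs_fps a) t = Z"
    by (simp add: v_def F0_def F_def)
qed

section \<open>The normal form at levels 4, 2 and 3\<close>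

definition w4 :: "complex fps" where "w4 = 1 - 2 * a4 * inverse b4"
definition h4 :: "complex fps" where "h4 = fps_const (1/3) * (P2 + 2 * a4 - b4)"

lemma h4: "3 * h4 = P2 + 2 * a4 - b4"
  by (simp add: h4_def fps_numeral_mult_const)

lemma b4_w4: "b4 * w4 = b4 - 2 * a4"
proof -
  have "b4 * inverse b4 = 1"
    by (rule inverse_mult_eq_1') (simp add: ab4_nth)
  then show ?thesis
    unfolding w4_def by algebra
qed

lemma b4_nz: "b4 \<noteq> 0"
  using ab4_nth(3) by auto

text \<open>The quotient \<open>a4 / b4\<close> is the elliptic modular function lambda, so
  \<open>w4\<close> = 1 - 2 lambda and \<open>1 - w4 ^ 2\<close> = 4 lambda (1 - lambda). The
  equation for \<open>w4\<close> is first proved times \<open>b4 ^ 2\<close>, so that no inverse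
  occurs, and then cancelled.\<close>

lemma level4:
  "qD b4 = b4 * h4"
  "2 * qD w4 = - (1 - w4 ^ 2) * b4"
  "2 * qD h4 = h4 ^ 2 + fps_const (1/4) * (1 - w4 ^ 2) * b4 ^ 2"
  "15 * (b4 ^ 2 * w4) = 16 * Q4 - Q1"
proof -
  have "3 * qD b4 = 3 * (b4 * h4)"
    using qD_b4 h4 by algebra
  then show 1: "qD b4 = b4 * h4"
    by (rule fps_numeral_cancel)
  have "qD b4 * w4 + b4 * qD w4 = qD b4 - 2 * qD a4"
    using arg_cong[OF b4_w4, of qD] unfolding qD_mult qD_diff qD_const by algebra
  then have "3 * (b4 ^ 2 * (2 * qD w4)) = 3 * (b4 ^ 2 * (- (1 - w4 ^ 2) * b4))"
    using qD_b4 qD_a4 b4_w4 by algebra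
  then have "b4 ^ 2 * (2 * qD w4) = b4 ^ 2 * (- (1 - w4 ^ 2) * b4)"
    by (rule fps_numeral_cancel)
  then show "2 * qD w4 = - (1 - w4 ^ 2) * b4"
    using b4_nz by simp
  have "3 * qD h4 = qD P2 + 2 * qD a4 - qD b4"
    using arg_cong[OF h4, of qD] unfolding qD_mult qD_add qD_diff qD_const by algebra
  moreover have "4 * (fps_const (1/4) * (1 - w4 ^ 2) * b4 ^ 2) = (1 - w4 ^ 2) * b4 ^ 2"
    by (simp add: fps_numeral_mult_const mult.assoc)
  ultimately have "36 * (2 * qD h4) = 36 * (h4 ^ 2 + fps_const (1/4) * (1 - w4 ^ 2) * b4 ^ 2)"
    using qD_P2_4 qD_b4 qD_a4 h4 b4_w4 by algebra
  then show "2 * qD h4 = h4 ^ 2 + fps_const (1/4) * (1 - w4 ^ 2) * b4 ^ 2"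
    by (rule fps_numeral_cancel)
  show "15 * (b4 ^ 2 * w4) = 16 * Q4 - Q1"
    using b4_w4 Q4_4 Q1_4 by algebra
qed

lemma level4_nth: "fps_nth w4 0 = 1" "fps_nth w4 (Suc 0) = -32"
  by (simp_all add: w4_def ab4_nth fps_numeral_nth)

text \<open>By \<open>P1_4\<close> this is \<open>2 * P2 - P1\<close>, of level 2 although built
  from level 4. The choice of \<open>w2\<close> is then forced by
  \<open>3 * (Z2 ^ 2 * w2) = 4 * Q2 - Q1\<close>.\<close>

definition Z2 :: "complex fps" where "Z2 = a4 + b4"
definition w2 :: "complex fps" where "w2 = 1 - 8 * a4 * b4 * inverse Z2 ^ 2"
definition h2 :: "complex fps" where "h2 = fps_const (1/12) * (4 * P2 - Z2 - 3 * w2 * Z2)"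

lemma h2: "12 * h2 = 4 * P2 - Z2 - 3 * w2 * Z2"
  by (simp add: h2_def fps_numeral_mult_const)

lemma Z2_nth: "fps_nth Z2 0 = 1"
  by (simp add: Z2_def ab4_nth)

lemma Z2_w2: "Z2 ^ 2 * w2 = a4 ^ 2 - 6 * a4 * b4 + b4 ^ 2"
proof -
  have "Z2 * inverse Z2 = 1"
    by (rule inverse_mult_eq_1') (simp add: Z2_nth)
  then show ?thesis
    unfolding w2_def Z2_def by algebra
qed

lemma level2:
  "qD Z2 = Z2 * h2"
  "2 * qD w2 = - (1 - w2 ^ 2) * Z2"
  "2 * qD h2 = h2 ^ 2 + fps_const (3/16) * (1 - w2 ^ 2) * Z2 ^ 2"
  "3 * (Z2 ^ 2 * w2) = 4 * Q2 - Q1"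
proof -
  have nz: "Z2 ^ 3 \<noteq> 0"
    using Z2_nth by auto
  have DZ: "3 * qD Z2 = Z2 * P2 + 4 * a4 * b4 - a4 ^ 2 - b4 ^ 2"
    using qD_a4 qD_b4 unfolding Z2_def qD_add by algebra
  \<comment> \<open>Since \<open>a4 + b4\<close> is \<open>Z2\<close>, this turns symmetric
    polynomials in \<open>a4\<close>, \<open>b4\<close> into polynomials in \<open>Z2\<close> and
    \<open>w2\<close>.\<close>
  have ab: "8 * (a4 * b4) = (1 - w2) * Z2 ^ 2"
    using Z2_w2 unfolding Z2_def by algebra
  have "12 * qD Z2 = 12 * (Z2 * h2)"
    using DZ h2 Z2_w2 unfolding Z2_def by algebra
  then show 1: "qD Z2 = Z2 * h2"
    by (rule fps_numeral_cancel)
  have "8 * (qD a4 * b4 + a4 * qD b4) = (1 - w2) * (2 * Z2 * qD Z2) - qD w2 * Z2 ^ 2"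
    using arg_cong[OF ab, of qD] unfolding qD_mult qD_diff qD_square qD_const by algebra
  moreover have "3 * (qD a4 * b4 + a4 * qD b4) = a4 * b4 * (2 * P2 + Z2)"
    using qD_a4 qD_b4 unfolding Z2_def by algebra
  ultimately have "12 * (Z2 ^ 3 * (2 * qD w2)) = 12 * (Z2 ^ 3 * (- (1 - w2 ^ 2) * Z2))"
    using ab 1 h2 by algebra
  then have "Z2 ^ 3 * (2 * qD w2) = Z2 ^ 3 * (- (1 - w2 ^ 2) * Z2)"
    by (rule fps_numeral_cancel)
  then show Dw: "2 * qD w2 = - (1 - w2 ^ 2) * Z2"
    using nz by simp
  have "12 * qD h2 = 4 * qD P2 - qD Z2 - 3 * (qD w2 * Z2 + w2 * qD Z2)"
    using arg_cong[OF h2, of qD] unfolding qD_mult qD_add qD_diff qD_const by algebra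
  moreover have "16 * (fps_const (3/16) * (1 - w2 ^ 2) * Z2 ^ 2) = 3 * (1 - w2 ^ 2) * Z2 ^ 2"
    by (simp add: fps_numeral_mult_const mult.assoc flip: numeral_fps_const)
  moreover have "6 * qD P2 = P2 ^ 2 - Z2 ^ 2 + 3 * (a4 * b4)"
    using qD_P2_4 unfolding Z2_def by algebra
  ultimately have "144 * (2 * qD h2) = 144 * (h2 ^ 2 + fps_const (3/16) * (1 - w2 ^ 2) * Z2 ^ 2)"
    using 1 Dw h2 ab by algebra
  then show "2 * qD h2 = h2 ^ 2 + fps_const (3/16) * (1 - w2 ^ 2) * Z2 ^ 2"
    by (rule fps_numeral_cancel)
  show "3 * (Z2 ^ 2 * w2) = 4 * Q2 - Q1"
    using Z2_w2 Q2_4 Q1_4 by algebra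
qed

lemma level2_nth: "fps_nth w2 0 = 1" "fps_nth w2 (Suc 0) = -128"
  by (simp_all add: w2_def ab4_nth Z2_nth fps_nth_power_0 fps_numeral_nth)

definition h3 :: "complex fps" where "h3 = fps_const (1/6) * (Z3 + P1 - 2 * w3 * Z3)"

lemma h3: "6 * h3 = Z3 + P1 - 2 * w3 * Z3"
  by (simp add: h3_def fps_numeral_mult_const)

lemma level3:
  "qD Z3 = Z3 * h3"
  "2 * qD w3 = - (1 - w3 ^ 2) * Z3"
  "2 * qD h3 = h3 ^ 2 + fps_const (2/9) * (1 - w3 ^ 2) * Z3 ^ 2"
  "8 * (Z3 ^ 2 * w3) = 9 * Q3 - Q1"
proof -
  have "6 * qD Z3 = 6 * (Z3 * h3)"
    using qD_Z3 h3 by algebra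
  then show 1: "qD Z3 = Z3 * h3"
    by (rule fps_numeral_cancel)
  have "6 * qD h3 = qD Z3 + qD P1 - 2 * (qD w3 * Z3 + w3 * qD Z3)"
    using arg_cong[OF h3, of qD] unfolding qD_mult qD_add qD_diff qD_const by algebra
  moreover have "9 * (fps_const (2/9) * (1 - w3 ^ 2) * Z3 ^ 2) = 2 * (1 - w3 ^ 2) * Z3 ^ 2"
    by (simp add: fps_numeral_mult_const mult.assoc flip: numeral_fps_const)
  ultimately have "36 * (2 * qD h3) = 36 * (h3 ^ 2 + fps_const (2/9) * (1 - w3 ^ 2) * Z3 ^ 2)"
    using 1 qD_w3 h3 qD_eis1(1) Q1_3 by algebra
  then show "2 * qD h3 = h3 ^ 2 + fps_const (2/9) * (1 - w3 ^ 2) * Z3 ^ 2"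
    by (rule fps_numeral_cancel)
qed (rule qD_w3 Z3_w3_Eisenstein)+

section \<open>Eta quotients\<close>

text \<open>A linear system with one unknown: the constant term r of the common logarithmic
  derivative is the only eigenvalue, so the coefficients up to r determine the solution. For eta
  quotients r is the order at q = 0.\<close>

lemma qD_eq_by_log_derivative:
  assumes f: "qD f = u * f" and g: "qD g = v * g" and uv: "u = v"
    and u0: "fps_nth u 0 = of_nat r"
    and init: "\<And>n. n \<le> r \<Longrightarrow> fps_nth f n = fps_nth g n"
  shows "f = g"
proof -
  have "f - g = 0"
  proof (rule qD_linear_system_zero[where I = "{()}" and N = 1 and v = "\<lambda>_. f - g" and M = "\<lambda>_ _. u" and ?n0.0 = "Suc r"])
    fix n :: nat and c :: "unit \<Rightarrow> complex" and i :: unit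
    assume "Suc r \<le> n" and "\<And>i. i \<in> {()} \<Longrightarrow> 1 * (of_nat n * c i) = (\<Sum>j\<in>{()}. fps_nth u 0 * c j)"
    then have "(of_nat n - of_nat r :: complex) * c () = 0" "n \<noteq> r"
      by (auto simp: u0 algebra_simps)
    then show "c i = 0" by simp
  qed (use f g uv init in \<open>auto simp: qD_diff algebra_simps\<close>)
  then show ?thesis by simp
qed

text \<open>The series of -sum n^(k-1) log(1 - q^n): index 1 gives minus the logarithm of Euler's
  product, index 3 the series in \<open>G\<close>.\<close>

definition lsig :: "nat \<Rightarrow> complex fps" where
  "lsig k = Abs_fps (\<lambda>n. dsig k n / of_nat n)"

lemma qD_lsig: "qD (lsig k) = Abs_fps (dsig k)"
  by (rule fps_ext) (simp add: lsig_def)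

lemma lsig_nth_0 [simp]: "fps_nth (lsig k) 0 = 0"
  by (simp add: lsig_def)

lemma eis_lsig: "eis c k = 1 + fps_const c * qD (lsig k)"
  by (rule fps_ext) (simp add: eis_def qD_lsig)

definition fexp :: "complex fps \<Rightarrow> complex fps" where
  "fexp f = fps_compose (fps_exp 1) f"

lemma fexp_nth_0 [simp]: "fps_nth f 0 = 0 \<Longrightarrow> fps_nth (fexp f) 0 = 1"
  by (simp add: fexp_def)

lemma qD_fexp: "fps_nth f 0 = 0 \<Longrightarrow> qD (fexp f) = qD f * fexp f"
  by (simp add: fexp_def qD_def fps_compose_deriv mult_ac)

text \<open>
  \<open>Phi\<close> is the formal expansion of \<open>\<Prod>(1 - q\<^sup>n)\<close>.
\<close>

definition Phi :: "complex fps" where "Phi = fexp (- lsig 1)"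

lemma qD_Phi: "24 * qD Phi = (P1 - 1) * Phi"
proof -
  have "24 * qD Phi = - (24 * qD (lsig 1)) * Phi"
    unfolding Phi_def by (subst qD_fexp) (simp_all add: qD_minus)
  also have "- (24 * qD (lsig 1)) = P1 - 1"
    by (simp add: P_eis_def eis_lsig flip: numeral_fps_const neg_numeral_fps_const)
  finally show ?thesis .
qed

abbreviation "Phi2 \<equiv> dil 2 Phi"
abbreviation "Phi3 \<equiv> dil 3 Phi"
abbreviation "Phi4 \<equiv> dil 4 Phi"

lemma qD_Phi2: "12 * qD Phi2 = (P2 - 1) * Phi2"
proof -
  have "24 * qD Phi2 = 2 * dil 2 (24 * qD Phi)"
    by (simp add: qD_dil dil_simps)
  then have "2 * (12 * qD Phi2) = 2 * ((P2 - 1) * Phi2)"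
    unfolding qD_Phi by (simp add: dil_simps)
  then show ?thesis by (rule fps_numeral_cancel)
qed

lemma qD_Phi3: "8 * qD Phi3 = (P3 - 1) * Phi3"
proof -
  have "24 * qD Phi3 = 3 * dil 3 (24 * qD Phi)"
    by (simp add: qD_dil dil_simps)
  then have "3 * (8 * qD Phi3) = 3 * ((P3 - 1) * Phi3)"
    unfolding qD_Phi by (simp add: dil_simps)
  then show ?thesis by (rule fps_numeral_cancel)
qed

lemma qD_Phi4: "6 * qD Phi4 = (P4 - 1) * Phi4"
proof -
  have "24 * qD Phi4 = 4 * dil 4 (24 * qD Phi)"
    by (simp add: qD_dil dil_simps)
  then have "4 * (6 * qD Phi4) = 4 * ((P4 - 1) * Phi4)"
    unfolding qD_Phi by (simp add: dil_simps)
  then show ?thesis by (rule fps_numeral_cancel)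
qed

lemma Phi_nth_0: "fps_nth Phi 0 = 1" "fps_nth Phi2 0 = 1" "fps_nth Phi3 0 = 1" "fps_nth Phi4 0 = 1"
  by (simp_all add: Phi_def dil_nth)

lemma qD_log_power: "qD (f ^ n) = of_nat n * u * f ^ n" if "qD f = u * f"
proof (cases n)
  case (Suc m)
  then show ?thesis
    using that by (subst qD_power) (simp add: mult_ac)
qed simp

lemma qD_log_mult: "qD (f * g) = (u + v) * (f * g)" if "qD f = u * f" "qD g = v * g"
  using that by (simp add: qD_mult algebra_simps)

lemma qD_X: "qD fps_X = 1 * fps_X"
  by (simp add: qD_def)

definition "pl1 = fps_const (1/24) * (P1 - 1)"
definition "pl2 = fps_const (1/12) * (P2 - 1)"
definition "pl3 = fps_const (1/8) * (P3 - 1)"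
definition "pl4 = fps_const (1/6) * (P4 - 1)"

lemma pl: "24 * pl1 = P1 - 1" "12 * pl2 = P2 - 1" "8 * pl3 = P3 - 1" "6 * pl4 = P4 - 1"
  by (simp_all add: pl1_def pl2_def pl3_def pl4_def fps_numeral_mult_const)

lemma qD_log_Phi: "qD Phi = pl1 * Phi" "qD Phi2 = pl2 * Phi2" "qD Phi3 = pl3 * Phi3" "qD Phi4 = pl4 * Phi4"
proof -
  have "24 * qD Phi = 24 * (pl1 * Phi)"
    using qD_Phi pl(1) by algebra
  then show "qD Phi = pl1 * Phi" by (rule fps_numeral_cancel)
  have "12 * qD Phi2 = 12 * (pl2 * Phi2)"
    using qD_Phi2 pl(2) by algebra
  then show "qD Phi2 = pl2 * Phi2" by (rule fps_numeral_cancel)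
  have "8 * qD Phi3 = 8 * (pl3 * Phi3)"
    using qD_Phi3 pl(3) by algebra
  then show "qD Phi3 = pl3 * Phi3" by (rule fps_numeral_cancel)
  have "6 * qD Phi4 = 6 * (pl4 * Phi4)"
    using qD_Phi4 pl(4) by algebra
  then show "qD Phi4 = pl4 * Phi4" by (rule fps_numeral_cancel)
qed

lemma pl_nth_0: "fps_nth pl1 0 = 0" "fps_nth pl2 0 = 0" "fps_nth pl3 0 = 0" "fps_nth pl4 0 = 0"
  by (simp_all add: pl1_def pl2_def pl3_def pl4_def P_eis_nth P2_nth P3_nth P4_nth)

definition "la = fps_const (1/3) * (P2 + 2 * b4 - a4)"

lemma la: "3 * la = P2 + 2 * b4 - a4"
  by (simp add: la_def fps_numeral_mult_const)

lemma qD_log_a4: "qD a4 = la * a4"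
proof -
  have "3 * qD a4 = 3 * (la * a4)"
    using qD_a4 la by algebra
  then show ?thesis by (rule fps_numeral_cancel)
qed

lemma qD_log_b4: "qD b4 = h4 * b4"
  using level4(1) by (simp add: mult.commute)

text \<open>This and the next two lemmas are the product formulas for theta_2^4, theta_4^4 =
  theta_3^4 - theta_2^4 and theta_3^4, with denominators cleared. Both sides here begin with 16 q,
  hence \<open>r = 1\<close>.\<close>

lemma a4_eta: "a4 * Phi2 ^ 4 = 16 * fps_X * Phi4 ^ 8"
proof (rule qD_eq_by_log_derivative[where r = 1])
  show "qD (a4 * Phi2 ^ 4) = (la + of_nat 4 * pl2) * (a4 * Phi2 ^ 4)"
    by (intro qD_log_mult qD_log_power qD_log_a4 qD_log_Phi)
  have "qD (16 :: complex fps) = 0 * 16"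
    by simp
  then show "qD (16 * fps_X * Phi4 ^ 8) = (0 + 1 + of_nat 8 * pl4) * (16 * fps_X * Phi4 ^ 8)"
    by (intro qD_log_mult qD_log_power qD_X qD_log_Phi)
  have "12 * (la + 4 * pl2) = 12 * (0 + 1 + 8 * pl4)"
    using la pl P4_4 by algebra
  then show "la + of_nat 4 * pl2 = 0 + 1 + of_nat 8 * pl4"
    unfolding of_nat_numeral by (rule fps_numeral_cancel)
next
  show "fps_nth (la + of_nat 4 * pl2) 0 = of_nat 1"
    by (simp add: la_def pl_nth_0 ab4_nth P2_nth)
next
  fix n :: nat assume "n \<le> 1"
  then show "fps_nth (a4 * Phi2 ^ 4) n = fps_nth (16 * fps_X * Phi4 ^ 8) n"
    by (auto simp: le_Suc_eq ab4_nth Phi_nth_0 fps_nth_power_0 mult.assoc)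
qed

lemma ba4_eta: "(b4 - a4) * Phi2 ^ 4 = Phi ^ 8"
proof (rule qD_eq_by_log_derivative[where r = 0])
  have "3 * qD (b4 - a4) = 3 * ((8 * pl1 - 4 * pl2) * (b4 - a4))"
    using qD_a4 qD_b4 pl P1_4 unfolding qD_diff by algebra
  then have "qD (b4 - a4) = (8 * pl1 - 4 * pl2) * (b4 - a4)"
    by (rule fps_numeral_cancel)
  then show "qD ((b4 - a4) * Phi2 ^ 4) = ((8 * pl1 - 4 * pl2) + of_nat 4 * pl2) * ((b4 - a4) * Phi2 ^ 4)"
    by (intro qD_log_mult qD_log_power qD_log_Phi)
  show "qD (Phi ^ 8) = (of_nat 8 * pl1) * (Phi ^ 8)"
    by (intro qD_log_power qD_log_Phi)
qed (simp_all add: pl_nth_0 ab4_nth Phi_nth_0 fps_nth_power_0)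

lemma b4_eta: "b4 * Phi ^ 8 * Phi4 ^ 8 = Phi2 ^ 20"
proof (rule qD_eq_by_log_derivative[where r = 0])
  show "qD (b4 * Phi ^ 8 * Phi4 ^ 8) = (h4 + of_nat 8 * pl1 + of_nat 8 * pl4) * (b4 * Phi ^ 8 * Phi4 ^ 8)"
    by (intro qD_log_mult qD_log_power qD_log_b4 qD_log_Phi)
  show "qD (Phi2 ^ 20) = (of_nat 20 * pl2) * (Phi2 ^ 20)"
    by (intro qD_log_power qD_log_Phi)
  have "12 * (h4 + 8 * pl1 + 8 * pl4) = 12 * (20 * pl2)"
    using h4 pl P4_4 P1_4 by algebra
  then show "h4 + of_nat 8 * pl1 + of_nat 8 * pl4 = of_nat 20 * pl2"
    unfolding of_nat_numeral by (rule fps_numeral_cancel)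
qed (simp_all add: h4_def pl_nth_0 ab4_nth Phi_nth_0 fps_nth_power_0 P2_nth)

lemma w3_nth_1: "fps_nth w3 (Suc 0) = -54"
proof -
  have "K3 = 2 * (w3 * (Y3 * Y3))"
    using K3_w3 unfolding Y3_Z3 by algebra
  then have "fps_nth K3 (Suc 0) = fps_nth (2 * (w3 * (Y3 * Y3))) (Suc 0)"
    by (rule arg_cong)
  also have "\<dots> = 2 * (fps_nth w3 0 * 96 + fps_nth w3 (Suc 0) * 4)"
    unfolding fps_mult_numeral_left fps_mult_nth_1'[of w3] YY_nth by simp
  finally show ?thesis
    unfolding K3_nth Zw3_nth by algebra
qed

text \<open>The logarithmic derivatives of 1 - w3 and 1 + w3 are (1 + w3) Z3 / 2 and -(1 - w3) Z3 /
  2. Their difference is \<open>Z3\<close> = (3 P3 - P1) / 2, the logarithmic derivative of the eta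
  quotient q Phi3^12 / Phi^12.\<close>

lemma w3_eta: "(1 - w3) * Phi ^ 12 = (1 + w3) * (27 * fps_X * Phi3 ^ 12)"
proof (rule qD_eq_by_log_derivative[where r = 1])
  define p m where "p = fps_const (1/2) * (1 + w3) * Z3" and "m = fps_const (1/2) * (1 - w3) * Z3"
  have pm: "2 * p = (1 + w3) * Z3" "2 * m = (1 - w3) * Z3"
    by (simp_all add: p_def m_def mult.assoc fps_numeral_mult_const)
  have "2 * qD (1 - w3) = 2 * (p * (1 - w3))"
    using pm level3(2) unfolding qD_diff qD_const by algebra
  then have "qD (1 - w3) = p * (1 - w3)"
    by (rule fps_numeral_cancel)
  then show "qD ((1 - w3) * Phi ^ 12) = (p + of_nat 12 * pl1) * ((1 - w3) * Phi ^ 12)"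
    by (intro qD_log_mult qD_log_power qD_log_Phi)
  have "2 * qD (1 + w3) = 2 * (- m * (1 + w3))"
    using pm level3(2) unfolding qD_add qD_const by algebra
  then have "qD (1 + w3) = - m * (1 + w3)"
    by (rule fps_numeral_cancel)
  moreover have "qD (27 :: complex fps) = 0 * 27"
    by simp
  ultimately show "qD ((1 + w3) * (27 * fps_X * Phi3 ^ 12)) = (- m + (0 + 1 + of_nat 12 * pl3)) * ((1 + w3) * (27 * fps_X * Phi3 ^ 12))"
    by (intro qD_log_mult qD_log_power qD_X qD_log_Phi)
  have "2 * (p + 12 * pl1) = 2 * (- m + (0 + 1 + 12 * pl3))"
    using pm pl Y3_Z3 Y3_P3 by algebra
  then show "p + of_nat 12 * pl1 = - m + (0 + 1 + of_nat 12 * pl3)"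
    unfolding of_nat_numeral by (rule fps_numeral_cancel)
  show "fps_nth (p + of_nat 12 * pl1) 0 = of_nat 1"
    by (simp add: p_def pl_nth_0 Zw3_nth)
next
  fix n :: nat assume "n \<le> 1"
  then show "fps_nth ((1 - w3) * Phi ^ 12) n = fps_nth ((1 + w3) * (27 * fps_X * Phi3 ^ 12)) n"
    by (auto simp: le_Suc_eq Zw3_nth w3_nth_1 Phi_nth_0 fps_nth_power_0 mult.assoc)
qed

text \<open>The future reciprocals of s2, s3, s4. The linear coefficients of w4, w3, w2 are -32,
  -54, -128, so 64, 108, 256 are the divisors for which each series starts with q.\<close>

definition t4 :: "complex fps" where "t4 = fps_const (1/64) * (1 - w4 ^ 2)"
definition t3 :: "complex fps" where "t3 = fps_const (1/108) * (1 - w3 ^ 2)"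
definition t2 :: "complex fps" where "t2 = fps_const (1/256) * (1 - w2 ^ 2)"

lemma t_mult: "64 * t4 = 1 - w4 ^ 2" "108 * t3 = 1 - w3 ^ 2" "256 * t2 = 1 - w2 ^ 2"
  by (simp_all add: t4_def t3_def t2_def fps_numeral_mult_const)

lemma fps_eq_mult_inverse:
  fixes f g u :: "complex fps"
  assumes "f * u = g" "fps_nth u 0 \<noteq> 0"
  shows "f = g * inverse u"
proof -
  have "f * (u * inverse u) = g * inverse u"
    using assms(1) by (simp flip: mult.assoc)
  then show ?thesis
    by (simp add: inverse_mult_eq_1'[OF assms(2)])
qed

lemma t4_eta: "t4 = fps_X * inverse ((Phi2 ^ 2 * inverse (Phi * Phi4)) ^ 24)"
proof -
  \<comment> \<open>That is, t4 = lambda (1 - lambda) / 16 for lambda =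
    \<open>a4 / b4\<close>.\<close>
  have *: "16 * (b4 ^ 2 * t4) = a4 * (b4 - a4)"
  proof -
    have "4 * (16 * (b4 ^ 2 * t4)) = 4 * (a4 * (b4 - a4))"
      using t_mult(1) b4_w4 by algebra
    then show ?thesis by (rule fps_numeral_cancel)
  qed
  have "16 * (t4 * Phi2 ^ 48) = 16 * t4 * Phi2 ^ 20 * Phi2 ^ 20 * Phi2 ^ 8"
    by (simp add: mult.assoc flip: power_add)
  also have "\<dots> = (16 * (b4 ^ 2 * t4)) * Phi2 ^ 8 * (Phi ^ 16 * Phi4 ^ 16)"
    unfolding b4_eta[symmetric] by (simp add: power2_eq_square mult_ac flip: power_add)
  also have "\<dots> = (a4 * Phi2 ^ 4) * ((b4 - a4) * Phi2 ^ 4) * (Phi ^ 16 * Phi4 ^ 16)"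
    unfolding * by (simp add: mult_ac flip: power_add)
  also have "\<dots> = 16 * (fps_X * (Phi * Phi4) ^ 24)"
    unfolding a4_eta ba4_eta by (simp add: mult_ac power_mult_distrib flip: power_add)
  finally have eq: "t4 * Phi2 ^ 48 = fps_X * (Phi * Phi4) ^ 24"
    by (rule fps_numeral_cancel)
  have "t4 * (Phi2 ^ 2 * inverse (Phi * Phi4)) ^ 24 = (t4 * Phi2 ^ 48) * inverse (Phi * Phi4) ^ 24"
    by (simp add: power_mult_distrib flip: power_mult)
  also have "\<dots> = fps_X * (Phi * Phi4 * inverse (Phi * Phi4)) ^ 24"
    unfolding eq by (simp only: power_mult_distrib mult.assoc)
  also have "Phi * Phi4 * inverse (Phi * Phi4) = 1"
    by (simp add: inverse_mult_eq_1' Phi_nth_0)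
  finally show ?thesis
    by (intro fps_eq_mult_inverse) (simp_all add: Phi_nth_0 fps_nth_power_0)
qed

definition A3_eta :: "complex fps" where "A3_eta = Phi3 ^ 6 * inverse (Phi ^ 6)"
definition A3_inv :: "complex fps" where "A3_inv = Phi ^ 6 * inverse (Phi3 ^ 6)"

lemma A3_eta_inv: "A3_eta * A3_inv = 1"
proof -
  have "Phi ^ 6 * inverse (Phi ^ 6) = 1" "Phi3 ^ 6 * inverse (Phi3 ^ 6) = 1"
    by (simp_all add: inverse_mult_eq_1' Phi_nth_0 fps_nth_power_0)
  then show ?thesis
    unfolding A3_eta_def A3_inv_def by algebra
qed

lemma w3_A3: "1 - w3 = (1 + w3) * (27 * fps_X * A3_eta ^ 2)"
proof -
  have "Phi ^ 6 * inverse (Phi ^ 6) = 1"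
    by (simp add: inverse_mult_eq_1' Phi_nth_0 fps_nth_power_0)
  then show ?thesis
    using w3_eta unfolding A3_eta_def by algebra
qed

lemma t3_eta: "t3 = fps_X * inverse ((27 * fps_X * A3_eta + A3_inv) ^ 2)"
proof -
  define S where "S = 27 * fps_X * A3_eta + A3_inv"
  have S0: "fps_nth (S ^ 2) 0 = 1"
    by (simp add: S_def A3_eta_def A3_inv_def Phi_nth_0 fps_nth_power_0)
  have "432 * (t3 * S ^ 2) = 4 * (1 - w3) * (1 + w3) * S ^ 2"
    using t_mult(2) by algebra
  also have "\<dots> = 4 * (27 * fps_X) * ((1 + w3) * (A3_eta * S)) ^ 2"
    unfolding w3_A3 by algebra
  \<comment> \<open>\<open>A3_eta * S\<close> is 1 + x with x = 27 q \<open>A3_eta\<close>^2, and 1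
    - w3 = (1 + w3) x means (1 + w3) (1 + x) = 2.\<close>
  also have "(1 + w3) * (A3_eta * S) = 2"
    using w3_A3 A3_eta_inv unfolding S_def by algebra
  finally have "432 * (t3 * S ^ 2) = 432 * fps_X"
    by simp
  then have "t3 * S ^ 2 = fps_X"
    by (rule fps_numeral_cancel)
  then show ?thesis
    unfolding S_def[symmetric] by (rule fps_eq_mult_inverse) (simp add: S0)
qed

definition B2_eta :: "complex fps" where "B2_eta = Phi ^ 4 * Phi4 ^ 8 * inverse (Phi2 ^ 12)"
definition B2_inv :: "complex fps" where "B2_inv = Phi2 ^ 12 * inverse (Phi ^ 4 * Phi4 ^ 8)"

lemma B2_eta_inv: "B2_eta * B2_inv = 1"
proof -
  have "Phi2 ^ 12 * inverse (Phi2 ^ 12) = 1" "Phi ^ 4 * Phi4 ^ 8 * inverse (Phi ^ 4 * Phi4 ^ 8) = 1"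
    by (simp_all add: inverse_mult_eq_1' Phi_nth_0 fps_nth_power_0)
  then show ?thesis
    unfolding B2_eta_def B2_inv_def by algebra
qed

lemma t2_Z2: "16 * (t2 * Z2 ^ 4) = a4 * b4 * (b4 - a4) ^ 2"
proof -
  have "16 * (16 * (t2 * Z2 ^ 4)) = 16 * (a4 * b4 * (b4 - a4) ^ 2)"
    using t_mult(3) Z2_w2 unfolding Z2_def by algebra
  then show ?thesis by (rule fps_numeral_cancel)
qed

lemma b4_B2: "b4 * B2_eta ^ 2 * Phi2 ^ 4 = Phi4 ^ 8"
proof -
  have i: "Phi2 ^ 12 * inverse (Phi2 ^ 12) = 1"
    by (simp add: inverse_mult_eq_1' Phi_nth_0 fps_nth_power_0)
  have "b4 * B2_eta ^ 2 * Phi2 ^ 4 = (b4 * Phi ^ 8 * Phi4 ^ 8) * Phi4 ^ 8 * Phi2 ^ 4 * inverse (Phi2 ^ 12) ^ 2"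
    unfolding B2_eta_def by (simp add: power_mult_distrib mult_ac flip: power_add power_mult)
  also have "\<dots> = Phi4 ^ 8 * (Phi2 ^ 12 * inverse (Phi2 ^ 12)) ^ 2"
    unfolding b4_eta by (simp add: power_mult_distrib mult_ac flip: power_add power_mult)
  finally show ?thesis
    unfolding i by simp
qed

lemma a4_B2: "a4 = 16 * fps_X * b4 * B2_eta ^ 2"
proof -
  have i: "Phi2 ^ 4 * inverse (Phi2 ^ 4) = 1"
    by (simp add: inverse_mult_eq_1' Phi_nth_0 fps_nth_power_0)
  then show ?thesis
    using b4_B2 a4_eta by algebra
qed

text \<open>By \<open>a4_B2\<close> the bracket S in s4 satisfies
  \<open>Z2 = b4 * B2_eta * S\<close>. The factor \<open>S ^ 4\<close> is therefore
  \<open>Z2 ^ 4\<close> up to eta quotients, and \<open>t2_Z2\<close> expresses t2 Z2^4 by theta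
  series.\<close>

lemma t2_eta:
  "t2 = fps_X * inverse (Phi2 ^ 24 * inverse (Phi ^ 24) * (16 * fps_X * B2_eta + B2_inv) ^ 4)"
proof -
  define S where "S = 16 * fps_X * B2_eta + B2_inv"
  define U where "U = Phi2 ^ 24 * inverse (Phi ^ 24) * S ^ 4"
  have U0: "fps_nth U 0 = 1"
    by (simp add: U_def S_def B2_eta_def B2_inv_def Phi_nth_0 fps_nth_power_0)
  have i: "Phi ^ 24 * inverse (Phi ^ 24) = 1"
    by (simp add: inverse_mult_eq_1' Phi_nth_0 fps_nth_power_0)
  have Z: "Z2 = b4 * B2_eta * S"
    using a4_B2 B2_eta_inv unfolding S_def Z2_def by algebra
  have "16 * (t2 * U) * (b4 * B2_eta) ^ 4 * Phi ^ 24 = 16 * (t2 * Z2 ^ 4) * Phi2 ^ 24"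
    using i unfolding Z U_def by algebra
  also have "\<dots> = (a4 * Phi2 ^ 4) * b4 * ((b4 - a4) * Phi2 ^ 4) ^ 2 * Phi2 ^ 12"
    unfolding t2_Z2 by (simp add: power_mult_distrib mult_ac flip: power_add power_mult)
  also have "\<dots> = 16 * fps_X * b4 * Phi4 ^ 8 * Phi ^ 16 * Phi2 ^ 12"
    unfolding a4_eta ba4_eta by (simp add: power_mult_distrib mult_ac flip: power_add power_mult)
  \<comment> \<open>The extra \<open>Phi2 ^ 8\<close> completes \<open>Phi2 ^ 12\<close> to
    \<open>Phi2 ^ 20\<close>, to which \<open>b4_eta\<close> applies.\<close>
  finally have "16 * (t2 * U) * (b4 * B2_eta) ^ 4 * Phi ^ 24 * Phi2 ^ 8 =
      16 * fps_X * b4 * Phi4 ^ 8 * Phi ^ 16 * Phi2 ^ 12 * Phi2 ^ 8"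
    by (rule arg_cong[of _ _ "\<lambda>f. f * Phi2 ^ 8"])
  also have "\<dots> = 16 * fps_X * b4 * Phi4 ^ 8 * Phi ^ 16 * Phi2 ^ 20"
    by (simp add: mult.assoc flip: power_add)
  also have "\<dots> = 16 * fps_X * b4 ^ 2 * (Phi4 ^ 8) ^ 2 * Phi ^ 24"
    unfolding b4_eta[symmetric] by (simp add: power2_eq_square mult_ac flip: power_add)
  also have "\<dots> = 16 * fps_X * (b4 * B2_eta) ^ 4 * Phi ^ 24 * Phi2 ^ 8"
    unfolding b4_B2[symmetric] by (simp add: power_mult_distrib mult_ac flip: power_add power_mult)
  finally have "(16 * ((b4 * B2_eta) ^ 4 * Phi ^ 24 * Phi2 ^ 8)) * (t2 * U) = (16 * ((b4 * B2_eta) ^ 4 * Phi ^ 24 * Phi2 ^ 8)) * fps_X"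
    by (simp add: mult_ac)
  moreover have "fps_nth ((b4 * B2_eta) ^ 4 * Phi ^ 24 * Phi2 ^ 8) 0 = 1"
    by (simp add: B2_eta_def Phi_nth_0 fps_nth_power_0 ab4_nth)
  then have "(b4 * B2_eta) ^ 4 * Phi ^ 24 * Phi2 ^ 8 \<noteq> 0"
    by auto
  ultimately have "t2 * U = fps_X"
    by simp
  then show ?thesis
    unfolding S_def[symmetric] U_def[symmetric] by (rule fps_eq_mult_inverse) (simp add: U0)
qed

text \<open>Both sides have logarithmic derivative Z w. For the right side this is
  \<open>1 + qD E = Z * w\<close>: the composed series contributes -Z w (Z - 1), and
  \<open>eis\<close> cancels the resulting Z^2 w against Q1 and its dilation, up to a constant that
  absorbs the 1. The hypothesis \<open>w1\<close> makes t start with q, as the exponential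
  does.\<close>

theorem uniformizer_exp:
  fixes Z w h t :: "complex fps" and a :: "nat \<Rightarrow> complex"
  assumes Z0: "fps_nth Z 0 = 1" and w0: "fps_nth w 0 = 1" and w1: "fps_nth w (Suc 0) = - c / 2" and c: "c \<noteq> 0"
    and DZ: "qD Z = Z * h"
    and Dw: "2 * qD w = - (1 - w ^ 2) * Z"
    and Dh: "2 * qD h = h ^ 2 + fps_const \<alpha> * (1 - w ^ 2) * Z ^ 2"
    and eis: "of_nat (N ^ 2 - 1) * (Z ^ 2 * w) = of_nat (N ^ 2) * dil N Q1 - Q1" and N: "N > 1"
    and t: "t = fps_const (1 / c) * (1 - w ^ 2)"
    and a0: "a 0 = 1"
    and rec: "\<And>n. of_nat (Suc n) ^ 3 * a (Suc n) = c * (of_nat n + 1/2) * (of_nat n ^ 2 + of_nat n + \<alpha>) * a n"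
  shows "t = fps_X * fexp (fps_const (240 / (of_nat N ^ 2 - 1)) * (of_nat N * dil N (lsig 3) - lsig 3)
                - fps_compose (Abs_fps (\<lambda>n. a n / of_nat n)) t)"
proof -
  note hyp = hypergeometric_modular_parametrization[OF Z0 w0 c DZ Dw Dh t a0 rec]
  have t0: "fps_nth t 0 = 0"
    by (simp add: t w0 fps_nth_power_0)
  \<comment> \<open>Division by zero makes the term for n = 0 vanish, so the series starts at n = 1
    and \<open>1 + qD SA\<close> recovers a because \<open>a 0 = 1\<close>.\<close>
  define SA where "SA = Abs_fps (\<lambda>n. a n / of_nat n)"
  define k where "k = fps_const (240 / (of_nat N ^ 2 - 1 :: complex))"
  define E where "E = k * (of_nat N * dil N (lsig 3) - lsig 3) - fps_compose SA t"
  have N': "of_nat N ^ 2 - (1 :: complex) \<noteq> 0"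
    using N of_nat_eq_iff[of "N ^ 2" 1, where ?'a = complex] by (simp add: power2_eq_square)
  have E0: "fps_nth E 0 = 0"
    using N by (simp add: E_def SA_def dil_nth)
  have "Abs_fps a = 1 + qD SA"
    by (rule fps_ext) (auto simp: SA_def a0)
  then have SA: "fps_compose (qD SA) t = Z - 1"
    using hyp(1) by (simp add: fps_compose_add_distrib eq_diff_eq add.commute)
  have Q: "240 * qD (lsig 3) = Q1 - 1"
    by (simp add: Q_eis_def eis_lsig flip: numeral_fps_const)
  have QN: "240 * (of_nat N * dil N (qD (lsig 3))) = of_nat N * (dil N Q1 - 1)"
  proof -
    have "240 * dil N (qD (lsig 3)) = dil N (240 * qD (lsig 3))"
      using N by (simp add: dil_simps)
    then show ?thesis
      unfolding Q using N by (simp add: dil_simps mult.left_commute)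
  qed
  have k: "of_nat (N ^ 2 - 1) * k = 240"
  proof -
    have "of_nat (N ^ 2 - 1) * k = fps_const (of_nat (N ^ 2 - 1) * (240 / (of_nat N ^ 2 - 1)))"
      unfolding k_def by (simp only: fps_of_nat[symmetric] fps_const_mult)
    also have "of_nat (N ^ 2 - 1) = (of_nat N ^ 2 - 1 :: complex)"
      using N by (subst of_nat_diff) auto
    finally show ?thesis
      by (simp only: times_divide_eq_right nonzero_mult_div_cancel_left[OF N'] numeral_fps_const)
  qed
  have nz: "of_nat (N ^ 2 - 1) \<noteq> (0 :: complex fps)"
    unfolding fps_of_nat[symmetric] fps_const_eq_0_iff of_nat_eq_0_iff
    using one_less_power[OF N, of 2] by simp
  have "qD (fps_compose SA t) = Z * w * (Z - 1)"
    using qD_compose[OF t0 hyp(2), of SA] SA by simp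
  then have DE: "qD E = k * (of_nat N * (of_nat N * dil N (qD (lsig 3))) - qD (lsig 3)) - Z * w * (Z - 1)"
    using N unfolding E_def k_def by (simp add: qD_diff qD_mult qD_dil flip: fps_of_nat)
  have "of_nat (N ^ 2 - 1) * (1 + qD E) = of_nat (N ^ 2 - 1) * (Z * w)"
  proof -
    have "of_nat (N ^ 2 - 1) * (1 + qD E) = of_nat (N ^ 2 - 1) + (of_nat (N ^ 2 - 1) * k) * (of_nat N * (of_nat N * dil N (qD (lsig 3))) - qD (lsig 3))
       - of_nat (N ^ 2 - 1) * (Z ^ 2 * w) + of_nat (N ^ 2 - 1) * (Z * w)"
      unfolding DE by algebra
    also have "(of_nat (N ^ 2 - 1) * k) * (of_nat N * (of_nat N * dil N (qD (lsig 3))) - qD (lsig 3))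
       = of_nat N * (240 * (of_nat N * dil N (qD (lsig 3)))) - 240 * qD (lsig 3)"
      unfolding k by algebra
    also have "\<dots> = of_nat N * (of_nat N * (dil N Q1 - 1)) - (Q1 - 1)"
      unfolding QN Q ..
    finally show ?thesis
      unfolding eis using N by (simp add: of_nat_diff power2_eq_square algebra_simps)
  qed
  then have DE1: "1 + qD E = Z * w"
    using nz by simp
  have "t = fps_X * fexp E"
  proof (rule qD_eq_by_log_derivative[where r = 1])
    show "qD t = (Z * w) * t"
      by (rule hyp(2))
    show "qD (fps_X * fexp E) = (1 + qD E) * (fps_X * fexp E)"
      by (intro qD_log_mult qD_X qD_fexp E0)
    show "Z * w = 1 + qD E"
      using DE1 ..
    show "fps_nth (Z * w) 0 = of_nat 1"
      by (simp add: Z0 w0)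
  next
    fix n :: nat assume "n \<le> 1"
    then show "fps_nth t n = fps_nth (fps_X * fexp E) n"
      using c by (auto simp: le_Suc_eq t w0 w1 E0 power2_eq_square)
  qed
  then show ?thesis
    unfolding E_def SA_def k_def .
qed

section \<open>Lambert series and infinite products\<close>

lemma summable_power_mult_power:
  fixes x :: real
  assumes "norm x < 1"
  shows "summable (\<lambda>n. of_nat n ^ k * x ^ n)"
  using assms
proof (induction k arbitrary: x)
  case 0
  then show ?case by (simp add: summable_geometric)
next
  case (Suc k)
  have "summable (\<lambda>n. diffs (\<lambda>n. of_nat n ^ k) n * x ^ n)"
    by (rule termdiff_converges[of x 1]) (use Suc in auto)
  then have "summable (\<lambda>n. x * (of_nat (Suc n) ^ Suc k * x ^ n))"
    by (intro summable_mult) (simp add: diffs_def)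
  then have "summable (\<lambda>n. of_nat (Suc n) ^ Suc k * x ^ Suc n)"
    by (simp only: power_Suc mult_ac)
  then show ?case
    by (subst (asm) summable_Suc_iff)
qed

lemma lambert_pairs_summable:
  fixes q :: complex
  assumes q: "norm q < 1"
  shows "(\<lambda>(n,m). of_nat (Suc n) ^ k * q ^ (Suc n * Suc m) / of_nat (Suc m)) summable_on UNIV \<times> UNIV"
proof -
  define r where "r = norm q"
  have r: "0 \<le> r" "r < 1" using q by (auto simp: r_def)
  define A where "A = (\<lambda>n. of_nat (Suc n) ^ k * r ^ Suc n)"
  have "summable (\<lambda>n. of_nat n ^ k * r ^ n)"
    by (rule summable_power_mult_power) (use r in auto)
  then have A: "summable A"
    unfolding A_def by (subst summable_Suc_iff)
  have A0: "A n \<ge> 0" for n using r by (simp add: A_def)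
  have A': "A summable_on UNIV"
    using A A0 by (subst summable_on_UNIV_nonneg_real_iff) auto
  have geo: "((\<lambda>m. r ^ m) has_sum (1 / (1 - r))) UNIV"
    using r by (intro norm_summable_imp_has_sum geometric_sums) (auto simp: summable_geometric)
  have "(\<lambda>(n,m). A n * r ^ m) summable_on UNIV \<times> UNIV"
  proof (rule summable_on_SigmaI)
    show "((\<lambda>m. case (n, m) of (n, m) \<Rightarrow> A n * r ^ m) has_sum (A n * (1 / (1 - r)))) UNIV" for n
      using has_sum_cmult_right[OF geo, of "A n"] by simp
    show "(\<lambda>n. A n * (1 / (1 - r))) summable_on UNIV"
      by (rule summable_on_cmult_left[OF A'])
  qed (use r A0 in auto)
  then have "(\<lambda>p. norm (case p of (n,m) \<Rightarrow> of_nat (Suc n) ^ k * q ^ (Suc n * Suc m) / of_nat (Suc m))) summable_on UNIV \<times> UNIV"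
  proof (rule summable_on_comparison_test)
    fix p :: "nat \<times> nat"
    obtain n m where p: "p = (n, m)" by (cases p)
    have "norm (of_nat (Suc n) ^ k * q ^ (Suc n * Suc m) / of_nat (Suc m) :: complex) =
        of_nat (Suc n) ^ k * (r ^ (Suc n * Suc m) / of_nat (Suc m))"
      by (simp add: norm_mult norm_divide norm_power r_def del: of_nat_Suc mult_Suc mult_Suc_right)
    also have "\<dots> \<le> of_nat (Suc n) ^ k * r ^ (Suc n * Suc m)"
      using r divide_left_mono[of 1 "real (Suc m)" "r ^ (Suc n * Suc m)"] by (intro mult_left_mono) auto
    \<comment> \<open>The exponent satisfies \<open>Suc n * Suc m \<ge> Suc n + m\<close>, which
      separates the two indices.\<close>
    also have "\<dots> \<le> of_nat (Suc n) ^ k * r ^ (Suc n + m)"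
      using r by (intro mult_left_mono power_decreasing) auto
    finally show "norm (case p of (n,m) \<Rightarrow> of_nat (Suc n) ^ k * q ^ (Suc n * Suc m) / of_nat (Suc m)) \<le> (case p of (n,m) \<Rightarrow> A n * r ^ m)"
      by (simp add: p A_def power_add mult_ac del: of_nat_Suc)
  qed auto
  then show ?thesis
    by (rule abs_summable_summable)
qed

text \<open>One absolutely summable double series, with terms n^k q^(n m) / m, is summed in two
  ways: over m for fixed n it gives logarithms, and over n m = N it gives divisor sums, since n^k /
  m = n^(k+1) / N. This explains the shift from k to \<open>Suc k\<close>.\<close>

theorem lambert_log_sums:
  fixes q :: complex
  assumes q: "norm q < 1"
  shows "(\<lambda>n. fps_nth (lsig (Suc k)) n * q ^ n) sums eval_fps (lsig (Suc k)) q"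
    and "(\<lambda>n. of_nat (Suc n) ^ k * ln (1 - q ^ Suc n)) sums (- eval_fps (lsig (Suc k)) q)"
proof -
  define f where "f = (\<lambda>(n,m). of_nat (Suc n) ^ k * q ^ (Suc n * Suc m) / of_nat (Suc m) :: complex)"
  define S where "S = infsum f (UNIV \<times> UNIV)"
  have S: "(f has_sum S) (UNIV \<times> UNIV)"
    unfolding S_def f_def by (intro has_sum_infsum lambert_pairs_summable q)
  have row: "((\<lambda>m. f (n, m)) has_sum (- (of_nat (Suc n) ^ k * ln (1 - q ^ Suc n)))) UNIV" for n
  proof -
    define z where "z = q ^ Suc n"
    have z: "norm z < 1"
      unfolding z_def norm_power using q by (cases "q = 0") (auto intro!: power_Suc_less_one simp del: power_Suc)
    have s: "(\<lambda>m. - ((- (- z)) ^ m) / of_nat m) sums ln (1 + (- z))"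
      by (rule Ln_series') (use z in simp)
    then have "(\<lambda>m. - (- (z ^ m) / of_nat m)) sums (- ln (1 - z))"
      by (intro sums_minus) simp
    then have "(\<lambda>m. z ^ m / of_nat m) sums (- ln (1 - z))"
      by simp
    then have "(\<lambda>m. z ^ Suc m / of_nat (Suc m)) sums (- ln (1 - z))"
      by (subst sums_Suc_iff) simp
    moreover have "summable (\<lambda>m. norm (z ^ Suc m / of_nat (Suc m)))"
    proof (rule summable_comparison_test)
      show "\<exists>N. \<forall>m\<ge>N. norm (norm (z ^ Suc m / of_nat (Suc m))) \<le> norm z ^ m"
      proof (intro exI allI impI)
        fix m
        have "norm (z ^ Suc m / of_nat (Suc m)) = norm z ^ m * (norm z / real (Suc m))"
          by (simp add: norm_mult norm_divide norm_power del: of_nat_Suc)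
        also have "\<dots> \<le> norm z ^ m * 1"
          using z by (intro mult_left_mono) (auto simp: divide_le_eq)
        finally show "norm (norm (z ^ Suc m / of_nat (Suc m))) \<le> norm z ^ m"
          by simp
      qed
      show "summable (\<lambda>m. norm z ^ m)"
        using z by (simp add: summable_geometric)
    qed
    ultimately have "((\<lambda>m. z ^ Suc m / of_nat (Suc m)) has_sum (- ln (1 - z))) UNIV"
      by (intro norm_summable_imp_has_sum)
    from has_sum_cmult_right[OF this, of "of_nat (Suc n) ^ k"] show ?thesis
      by (simp add: f_def z_def power_mult[symmetric] del: of_nat_Suc mult_Suc power_Suc)
  qed
  have "((\<lambda>n. - (of_nat (Suc n) ^ k * ln (1 - q ^ Suc n))) has_sum S) UNIV"
    by (rule has_sum_SigmaD[OF S row])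
  from sums_minus[OF has_sum_imp_sums[OF this]]
  have 1: "(\<lambda>n. of_nat (Suc n) ^ k * ln (1 - q ^ Suc n)) sums (- S)"
    by simp
  have "((\<lambda>(N,d). of_nat d ^ Suc k / of_nat N * q ^ N) has_sum S) (SIGMA N:{0<..}. {d. d dvd N})"
  proof (rule has_sum_reindex_bij_witness[where i = "\<lambda>(N,d). (d - 1, N div d - 1)"
      and j = "\<lambda>(n,m). (Suc n * Suc m, Suc n)", THEN iffD1, OF _ _ _ _ _ refl S])
    fix p :: "nat \<times> nat"
    obtain n m where p: "p = (n, m)" by (cases p)
    show "(\<lambda>(N,d). (d - 1, N div d - 1)) ((\<lambda>(n,m). (Suc n * Suc m, Suc n)) p) = p"
      by (simp add: p del: mult_Suc mult_Suc_right)
    show "(\<lambda>(n,m). (Suc n * Suc m, Suc n)) p \<in> (SIGMA N:{0<..}. {d. d dvd N})"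
      by (simp add: p del: mult_Suc mult_Suc_right)
    show "(\<lambda>(N,d). of_nat d ^ Suc k / of_nat N * q ^ N) ((\<lambda>(n,m). (Suc n * Suc m, Suc n)) p) = f p"
      by (simp add: p f_def field_simps del: mult_Suc mult_Suc_right of_nat_Suc)
  next
    fix p :: "nat \<times> nat" assume "p \<in> (SIGMA N:{0<..}. {d. d dvd N})"
    then obtain d m where p: "p = (d * m, d)" "d > 0" "m > 0"
      by (cases p) (auto elim!: dvdE)
    show "(\<lambda>(n,m). (Suc n * Suc m, Suc n)) ((\<lambda>(N,d). (d - 1, N div d - 1)) p) = p"
      using p by (cases m) (auto simp: Suc_diff_1 algebra_simps)
  qed auto
  then have "((\<lambda>N. fps_nth (lsig (Suc k)) N * q ^ N) has_sum S) {0<..}"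
  proof (rule has_sum_SigmaD)
    fix N :: nat assume "N \<in> {0<..}"
    then show "((\<lambda>d. case (N, d) of (N, d) \<Rightarrow> of_nat d ^ Suc k / of_nat N * q ^ N) has_sum (fps_nth (lsig (Suc k)) N * q ^ N)) {d. d dvd N}"
      by (intro has_sum_finiteI) (auto simp: lsig_def dsig_def sum_divide_distrib sum_distrib_right)
  qed
  then have "((\<lambda>N. fps_nth (lsig (Suc k)) N * q ^ N) has_sum S) UNIV"
    by (rule has_sum_cong_neutral[THEN iffD1, rotated -1]) auto
  then have 2: "(\<lambda>N. fps_nth (lsig (Suc k)) N * q ^ N) sums S"
    by (rule has_sum_imp_sums)
  then have "eval_fps (lsig (Suc k)) q = S"
    by (simp add: eval_fps_def sums_iff)
  with 1 2 show "(\<lambda>n. fps_nth (lsig (Suc k)) n * q ^ n) sums eval_fps (lsig (Suc k)) q"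
    "(\<lambda>n. of_nat (Suc n) ^ k * ln (1 - q ^ Suc n)) sums (- eval_fps (lsig (Suc k)) q)"
    by simp_all
qed

lemma eventually_norm_less: "r > 0 \<Longrightarrow> eventually (\<lambda>q :: complex. norm q < r) (nhds 0)"
  using eventually_nhds_in_open[of "ball 0 r" "0 :: complex"] by (simp add: dist_norm)

lemma lsig_has_fps_expansion: "eval_fps (lsig (Suc k)) has_fps_expansion lsig (Suc k)"
  by (rule has_fps_expansionI) (use eventually_norm_less[of 1] in \<open>auto elim!: eventually_mono intro: lambert_log_sums\<close>)

lemma G_eq:
  assumes "norm q < 1" "q \<noteq> 0"
  shows "G q = - ln (norm q) - 240 * Re (eval_fps (lsig 3) q)"
proof -
  have "(\<Sum>n. of_nat (Suc n) ^ 2 * ln (1 - q ^ Suc n)) = - eval_fps (lsig 3) q"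
    using lambert_log_sums(2)[OF assms(1), of 2] by (simp add: sums_iff eval_nat_numeral)
  then show ?thesis
    using assms(2) by (simp add: G_def)
qed

section \<open>q-Pochhammer symbols and Euler's product as analytic functions\<close>

lemma qpoch_LIMSEQ:
  assumes q: "norm q < 1" and x: "norm x < 1"
  shows "(\<lambda>n. \<Prod>j<n. 1 - x * q ^ j) \<longlonglongrightarrow> qpoch x q"
proof -
  have lt: "norm (x * q ^ j) < 1" for j
  proof -
    have "norm (x * q ^ j) \<le> norm x * 1"
      unfolding norm_mult norm_power using q by (intro mult_left_mono power_le_one) auto
    then show ?thesis using x by simp
  qed
  have "convergent_prod (\<lambda>j. 1 + - (x * q ^ j))"
  proof (rule summable_imp_convergent_prod_complex)
    show "summable (\<lambda>j. norm (- (x * q ^ j)))"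
      unfolding norm_minus_cancel norm_mult norm_power using q by (intro summable_mult summable_geometric) auto
    show "- (x * q ^ j) \<noteq> - 1" for j
      using lt[of j] by auto
  qed
  from convergent_prod_LIMSEQ[OF this] show ?thesis
    unfolding qpoch_def LIMSEQ_lessThan_iff_atMost by simp
qed

definition euler_phi :: "complex \<Rightarrow> complex" where
  "euler_phi q = qpoch q q"

lemma euler_phi_exp:
  assumes q: "norm q < 1"
  shows "euler_phi q = exp (- eval_fps (lsig 1) q)"
proof -
  have s: "(\<lambda>n. ln (1 - q ^ Suc n)) sums (- eval_fps (lsig 1) q)"
    using lambert_log_sums(2)[OF q, of 0] by simp
  have "1 - q ^ Suc n \<noteq> 0" for n
  proof
    assume "1 - q ^ Suc n = 0"
    then have "norm (q ^ Suc n) = 1" by simp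
    moreover have "norm (q ^ Suc n) < 1"
      unfolding norm_power using q by (cases "q = 0") (auto intro!: power_Suc_less_one simp del: power_Suc)
    ultimately show False by simp
  qed
  then have "(\<lambda>n. exp (ln (1 - q ^ Suc n))) = (\<lambda>n. 1 - q * q ^ n)"
    by auto
  then show ?thesis
    using prodinf_exp[of "\<lambda>n. ln (1 - q ^ Suc n)"] s by (simp add: euler_phi_def qpoch_def sums_iff)
qed

lemma euler_phi_nonzero: "norm q < 1 \<Longrightarrow> euler_phi q \<noteq> 0"
  by (simp add: euler_phi_exp)

lemma has_fps_expansion_cong':
  assumes "f has_fps_expansion F" "eventually (\<lambda>q. f q = g q) (nhds 0)"
  shows "g has_fps_expansion F"
proof -
  have "eventually (\<lambda>z. eval_fps F z = f z) (nhds 0)"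
    using assms(1) by (auto simp: has_fps_expansion_def)
  with assms(2) have "eventually (\<lambda>z. eval_fps F z = g z) (nhds 0)"
    by eventually_elim simp
  then show ?thesis
    using assms(1) by (auto simp: has_fps_expansion_def)
qed

text \<open>The passage from formal identities to identities of functions near 0.\<close>

lemma has_fps_expansion_eventually_eq:
  assumes "f has_fps_expansion F" "g has_fps_expansion F"
  shows "eventually (\<lambda>q. f q = g q) (nhds 0)"
proof -
  have "eventually (\<lambda>z. eval_fps F z = f z) (nhds 0)" "eventually (\<lambda>z. eval_fps F z = g z) (nhds 0)"
    using assms by (auto simp: has_fps_expansion_def)
  then show ?thesis by eventually_elim simp
qed

lemma has_fps_expansion_fexp:
  assumes "f has_fps_expansion F" "fps_nth F 0 = 0"
  shows "(\<lambda>q. exp (f q)) has_fps_expansion fexp F"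
  using has_fps_expansion_compose[OF has_fps_expansion_exp[of 1] assms] by (simp add: fexp_def o_def)

lemma euler_phi_expansion: "euler_phi has_fps_expansion Phi"
proof (rule has_fps_expansion_cong')
  show "(\<lambda>q. exp (- eval_fps (lsig 1) q)) has_fps_expansion Phi"
    unfolding Phi_def using lsig_has_fps_expansion[of 0]
    by (intro has_fps_expansion_fexp has_fps_expansion_minus) simp_all
  show "eventually (\<lambda>q. exp (- eval_fps (lsig 1) q) = euler_phi q) (nhds 0)"
    using eventually_norm_less[of 1] by (auto elim!: eventually_mono simp: euler_phi_exp)
qed

lemma has_fps_expansion_dil:
  assumes "f has_fps_expansion F" "m > 0"
  shows "(\<lambda>q. f (q ^ m)) has_fps_expansion dil m F"
  using has_fps_expansion_compose[OF assms(1) has_fps_expansion_fps_X_power[of m]] assms(2)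
  by (simp add: dil_def o_def fps_X_power_nth)

lemma norm_power_less_one:
  fixes q :: complex
  assumes "norm q < 1" "m > 0"
  shows "norm (q ^ m) < 1"
  using assms by (cases "q = 0") (simp_all add: norm_power power_less_one_iff power_0_left)

lemma qpoch_odd_even:
  assumes q: "norm q < 1"
  shows "euler_phi q = qpoch q (q ^ 2) * euler_phi (q ^ 2)"
proof (rule LIMSEQ_unique)
  have q2: "norm (q ^ 2) < 1"
    using q by (rule norm_power_less_one) simp
  have "strict_mono (\<lambda>n::nat. 2 * n)"
    by (rule strict_monoI) simp
  from LIMSEQ_subseq_LIMSEQ[OF qpoch_LIMSEQ[OF q q] this]
  show "(\<lambda>n. \<Prod>j<2 * n. 1 - q * q ^ j) \<longlonglongrightarrow> euler_phi q"
    by (simp add: o_def euler_phi_def)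
  have "(\<lambda>n. (\<Prod>j<n. 1 - q * (q ^ 2) ^ j) * (\<Prod>j<n. 1 - q ^ 2 * (q ^ 2) ^ j)) \<longlonglongrightarrow> qpoch q (q ^ 2) * euler_phi (q ^ 2)"
    unfolding euler_phi_def by (intro tendsto_mult qpoch_LIMSEQ q q2)
  moreover have "(\<Prod>j<n. 1 - q * (q ^ 2) ^ j) * (\<Prod>j<n. 1 - q ^ 2 * (q ^ 2) ^ j) = (\<Prod>j<2 * n. 1 - q * q ^ j)" for n
  proof -
    have e: "q * (q ^ 2) ^ j = q ^ (2 * j + 1)" "q ^ 2 * (q ^ 2) ^ j = q ^ (2 * j + 2)" "q * q ^ j = q ^ (j + 1)" for j
      by (simp_all add: power_add power_mult power2_eq_square power_mult_distrib mult_ac)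
    show ?thesis
      unfolding e by (induction n) (simp_all add: mult_ac del: power_Suc)
  qed
  ultimately show "(\<lambda>n. \<Prod>j<2 * n. 1 - q * q ^ j) \<longlonglongrightarrow> qpoch q (q ^ 2) * euler_phi (q ^ 2)"
    by simp
qed

lemma qpoch_plus_minus:
  assumes q: "norm q < 1"
  shows "qpoch q (q ^ 2) * qpoch (- q) (q ^ 2) = qpoch (q ^ 2) (q ^ 4)"
proof (rule LIMSEQ_unique)
  have q2: "norm (q ^ 2) < 1" "norm (q ^ 4) < 1"
    by (rule norm_power_less_one[OF q]; simp)+
  show "(\<lambda>n. (\<Prod>j<n. 1 - q * (q ^ 2) ^ j) * (\<Prod>j<n. 1 - (- q) * (q ^ 2) ^ j)) \<longlonglongrightarrow> qpoch q (q ^ 2) * qpoch (- q) (q ^ 2)"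
    by (intro tendsto_mult qpoch_LIMSEQ) (use q q2 in auto)
  have eq: "(1 - q * (q ^ 2) ^ j) * (1 - (- q) * (q ^ 2) ^ j) = 1 - q ^ 2 * (q ^ 4) ^ j" for j
  proof -
    have "(q ^ 4) ^ j = (q ^ 2) ^ j * (q ^ 2) ^ j"
      by (simp flip: power_mult power_add)
    moreover have "(1 - q * z) * (1 - (- q) * z) = 1 - q ^ 2 * (z * z)" for z
      by algebra
    ultimately show ?thesis by (simp only:)
  qed
  have "(\<lambda>n. \<Prod>j<n. 1 - q ^ 2 * (q ^ 4) ^ j) \<longlonglongrightarrow> qpoch (q ^ 2) (q ^ 4)"
    by (intro qpoch_LIMSEQ q2)
  then show "(\<lambda>n. (\<Prod>j<n. 1 - q * (q ^ 2) ^ j) * (\<Prod>j<n. 1 - (- q) * (q ^ 2) ^ j)) \<longlonglongrightarrow> qpoch (q ^ 2) (q ^ 4)"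
    unfolding eq[symmetric] prod.distrib .
qed

text \<open>Splitting Euler's product into odd and even exponents gives (q; q^2) = phi(q) /
  phi(q^2), and (q; q^2) (-q; q^2) = (q^2; q^4) is treated by the same splitting with q^2 for
  q.\<close>

lemma qpoch_weber:
  assumes q: "norm q < 1"
  shows "qpoch (- q) (q ^ 2) = euler_phi (q ^ 2) ^ 2 * inverse (euler_phi q * euler_phi (q ^ 4))"
proof -
  have q2: "norm (q ^ 2) < 1" "norm (q ^ 4) < 1"
    by (rule norm_power_less_one[OF q]; simp)+
  have "euler_phi (q ^ 2) = qpoch (q ^ 2) (q ^ 4) * euler_phi (q ^ 4)"
    using qpoch_odd_even[OF q2(1)] by (simp flip: power_mult)
  then have "euler_phi q * euler_phi (q ^ 4) * qpoch (- q) (q ^ 2) = euler_phi (q ^ 2) ^ 2"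
    using qpoch_odd_even[OF q] qpoch_plus_minus[OF q] by algebra
  moreover have "euler_phi q \<noteq> 0" "euler_phi (q ^ 4) \<noteq> 0"
    by (rule euler_phi_nonzero[OF q] euler_phi_nonzero[OF q2(2)])+
  ultimately show ?thesis
    by (simp add: field_simps)
qed

text \<open>The function s2 has a pole at 0, so its reciprocal is expanded; likewise for s3 and
  s4.\<close>

lemma s2_expansion:
  "(\<lambda>q. q * inverse ((euler_phi (q ^ 2) ^ 2 * inverse (euler_phi q * euler_phi (q ^ 4))) ^ 24)) has_fps_expansion t4"
  unfolding t4_eta
  by (intro has_fps_expansion_fps_X has_fps_expansion_mult has_fps_expansion_inverse has_fps_expansion_power
      has_fps_expansion_dil euler_phi_expansion) (simp_all add: Phi_nth_0 fps_nth_power_0)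

lemma s3_expansion:
  "(\<lambda>q. q * inverse ((27 * q * (euler_phi (q ^ 3) ^ 6 * inverse (euler_phi q ^ 6)) + euler_phi q ^ 6 * inverse (euler_phi (q ^ 3) ^ 6)) ^ 2))
     has_fps_expansion t3"
  unfolding t3_eta A3_eta_def A3_inv_def
  by (intro has_fps_expansion_fps_X has_fps_expansion_mult has_fps_expansion_inverse has_fps_expansion_power
      has_fps_expansion_add has_fps_expansion_numeral has_fps_expansion_dil euler_phi_expansion)
     (simp_all add: Phi_nth_0 fps_nth_power_0)

lemma s4_expansion:
  "(\<lambda>q. q * inverse (euler_phi (q ^ 2) ^ 24 * inverse (euler_phi q ^ 24) *
     (16 * q * (euler_phi q ^ 4 * euler_phi (q ^ 4) ^ 8 * inverse (euler_phi (q ^ 2) ^ 12)) +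
      euler_phi (q ^ 2) ^ 12 * inverse (euler_phi q ^ 4 * euler_phi (q ^ 4) ^ 8)) ^ 4)) has_fps_expansion t2"
  unfolding t2_eta B2_eta_def B2_inv_def
  by (intro has_fps_expansion_fps_X has_fps_expansion_mult has_fps_expansion_inverse has_fps_expansion_power
      has_fps_expansion_add has_fps_expansion_numeral has_fps_expansion_dil euler_phi_expansion)
     (simp_all add: Phi_nth_0 fps_nth_power_0)

lemma inverse_s2: "norm q < 1 \<Longrightarrow> inverse (s2 q) =
    q * inverse ((euler_phi (q ^ 2) ^ 2 * inverse (euler_phi q * euler_phi (q ^ 4))) ^ 24)"
  by (simp add: s2_def qpoch_weber)

lemma inverse_s3: "inverse (s3 q) =
    q * inverse ((27 * q * (euler_phi (q ^ 3) ^ 6 * inverse (euler_phi q ^ 6)) + euler_phi q ^ 6 * inverse (euler_phi (q ^ 3) ^ 6)) ^ 2)"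
  by (simp add: s3_def euler_phi_def divide_inverse)

lemma inverse_s4: "inverse (s4 q) =
    q * inverse (euler_phi (q ^ 2) ^ 24 * inverse (euler_phi q ^ 24) *
     (16 * q * (euler_phi q ^ 4 * euler_phi (q ^ 4) ^ 8 * inverse (euler_phi (q ^ 2) ^ 12)) +
      euler_phi (q ^ 2) ^ 12 * inverse (euler_phi q ^ 4 * euler_phi (q ^ 4) ^ 8)) ^ 4)"
  by (simp add: s4_def euler_phi_def divide_inverse)

lemma log_series_expansion:
  fixes a :: "nat \<Rightarrow> complex"
  assumes B: "\<And>n. norm (a n) \<le> B ^ n" and B0: "B > 0"
  defines "F \<equiv> Abs_fps (\<lambda>n. a n / of_nat n)"
  shows "eval_fps F has_fps_expansion F"
    and "norm x < 1 / B \<Longrightarrow> (\<lambda>n. a n / of_nat n * x ^ n) sums eval_fps F x"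
proof -
  have sums: "(\<lambda>n. fps_nth F n * x ^ n) sums eval_fps F x" if x: "norm x < 1 / B" for x
  proof -
    have "summable (\<lambda>n. fps_nth F n * x ^ n)"
    proof (rule summable_comparison_test)
      show "\<exists>N. \<forall>n\<ge>N. norm (fps_nth F n * x ^ n) \<le> (B * norm x) ^ n"
      proof (intro exI allI impI)
        fix n :: nat
        have "norm (a n / of_nat n) \<le> norm (a n)"
          by (cases n) (auto simp: norm_divide divide_le_eq mult_le_cancel_left1 simp del: of_nat_Suc)
        then have "norm (a n / of_nat n) \<le> B ^ n"
          using B[of n] by linarith
        then show "norm (fps_nth F n * x ^ n) \<le> (B * norm x) ^ n"
          unfolding F_def fps_nth_Abs_fps norm_mult norm_power power_mult_distrib
          by (rule mult_right_mono) simp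
      qed
      show "summable (\<lambda>n. (B * norm x) ^ n)"
        using x B0 by (intro summable_geometric) (simp add: field_simps)
    qed
    then show ?thesis
      by (simp add: eval_fps_def summable_sums)
  qed
  show "eval_fps F has_fps_expansion F"
    by (rule has_fps_expansionI) (use eventually_norm_less[of "1 / B"] B0 in \<open>auto elim!: eventually_mono intro: sums\<close>)
  show "norm x < 1 / B \<Longrightarrow> (\<lambda>n. a n / of_nat n * x ^ n) sums eval_fps F x"
    using sums[of x] by (simp add: F_def)
qed

text \<open>Take absolute values in 1 / s = q exp(E). The terms in ln |q| agree because (N * N - 1)
  / (N^2 - 1) = 1, and the rest of Re E is the combination of the series in G, less F. The second
  claim, from \<open>\<tau>\<close> tending to 0, brings s(q) into the range where the Mahler
  measures are power series in 1 / s(q).\<close>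

theorem log_uniformizer:
  fixes s \<tau> :: "complex \<Rightarrow> complex"
  assumes \<tau>: "\<tau> has_fps_expansion t"
    and s: "eventually (\<lambda>q. inverse (s q) = \<tau> q) (at 0)"
    and t: "t = fps_X * fexp (fps_const (240 / (of_nat N ^ 2 - 1)) * (of_nat N * dil N (lsig 3) - lsig 3) - fps_compose F t)"
    and F: "eval_fps F has_fps_expansion F" "fps_nth F 0 = 0" and N: "N > 1"
  shows "eventually (\<lambda>q. ln (norm (s q)) - Re (eval_fps F (inverse (s q))) =
            (real N * G (q ^ N) - G q) / (real N ^ 2 - 1)) (at 0)"
    and "eventually (\<lambda>q. norm (s q) > B) (at 0)"
proof -
  define k :: real where "k = 240 / (real N ^ 2 - 1)"
  define E where "E = (\<lambda>q. of_real k * (of_nat N * eval_fps (lsig 3) (q ^ N) - eval_fps (lsig 3) q) - (eval_fps F \<circ> \<tau>) q)"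
  have t0: "fps_nth t 0 = 0"
    by (subst t) simp
  have L: "eval_fps (lsig 3) has_fps_expansion lsig 3"
    using lsig_has_fps_expansion[of 2] by (simp add: eval_nat_numeral)
  have kc: "of_real k = 240 / (of_nat N ^ 2 - 1 :: complex)"
    by (simp add: k_def)
  have "E has_fps_expansion (fps_const (240 / (of_nat N ^ 2 - 1)) * (of_nat N * dil N (lsig 3) - lsig 3) - fps_compose F t)"
    unfolding E_def kc fps_of_nat[symmetric] using N
    by (intro has_fps_expansion_diff has_fps_expansion_mult has_fps_expansion_const has_fps_expansion_dil
        has_fps_expansion_compose L F \<tau> t0) auto
  then have "(\<lambda>q. q * exp (E q)) has_fps_expansion t"
    using N F(2) by (subst t) (intro has_fps_expansion_mult has_fps_expansion_fps_X has_fps_expansion_fexp, simp_all add: dil_nth)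
  from has_fps_expansion_eventually_eq[OF \<tau> this]
  have eq: "eventually (\<lambda>q. \<tau> q = q * exp (E q)) (at 0)"
    by (simp add: eventually_at_filter eventually_mono)
  have nz: "eventually (\<lambda>q :: complex. q \<noteq> 0) (at 0)"
    by (simp add: eventually_at_filter)
  have small: "eventually (\<lambda>q :: complex. norm q < 1) (at 0)"
    using eventually_norm_less[of 1] by (simp add: eventually_at_filter eventually_mono)
  from s eq nz small show "eventually (\<lambda>q. ln (norm (s q)) - Re (eval_fps F (inverse (s q))) =
            (real N * G (q ^ N) - G q) / (real N ^ 2 - 1)) (at 0)"
  proof eventually_elim
    case (elim q)
    have qN: "norm (q ^ N) < 1"
      using elim N by (intro norm_power_less_one) auto
    have "norm (s q) = inverse (norm q * exp (Re (E q)))"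
      using elim by (metis inverse_inverse_eq norm_exp_eq_Re norm_inverse norm_mult)
    then have ln: "ln (norm (s q)) = - ln (norm q) - Re (E q)"
      using elim by (simp add: ln_inverse ln_mult)
    have Re: "Re (E q) = k * (real N * Re (eval_fps (lsig 3) (q ^ N)) - Re (eval_fps (lsig 3) q)) - Re (eval_fps F (\<tau> q))"
      by (simp add: E_def)
    have "1 < real N ^ 2"
      using N by (intro one_less_power) auto
    then have "real N ^ 2 \<noteq> 1"
      by simp
    moreover have "ln (norm (q ^ N)) = real N * ln (norm q)"
      using elim by (simp add: norm_power ln_realpow)
    ultimately show ?case
      unfolding ln Re using elim qN N
      by (simp add: G_eq k_def field_simps) (simp add: algebra_simps power2_eq_square)
  qed
  have "continuous (at 0) \<tau>"
    using has_fps_expansion_imp_continuous[OF \<tau>, of UNIV] by simp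
  moreover have "\<tau> 0 = 0"
    using \<tau> t0 has_fps_expansion_imp_0_eq_fps_nth_0 by metis
  ultimately have "(\<tau> \<longlongrightarrow> 0) (at 0)"
    by (simp add: continuous_at isCont_def)
  then have "eventually (\<lambda>q. dist (\<tau> q) 0 < 1 / (\<bar>B\<bar> + 1)) (at 0)"
    by (rule tendstoD) auto
  with s eq nz show "eventually (\<lambda>q. norm (s q) > B) (at 0)"
  proof eventually_elim
    case (elim q)
    then have "\<tau> q \<noteq> 0" by simp
    then have "norm (s q) = 1 / norm (\<tau> q)"
      using elim by (metis inverse_eq_divide inverse_inverse_eq norm_inverse)
    moreover have "\<bar>B\<bar> + 1 < 1 / norm (\<tau> q)"
      using elim(4) \<open>\<tau> q \<noteq> 0\<close> by (simp add: field_simps)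
    ultimately show ?case by simp
  qed
qed

section \<open>Integration over the torus\<close>

lemma integral_lborel_prod:
  fixes f :: "'a::euclidean_space \<Rightarrow> real \<Rightarrow> complex"
  assumes f: "\<And>b. b \<in> Basis \<Longrightarrow> integrable lborel (f b)"
  shows "(\<integral>x. (\<Prod>b\<in>Basis. f b (x \<bullet> b)) \<partial>lborel) = (\<Prod>b\<in>Basis. \<integral>x. f b x \<partial>lborel)"
proof -
  interpret product_sigma_finite "\<lambda>_ :: 'a. lborel :: real measure"
    by unfold_locales
  have [measurable]: "f b \<in> borel_measurable borel" if "b \<in> Basis" for b
    using borel_measurable_integrable[OF f[OF that]] by simp
  have "(\<integral>x. (\<Prod>b\<in>Basis. f b (x \<bullet> b)) \<partial>lborel) =
      (\<integral>x. (\<Prod>b\<in>Basis. f b ((\<Sum>c\<in>Basis. x c *\<^sub>R c) \<bullet> b)) \<partial>(\<Pi>\<^sub>M b\<in>Basis. lborel))"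
    by (subst lborel_eq) (intro integral_distr; measurable)
  also have "\<dots> = (\<integral>x. (\<Prod>b\<in>Basis. f b (x b)) \<partial>(\<Pi>\<^sub>M b\<in>Basis. lborel))"
    by (intro Bochner_Integration.integral_cong prod.cong) simp_all
  also have "\<dots> = (\<Prod>b\<in>Basis. \<integral>x. f b x \<partial>lborel)"
    by (rule product_integral_prod) (use f in auto)
  finally show ?thesis .
qed

lemma Basis_real_3: "(Basis :: (real ^ 3) set) = {axis 1 1, axis 2 1, axis 3 1}"
  by (auto simp: Basis_vec_def UNIV_3)

lemma axis_3_distinct:
  "axis 1 1 \<noteq> (axis 2 1 :: real ^ 3)" "axis 1 1 \<noteq> (axis 3 1 :: real ^ 3)" "axis 2 1 \<noteq> (axis 3 1 :: real ^ 3)"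
  by (simp_all add: axis_eq_axis)

lemma integral_unit_cube_product:
  fixes f g h :: "real \<Rightarrow> complex"
  assumes "continuous_on UNIV f" "continuous_on UNIV g" "continuous_on UNIV h"
  shows "integral (cbox 0 1) (\<lambda>\<theta> :: real ^ 3. f (\<theta> $ 1) * g (\<theta> $ 2) * h (\<theta> $ 3)) =
         integral {0..1} f * integral {0..1} g * integral {0..1} h"
proof -
  \<comment> \<open>The indicator of the cube is distributed over the three factors, so the integral
    over the whole space splits coordinatewise.\<close>
  define F :: "real ^ 3 \<Rightarrow> real \<Rightarrow> complex" where
    "F = (\<lambda>b x. indicator {0..1} x *\<^sub>R (if b = axis 1 1 then f x else if b = axis 2 1 then g x else h x))"
  have cont: "continuous_on {0..1} f" "continuous_on {0..1} g" "continuous_on {0..1} h"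
    using assms by (auto intro: continuous_on_subset)
  have int: "set_integrable lborel {0..1} f" "set_integrable lborel {0..1} g" "set_integrable lborel {0..1} h"
    by (intro borel_integrable_atLeastAtMost' cont)+
  have I: "(\<integral>x. indicator {0..1} x *\<^sub>R k x \<partial>lborel) = integral {0..1} k" if "set_integrable lborel {0..1} k" for k :: "real \<Rightarrow> complex"
    using set_borel_integral_eq_integral(2)[OF that] by (simp add: set_lebesgue_integral_def)
  have c3: "continuous_on (cbox 0 1) (\<lambda>\<theta> :: real ^ 3. f (\<theta> $ 1) * g (\<theta> $ 2) * h (\<theta> $ 3))"
    by (intro continuous_intros continuous_on_compose2[OF assms(1)] continuous_on_compose2[OF assms(2)]
        continuous_on_compose2[OF assms(3)]) auto
  have int3: "set_integrable lborel (cbox 0 1) (\<lambda>\<theta> :: real ^ 3. f (\<theta> $ 1) * g (\<theta> $ 2) * h (\<theta> $ 3))"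
    unfolding set_integrable_def by (intro borel_integrable_compact compact_cbox c3)
  have "integral (cbox 0 1) (\<lambda>\<theta> :: real ^ 3. f (\<theta> $ 1) * g (\<theta> $ 2) * h (\<theta> $ 3)) =
      (\<integral>(\<theta> :: real ^ 3). indicator (cbox 0 1) \<theta> *\<^sub>R (f (\<theta> $ 1) * g (\<theta> $ 2) * h (\<theta> $ 3)) \<partial>lborel)"
    using set_borel_integral_eq_integral(2)[OF int3] by (simp add: set_lebesgue_integral_def)
  also have "\<dots> = (\<integral>\<theta>. (\<Prod>b\<in>Basis. F b (\<theta> \<bullet> b)) \<partial>lborel)"
  proof (intro Bochner_Integration.integral_cong refl)
    fix \<theta> :: "real ^ 3"
    show "indicator (cbox 0 1) \<theta> *\<^sub>R (f (\<theta> $ 1) * g (\<theta> $ 2) * h (\<theta> $ 3)) = (\<Prod>b\<in>Basis. F b (\<theta> \<bullet> b))"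
      using axis_3_distinct axis_3_distinct[symmetric]
      by (auto simp: Basis_real_3 F_def inner_axis mem_box_cart forall_3 indicator_def)
  qed
  also have "\<dots> = (\<Prod>b\<in>Basis. \<integral>x. F b x \<partial>lborel)"
  proof (rule integral_lborel_prod)
    fix b :: "real ^ 3"
    show "integrable lborel (F b)"
      using int unfolding F_def set_integrable_def
      by (cases "b = axis 1 1"; cases "b = axis 2 1") simp_all
  qed
  also have "\<dots> = integral {0..1} f * integral {0..1} g * integral {0..1} h"
    using axis_3_distinct axis_3_distinct[symmetric] by (simp add: Basis_real_3 F_def I int mult.assoc)
  finally show ?thesis .
qed

lemma integral_cis_int:
  "integral {0..1} (\<lambda>t. cis (2 * pi * (of_int k * t))) = (if k = 0 then 1 else 0)"
proof (cases "k = 0")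
  case False
  define c where "c = 2 * pi * of_int k"
  have c: "c \<noteq> 0" using False by (simp add: c_def)
  have "((\<lambda>t. cis (c * t)) has_integral (cis (c * 1) / (\<i> * c) - cis (c * 0) / (\<i> * c))) {0..1}"
  proof (rule fundamental_theorem_of_calculus)
    fix t :: real
    show "((\<lambda>t. cis (c * t) / (\<i> * c)) has_vector_derivative cis (c * t)) (at t within {0..1})"
    proof -
      have "((\<lambda>z. exp (\<i> * (c * z)) / (\<i> * c)) has_field_derivative exp (\<i> * (c * of_real t))) (at (of_real t))"
        using c by (auto intro!: derivative_eq_intros simp: mult_ac)
      from has_vector_derivative_real_field[OF this] show ?thesis
        by (simp add: cis_conv_exp)
    qed
  qed simp
  moreover have "cis c = 1"
    using cis_multiple_2pi[of "of_int k"] by (simp add: c_def)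
  ultimately have "((\<lambda>t. cis (c * t)) has_integral 0) {0..1}"
    by simp
  then show ?thesis
    using False by (simp add: integral_unique c_def mult_ac)
qed simp

definition torus_char :: "real \<Rightarrow> complex" where
  "torus_char t = cis (2 * pi * t)"

lemma norm_torus_char [simp]: "norm (torus_char t) = 1"
  by (simp add: torus_char_def)

lemma torus_char_nonzero [simp]: "torus_char t \<noteq> 0"
  by (simp add: torus_char_def)

lemma continuous_on_torus_char: "continuous_on A torus_char"
  unfolding torus_char_def by (intro continuous_intros)

lemma continuous_on_torus_char' [continuous_intros]:
  "continuous_on A f \<Longrightarrow> continuous_on A (\<lambda>x. torus_char (f x))"
  by (rule continuous_on_compose2[OF continuous_on_torus_char[of UNIV]]) auto

text \<open>Orthogonality of characters: integrating over the torus extracts constant terms.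
  Negative powers are written with \<open>inverse\<close> to keep exponents natural.\<close>

lemma integral_torus_char:
  "integral {0..1} (\<lambda>t. torus_char t ^ a * inverse (torus_char t) ^ b) = (if a = b then 1 else 0)"
proof -
  have "torus_char t ^ a * inverse (torus_char t) ^ b = cis (2 * pi * (of_int (int a - int b) * t))" for t
    unfolding torus_char_def cis_inverse Complex.DeMoivre cis_mult by (rule arg_cong[of _ _ cis]) (simp add: algebra_simps)
  then show ?thesis
    by (simp only: integral_cis_int) simp
qed

lemma integral_central_binomial:
  "integral {0..1} (\<lambda>t. (torus_char t + inverse (torus_char t)) ^ k) = (if even k then of_nat (k choose (k div 2)) else 0)"
proof -
  have "integral {0..1} (\<lambda>t. (torus_char t + inverse (torus_char t)) ^ k) =
     integral {0..1} (\<lambda>t. \<Sum>i\<le>k. of_nat (k choose i) * (torus_char t ^ i * inverse (torus_char t) ^ (k - i)))"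
    by (simp add: binomial_ring mult.assoc)
  also have "\<dots> = (\<Sum>i\<le>k. integral {0..1} (\<lambda>t. of_nat (k choose i) * (torus_char t ^ i * inverse (torus_char t) ^ (k - i))))"
    by (intro integral_sum integrable_continuous_interval continuous_intros) auto
  also have "\<dots> = (\<Sum>i\<le>k. if i = k - i then of_nat (k choose i) else 0)"
    unfolding integral_mult_right integral_torus_char by (intro sum.cong) auto
  also have "\<dots> = (\<Sum>i\<le>k. if even k \<and> i = k div 2 then of_nat (k choose i) else 0)"
  proof (intro sum.cong refl if_cong)
    fix i assume "i \<in> {..k}"
    then show "(i = k - i) = (even k \<and> i = k div 2)"
      unfolding atMost_iff by presburger
  qed
  also have "\<dots> = (if even k then of_nat (k choose (k div 2)) else 0)"
    by auto
  finally show ?thesis .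
qed

lemma integral_one_plus:
  assumes "k \<le> n"
  shows "integral {0..1} (\<lambda>t. (1 + torus_char t) ^ n * inverse (torus_char t) ^ k) = of_nat (n choose k)"
proof -
  have "integral {0..1} (\<lambda>t. (1 + torus_char t) ^ n * inverse (torus_char t) ^ k) =
     integral {0..1} (\<lambda>t. \<Sum>i\<le>n. of_nat (n choose i) * (torus_char t ^ i * inverse (torus_char t) ^ k))"
    by (simp add: binomial_ring[of "torus_char _" 1, unfolded add.commute[of _ 1]] mult.assoc sum_distrib_right)
  also have "\<dots> = (\<Sum>i\<le>n. integral {0..1} (\<lambda>t. of_nat (n choose i) * (torus_char t ^ i * inverse (torus_char t) ^ k)))"
    by (intro integral_sum integrable_continuous_interval continuous_intros) auto
  also have "\<dots> = (\<Sum>i\<le>n. if i = k then of_nat (n choose i) else 0)"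
    unfolding integral_mult_right integral_torus_char by (intro sum.cong) auto
  also have "\<dots> = of_nat (n choose k)"
    using assms by simp
  finally show ?thesis .
qed

text \<open>Expand log |1 - X / U|; the terms are bounded by (B / |U|)^n, so convergence is uniform
  and integration is termwise. The term n = 0 vanishes by division by zero. P is compared with U - X
  in modulus only, which permits monomial factors.\<close>

theorem mahler_sums:
  fixes X :: "real ^ 3 \<Rightarrow> complex" and P :: "complex ^ 3 \<Rightarrow> complex"
  assumes cont: "continuous_on UNIV X" and bound: "\<And>\<theta>. norm (X \<theta>) \<le> B"
    and U: "norm U > B" and B: "B > 0"
    and P: "\<And>\<theta>. norm (P (\<chi> i. torus_char (\<theta> $ i))) = norm (U - X \<theta>)"
  shows "(\<lambda>n. Re (integral (cbox 0 1) (\<lambda>\<theta>. X \<theta> ^ n) / of_nat n * inverse U ^ n)) sums (ln (norm U) - mahler P)"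
proof -
  define r where "r = B / norm U"
  have r: "0 \<le> r" "r < 1" using U B by (auto simp: r_def divide_less_eq)
  have U0: "U \<noteq> 0" using U B by auto
  define f where "f = (\<lambda>n \<theta>. Re (X \<theta> ^ n * (inverse U ^ n / of_nat n)))"
  have z: "norm (X \<theta> * inverse U) \<le> r" for \<theta>
    unfolding norm_mult norm_inverse r_def divide_inverse by (intro mult_right_mono bound) simp
  have pw: "X \<theta> ^ n * (inverse U ^ n / of_nat n) = (X \<theta> * inverse U) ^ n / of_nat n" for n \<theta>
    by (simp add: power_mult_distrib)
  have fn: "norm (f n \<theta>) \<le> r ^ n" for n \<theta>
  proof -
    have "norm (f n \<theta>) \<le> norm ((X \<theta> * inverse U) ^ n / of_nat n)"
      unfolding f_def pw real_norm_def by (rule abs_Re_le_cmod)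
    also have "\<dots> \<le> norm ((X \<theta> * inverse U) ^ n)"
      by (cases n) (auto simp: norm_divide divide_le_eq mult_le_cancel_left1 simp del: of_nat_Suc power_Suc)
    also have "\<dots> \<le> r ^ n"
      unfolding norm_power by (intro power_mono z) simp
    finally show ?thesis .
  qed
  have g: "(\<lambda>n. f n \<theta>) sums (ln (norm U) - ln (norm (U - X \<theta>)))" for \<theta>
  proof -
    have "norm (- (X \<theta> * inverse U)) < 1"
      using z[of \<theta>] r by simp
    from Ln_series'[OF this]
    have "(\<lambda>n. - ((X \<theta> * inverse U) ^ n / of_nat n)) sums ln (1 - X \<theta> * inverse U)"
      by simp
    from sums_minus[OF this]
    have "(\<lambda>n. (X \<theta> * inverse U) ^ n / of_nat n) sums (- ln (1 - X \<theta> * inverse U))"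
      by simp
    from sums_Re[OF this] have "(\<lambda>n. f n \<theta>) sums (- Re (ln (1 - X \<theta> * inverse U)))"
      unfolding f_def pw by simp
    also have "1 - X \<theta> * inverse U \<noteq> 0"
      using z[of \<theta>] r by auto
    then have "Re (ln (1 - X \<theta> * inverse U)) = ln (norm (1 - X \<theta> * inverse U))"
      by simp
    also have "1 - X \<theta> * inverse U = (U - X \<theta>) / U"
      using U0 by (simp add: field_simps)
    also have "ln (norm ((U - X \<theta>) / U)) = ln (norm (U - X \<theta>)) - ln (norm U)"
    proof -
      have "U - X \<theta> \<noteq> 0"
        using U bound[of \<theta>] by auto
      then show ?thesis
        using U0 by (simp add: norm_divide ln_div)
    qed
    finally show ?thesis by simp
  qed
  have "uniform_limit (cbox 0 1) (\<lambda>n \<theta>. \<Sum>i<n. f i \<theta>) (\<lambda>\<theta>. \<Sum>i. f i \<theta>) sequentially"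
    by (rule Weierstrass_m_test[of _ _ "\<lambda>n. r ^ n"]) (use fn r in \<open>auto simp: summable_geometric\<close>)
  moreover have "(\<lambda>\<theta>. \<Sum>i. f i \<theta>) = (\<lambda>\<theta>. ln (norm U) - ln (norm (U - X \<theta>)))"
    using g by (auto simp: sums_iff)
  ultimately have ul: "uniform_limit (cbox 0 1) (\<lambda>n \<theta>. \<Sum>i<n. f i \<theta>) (\<lambda>\<theta>. ln (norm U) - ln (norm (U - X \<theta>))) sequentially"
    by simp
  have cf: "continuous_on (cbox 0 1) (\<lambda>\<theta>. \<Sum>i<n. f i \<theta>)" for n
    unfolding f_def by (intro continuous_intros continuous_on_subset[OF cont]) auto
  obtain I J where I: "\<And>n. ((\<lambda>\<theta>. \<Sum>i<n. f i \<theta>) has_integral I n) (cbox 0 1)"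
    and J: "((\<lambda>\<theta>. ln (norm U) - ln (norm (U - X \<theta>))) has_integral J) (cbox 0 1)" and lim: "I \<longlonglongrightarrow> J"
    using uniform_limit_integral_cbox[OF ul cf] by (metis sequentially_bot)
  have fi: "(f i has_integral Re (integral (cbox 0 1) (\<lambda>\<theta>. X \<theta> ^ i) / of_nat i * inverse U ^ i)) (cbox 0 1)" for i
  proof -
    have "(\<lambda>\<theta>. X \<theta> ^ i) integrable_on cbox 0 1"
      by (intro integrable_continuous continuous_intros continuous_on_subset[OF cont]) auto
    then have "((\<lambda>\<theta>. X \<theta> ^ i) has_integral integral (cbox 0 1) (\<lambda>\<theta>. X \<theta> ^ i)) (cbox 0 1)"
      by (rule integrable_integral)
    from has_integral_linear[OF has_integral_mult_left[OF this] bounded_linear_Re, of "inverse U ^ i / of_nat i"]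
    show ?thesis
      by (simp add: f_def o_def)
  qed
  have "I = (\<lambda>n. \<Sum>i<n. Re (integral (cbox 0 1) (\<lambda>\<theta>. X \<theta> ^ i) / of_nat i * inverse U ^ i))"
    by (rule ext, rule has_integral_unique[OF I]) (intro has_integral_sum fi, simp)
  from lim[unfolded this] have sums: "(\<lambda>n. Re (integral (cbox 0 1) (\<lambda>\<theta>. X \<theta> ^ n) / of_nat n * inverse U ^ n)) sums J"
    unfolding sums_def .
  have c: "continuous_on (cbox 0 1) (\<lambda>\<theta>. ln (norm (U - X \<theta>)))"
  proof (intro continuous_intros continuous_on_subset[OF cont] ballI)
    fix \<theta>
    show "norm (U - X \<theta>) \<noteq> 0"
      using U bound[of \<theta>] by auto
  qed auto
  have "mahler P = (LINT \<theta>:cbox 0 1|lborel. ln (norm (U - X \<theta>)))"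
    unfolding mahler_def P[unfolded torus_char_def] ..
  also have "\<dots> = integral (cbox 0 1) (\<lambda>\<theta>. ln (norm (U - X \<theta>)))"
    by (intro set_borel_integral_eq_integral(2)) (unfold set_integrable_def, intro borel_integrable_compact compact_cbox c)
  finally have m: "mahler P = integral (cbox 0 1) (\<lambda>\<theta>. ln (norm (U - X \<theta>)))" .
  have "((\<lambda>\<theta> :: real ^ 3. ln (norm U)) has_integral ln (norm U)) (cbox 0 1)"
    using has_integral_const[of "ln (norm U)" "0 :: real ^ 3" 1]
    by (simp add: content_cbox_if_cart interval_eq_empty_cart)
  moreover have "((\<lambda>\<theta>. ln (norm (U - X \<theta>))) has_integral mahler P) (cbox 0 1)"
    unfolding m by (intro integrable_integral integrable_continuous c)
  ultimately have "((\<lambda>\<theta>. ln (norm U) - ln (norm (U - X \<theta>))) has_integral (ln (norm U) - mahler P)) (cbox 0 1)"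
    by (rule has_integral_diff)
  with J have "J = ln (norm U) - mahler P"
    by (rule has_integral_unique)
  with sums show ?thesis by simp
qed

section \<open>Mahler measures as power series\<close>

lemma choose_le_2_power: "n choose k \<le> 2 ^ n"
proof (cases "k \<le> n")
  case True
  have "n choose k \<le> (\<Sum>i\<le>n. n choose i)"
    using True by (intro member_le_sum) auto
  then show ?thesis by (simp add: choose_row_sum)
qed (simp add: binomial_eq_0)

text \<open>These sequences are the constant terms of the powers 2n, n and 4n of the three Laurent
  polynomials; the last is (4n)! / n!^4.\<close>

definition coeff2 :: "nat \<Rightarrow> complex" where
  "coeff2 n = of_nat ((2 * n choose n) ^ 3)"

definition coeff3 :: "nat \<Rightarrow> complex" where
  "coeff3 n = of_nat ((2 * n choose n) ^ 2 * (3 * n choose n))"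

definition coeff4 :: "nat \<Rightarrow> complex" where
  "coeff4 n = of_nat ((4 * n choose n) * (3 * n choose n) * (2 * n choose n))"

lemma coeff_0: "coeff2 0 = 1" "coeff3 0 = 1" "coeff4 0 = 1"
  by (simp_all add: coeff2_def coeff3_def coeff4_def)

lemma coeff2_bound: "norm (coeff2 n) \<le> 64 ^ n"
proof -
  have "(2 * n choose n) ^ 3 \<le> (2 ^ (2 * n)) ^ 3"
    by (intro power_mono choose_le_2_power) simp
  also have "\<dots> = (2 ^ 6) ^ n"
    by (simp only: power_mult[symmetric] mult_ac) simp
  finally have "real ((2 * n choose n) ^ 3) \<le> real ((2 ^ 6) ^ n)"
    by (simp only: of_nat_le_iff)
  then show ?thesis
    by (simp add: coeff2_def norm_power)
qed

text \<open>A crude bound, above the true growth rate 108. It is sufficient because |s(q)| exceeds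
  every bound as q tends to 0.\<close>

lemma coeff3_bound: "norm (coeff3 n) \<le> 128 ^ n"
proof -
  have "(2 * n choose n) ^ 2 * (3 * n choose n) \<le> (2 ^ (2 * n)) ^ 2 * 2 ^ (3 * n)"
    by (intro mult_mono power_mono choose_le_2_power) simp_all
  also have "\<dots> = (2 ^ 7) ^ n"
    by (simp only: power_mult[symmetric] power_add[symmetric] mult_ac) (simp add: algebra_simps)
  finally have "real ((2 * n choose n) ^ 2 * (3 * n choose n)) \<le> real ((2 ^ 7) ^ n)"
    by (simp only: of_nat_le_iff)
  then show ?thesis
    by (simp add: coeff3_def norm_power norm_mult)
qed

lemma coeff4_bound: "norm (coeff4 n) \<le> 512 ^ n"
proof -
  have "(4 * n choose n) * (3 * n choose n) * (2 * n choose n) \<le> 2 ^ (4 * n) * 2 ^ (3 * n) * 2 ^ (2 * n)"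
    by (intro mult_mono power_mono choose_le_2_power) simp_all
  also have "\<dots> = (2 ^ 9) ^ n"
    by (simp only: power_mult[symmetric] power_add[symmetric] mult_ac) (simp add: algebra_simps)
  finally have "real ((4 * n choose n) * (3 * n choose n) * (2 * n choose n)) \<le> real ((2 ^ 9) ^ n)"
    by (simp only: of_nat_le_iff)
  then show ?thesis
    by (simp add: coeff4_def norm_power norm_mult)
qed

lemma coeff_fact:
  "coeff2 n = fact (2 * n) ^ 3 / fact n ^ 6"
  "coeff3 n = fact (2 * n) * fact (3 * n) / fact n ^ 5"
  "coeff4 n = fact (4 * n) / fact n ^ 4"
proof -
  have c2: "of_nat (2 * n choose n) = (fact (2 * n) / (fact n * fact n) :: complex)"
    by (subst binomial_fact) simp_all
  have c3: "of_nat (3 * n choose n) = (fact (3 * n) / (fact n * fact (2 * n)) :: complex)"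
    by (subst binomial_fact) simp_all
  have c4: "of_nat (4 * n choose n) = (fact (4 * n) / (fact n * fact (3 * n)) :: complex)"
    by (subst binomial_fact) simp_all
  show "coeff2 n = fact (2 * n) ^ 3 / fact n ^ 6"
    "coeff3 n = fact (2 * n) * fact (3 * n) / fact n ^ 5"
    "coeff4 n = fact (4 * n) / fact n ^ 4"
    unfolding coeff2_def coeff3_def coeff4_def of_nat_mult of_nat_power c2 c3 c4
    by (simp_all add: field_simps power_numeral_reduce)
qed

lemma fact_mult_Suc:
  "fact (2 * Suc n) = ((2 * of_nat n + 2) * (2 * of_nat n + 1) * fact (2 * n) :: complex)"
  "fact (3 * Suc n) = ((3 * of_nat n + 3) * (3 * of_nat n + 2) * (3 * of_nat n + 1) * fact (3 * n) :: complex)"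
  "fact (4 * Suc n) = ((4 * of_nat n + 4) * (4 * of_nat n + 3) * (4 * of_nat n + 2) * (4 * of_nat n + 1) * fact (4 * n) :: complex)"
proof -
  have "2 * Suc n = Suc (Suc (2 * n))" "3 * Suc n = Suc (Suc (Suc (3 * n)))" "4 * Suc n = Suc (Suc (Suc (Suc (4 * n))))"
    by simp_all
  then show "fact (2 * Suc n) = ((2 * of_nat n + 2) * (2 * of_nat n + 1) * fact (2 * n) :: complex)"
    "fact (3 * Suc n) = ((3 * of_nat n + 3) * (3 * of_nat n + 2) * (3 * of_nat n + 1) * fact (3 * n) :: complex)"
    "fact (4 * Suc n) = ((4 * of_nat n + 4) * (4 * of_nat n + 3) * (4 * of_nat n + 2) * (4 * of_nat n + 1) * fact (4 * n) :: complex)"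
    by (simp_all only: fact_Suc of_nat_mult of_nat_Suc of_nat_numeral) (simp_all add: algebra_simps)
qed

text \<open>The quadratic factor is (n + r) (n + 1 - r) with r = 1/2, 1/3, 1/4, which makes the
  constants r (1 - r) = 1/4, 2/9, 3/16.\<close>

lemma coeff_rec:
  "of_nat (Suc n) ^ 3 * coeff2 (Suc n) = 64 * (of_nat n + 1/2) * (of_nat n ^ 2 + of_nat n + 1/4) * coeff2 n"
  "of_nat (Suc n) ^ 3 * coeff3 (Suc n) = 108 * (of_nat n + 1/2) * (of_nat n ^ 2 + of_nat n + 2/9) * coeff3 n"
  "of_nat (Suc n) ^ 3 * coeff4 (Suc n) = 256 * (of_nat n + 1/2) * (of_nat n ^ 2 + of_nat n + 3/16) * coeff4 n"
proof -
  define N F :: complex where "N = of_nat n" and "F = fact n"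
  have nz: "N + 1 \<noteq> 0" "F \<noteq> 0"
    using of_nat_neq_0[of n, where ?'a = complex] by (simp_all add: N_def F_def add.commute)
  have S: "of_nat (Suc n) = N + 1" "fact (Suc n) = (N + 1) * F"
    by (simp_all add: N_def F_def add.commute)
  show "of_nat (Suc n) ^ 3 * coeff2 (Suc n) = 64 * (of_nat n + 1/2) * (of_nat n ^ 2 + of_nat n + 1/4) * coeff2 n"
    unfolding coeff_fact fact_mult_Suc S N_def[symmetric] F_def[symmetric] using nz
    by (simp add: divide_simps) algebra
  show "of_nat (Suc n) ^ 3 * coeff3 (Suc n) = 108 * (of_nat n + 1/2) * (of_nat n ^ 2 + of_nat n + 2/9) * coeff3 n"
    unfolding coeff_fact fact_mult_Suc S N_def[symmetric] F_def[symmetric] using nz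
    by (simp add: divide_simps) algebra
  show "of_nat (Suc n) ^ 3 * coeff4 (Suc n) = 256 * (of_nat n + 1/2) * (of_nat n ^ 2 + of_nat n + 3/16) * coeff4 n"
    unfolding coeff_fact fact_mult_Suc S N_def[symmetric] F_def[symmetric] using nz
    by (simp add: divide_simps) algebra
qed

text \<open>Only powers of X divisible by p have a constant term. The resulting series involves U
  through \<open>U ^ p\<close> and |U| alone, so the value does not depend on which p-th root U
  is.\<close>

lemma mahler_eval:
  fixes X :: "real ^ 3 \<Rightarrow> complex" and P :: "complex ^ 3 \<Rightarrow> complex" and a :: "nat \<Rightarrow> complex"
  assumes cont: "continuous_on UNIV X" and bound: "\<And>\<theta>. norm (X \<theta>) \<le> B"
    and U: "norm U > B" and B: "B > 0"
    and P: "\<And>\<theta>. norm (P (\<chi> i. torus_char (\<theta> $ i))) = norm (U - X \<theta>)"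
    and p: "p > 0" and int: "\<And>n. integral (cbox 0 1) (\<lambda>\<theta>. X \<theta> ^ n) = (if p dvd n then a (n div p) else 0)"
    and a: "\<And>n. norm (a n) \<le> A ^ n" "A > 0" and UA: "norm U ^ p > A"
  shows "real p * mahler P = ln (norm U ^ p) - Re (eval_fps (Abs_fps (\<lambda>n. a n / of_nat n)) (inverse (U ^ p)))"
proof -
  have U0: "U \<noteq> 0" using U B by auto
  have "norm (inverse (U ^ p)) < 1 / A"
    using less_imp_inverse_less[OF UA a(2)] by (simp add: norm_inverse norm_power inverse_eq_divide norm_divide)
  from sums_Re[OF log_series_expansion(2)[OF a this]]
  have 1: "(\<lambda>n. Re (a n / of_nat n * inverse (U ^ p) ^ n)) sums Re (eval_fps (Abs_fps (\<lambda>n. a n / of_nat n)) (inverse (U ^ p)))" .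
  have "strict_mono (\<lambda>n. p * n)"
    using p by (intro strict_monoI) simp
  \<comment> \<open>The vanishing terms are dropped by reindexing along the multiples of p.\<close>
  from sums_mono_reindex[OF this, THEN iffD2, OF _ mahler_sums[OF cont bound U B P]]
  have "(\<lambda>n. Re (integral (cbox 0 1) (\<lambda>\<theta>. X \<theta> ^ (p * n)) / of_nat (p * n) * inverse U ^ (p * n))) sums (ln (norm U) - mahler P)"
    by (auto simp: int image_def dvd_def)
  from sums_mult[OF this, of "real p"]
  have "(\<lambda>n. real p * Re (integral (cbox 0 1) (\<lambda>\<theta>. X \<theta> ^ (p * n)) / of_nat (p * n) * inverse U ^ (p * n))) sums (real p * (ln (norm U) - mahler P))" .
  also have "(\<lambda>n. real p * Re (integral (cbox 0 1) (\<lambda>\<theta>. X \<theta> ^ (p * n)) / of_nat (p * n) * inverse U ^ (p * n))) =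
     (\<lambda>n. Re (a n / of_nat n * inverse (U ^ p) ^ n))"
  proof
    fix n
    have "real p * Re (integral (cbox 0 1) (\<lambda>\<theta>. X \<theta> ^ (p * n)) / of_nat (p * n) * inverse U ^ (p * n)) =
       Re (of_nat p * (a n / of_nat (p * n) * inverse U ^ (p * n)))"
      using p by (simp add: int)
    also have "of_nat p * (a n / of_nat (p * n) * inverse U ^ (p * n)) = a n / of_nat n * inverse (U ^ p) ^ n"
      using p by (simp add: power_mult power_inverse)
    finally show "real p * Re (integral (cbox 0 1) (\<lambda>\<theta>. X \<theta> ^ (p * n)) / of_nat (p * n) * inverse U ^ (p * n)) =
       Re (a n / of_nat n * inverse (U ^ p) ^ n)" .
  qed
  finally have "real p * (ln (norm U) - mahler P) = Re (eval_fps (Abs_fps (\<lambda>n. a n / of_nat n)) (inverse (U ^ p)))"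
    using 1 by (rule sums_unique2)
  then show ?thesis
    using U0 by (simp add: ln_realpow algebra_simps)
qed

lemma norm_torus_char_plus_inverse: "norm (torus_char t + inverse (torus_char t)) \<le> 2"
  using norm_triangle_ineq[of "torus_char t" "inverse (torus_char t)"] by (simp add: norm_inverse)

theorem f2_eq:
  assumes rt: "rt u ^ 2 = u" and u: "norm u > 64"
  shows "f2 rt u = ln (norm u) - Re (eval_fps (Abs_fps (\<lambda>n. coeff2 n / of_nat n)) (inverse u))"
proof -
  define c where "c = (\<lambda>t. torus_char t + inverse (torus_char t))"
  \<comment> \<open>The sign fits the shape U - X; it disappears in the moments because odd powers
    integrate to 0.\<close>
  define X where "X = (\<lambda>\<theta> :: real ^ 3. - (c (\<theta> $ 1) * c (\<theta> $ 2) * c (\<theta> $ 3)))"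
  have cc: "continuous_on UNIV c"
    unfolding c_def by (intro continuous_intros) auto
  have cc': "continuous_on A (\<lambda>x. c (f x))" if "continuous_on A f" for A :: "(real ^ 3) set" and f
    by (rule continuous_on_compose2[OF cc that]) auto
  define P :: "complex ^ 3 \<Rightarrow> complex" where "P = (\<lambda>v. let x = v $ 1; y = v $ 2; z = v $ 3 in
     rt u + (x + inverse x) * (y + inverse y) * (z + inverse z))"
  have nu: "norm (rt u) ^ 2 = norm u"
    using rt by (metis norm_power)
  have "real 2 * mahler P = ln (norm (rt u) ^ 2) - Re (eval_fps (Abs_fps (\<lambda>n. coeff2 n / of_nat n)) (inverse (rt u ^ 2)))"
  proof (rule mahler_eval[where X = X and B = 8 and A = 64])
    show "continuous_on UNIV X"
      unfolding X_def by (intro continuous_intros cc')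
    show "norm (X \<theta>) \<le> 8" for \<theta>
    proof -
      have "norm (X \<theta>) \<le> 2 * 2 * 2"
        unfolding X_def norm_minus_cancel norm_mult c_def
        by (intro mult_mono norm_torus_char_plus_inverse) auto
      then show ?thesis by simp
    qed
    show "norm (rt u) > 8"
      by (rule power_less_imp_less_base[of _ 2]) (use nu u in auto)
    show "norm (P (\<chi> i. torus_char (\<theta> $ i))) = norm (rt u - X \<theta>)" for \<theta>
      by (simp add: P_def X_def c_def Let_def)
    show "integral (cbox 0 1) (\<lambda>\<theta>. X \<theta> ^ n) = (if 2 dvd n then coeff2 (n div 2) else 0)" for n
    proof -
      have "integral (cbox 0 1) (\<lambda>\<theta>. X \<theta> ^ n) =
          integral (cbox 0 1) (\<lambda>\<theta> :: real ^ 3. (-1) ^ n * (c (\<theta> $ 1) ^ n * c (\<theta> $ 2) ^ n * c (\<theta> $ 3) ^ n))"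
        unfolding X_def by (subst power_minus) (simp add: power_mult_distrib)
      also have "\<dots> = (-1) ^ n * integral {0..1} (\<lambda>t. c t ^ n) ^ 3"
        by (subst integral_mult_right, subst integral_unit_cube_product)
          (auto intro!: continuous_intros cc simp: power3_eq_cube)
      also have "\<dots> = (if 2 dvd n then coeff2 (n div 2) else 0)"
        unfolding c_def integral_central_binomial by (auto simp: coeff2_def power_0_left)
      finally show ?thesis .
    qed
    show "norm (coeff2 n) \<le> 64 ^ n" for n
      by (rule coeff2_bound)
    show "64 < norm (rt u) ^ 2"
      using nu u by simp
  qed auto
  then show ?thesis
    unfolding nu rt by (simp add: f2_def P_def)
qed

theorem f3_eq:
  assumes u: "norm u > 128"
  shows "f3 u = ln (norm u) - Re (eval_fps (Abs_fps (\<lambda>n. coeff3 n / of_nat n)) (inverse u))"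
proof -
  define c where "c = (\<lambda>t. torus_char t + inverse (torus_char t))"
  define d where "d = (\<lambda>t. (1 + torus_char t) ^ 3 * inverse (torus_char t) ^ 2)"
  define X where "X = (\<lambda>\<theta> :: real ^ 3. c (\<theta> $ 1) ^ 2 * c (\<theta> $ 2) ^ 2 * d (\<theta> $ 3))"
  have cc: "continuous_on UNIV c" "continuous_on UNIV d"
    unfolding c_def d_def by (auto intro!: continuous_intros)
  have cc': "continuous_on A (\<lambda>x. c (f x))" "continuous_on A (\<lambda>x. d (f x))"
    if "continuous_on A f" for A :: "(real ^ 3) set" and f
    by (rule continuous_on_compose2[OF cc(1) that] continuous_on_compose2[OF cc(2) that]; simp)+
  define P :: "complex ^ 3 \<Rightarrow> complex" where "P = (\<lambda>v. let x = v $ 1; y = v $ 2; z = v $ 3 in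
     u - (x + inverse x)^2 * (y + inverse y)^2 * (1 + z)^3 * inverse z ^ 2)"
  have "real 1 * mahler P = ln (norm u ^ 1) - Re (eval_fps (Abs_fps (\<lambda>n. coeff3 n / of_nat n)) (inverse (u ^ 1)))"
  proof (rule mahler_eval[where X = X and B = 128 and A = 128])
    show "continuous_on UNIV X"
      unfolding X_def by (intro continuous_intros cc')
    show "norm (X \<theta>) \<le> 128" for \<theta>
    proof -
      have d: "norm (d t) \<le> 2 ^ 3 * 1" for t
        unfolding d_def norm_mult norm_power norm_inverse norm_torus_char
        using norm_triangle_ineq[of 1 "torus_char t"] by (intro mult_mono power_mono) auto
      have "norm (X \<theta>) \<le> 2 ^ 2 * 2 ^ 2 * (2 ^ 3 * 1)"
        unfolding X_def norm_mult norm_power c_def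
        by (intro mult_mono power_mono norm_torus_char_plus_inverse d) auto
      then show ?thesis by simp
    qed
    show "norm u > 128" by (rule u)
    show "norm (P (\<chi> i. torus_char (\<theta> $ i))) = norm (u - X \<theta>)" for \<theta>
      by (simp add: P_def X_def c_def d_def Let_def mult.assoc)
    show "integral (cbox 0 1) (\<lambda>\<theta>. X \<theta> ^ n) = (if 1 dvd n then coeff3 (n div 1) else 0)" for n
    proof -
      have "integral (cbox 0 1) (\<lambda>\<theta>. X \<theta> ^ n) =
          integral (cbox 0 1) (\<lambda>\<theta> :: real ^ 3. c (\<theta> $ 1) ^ (2 * n) * c (\<theta> $ 2) ^ (2 * n) * d (\<theta> $ 3) ^ n)"
        unfolding X_def by (simp add: power_mult_distrib power_mult)
      also have "\<dots> = integral {0..1} (\<lambda>t. c t ^ (2 * n)) ^ 2 * integral {0..1} (\<lambda>t. d t ^ n)"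
        by (subst integral_unit_cube_product) (auto intro!: continuous_intros cc simp: power2_eq_square)
      also have "integral {0..1} (\<lambda>t. d t ^ n) =
          integral {0..1} (\<lambda>t. (1 + torus_char t) ^ (3 * n) * inverse (torus_char t) ^ (2 * n))"
        unfolding d_def by (simp add: power_mult_distrib power_mult)
      also have "\<dots> = of_nat (3 * n choose (2 * n))"
        by (rule integral_one_plus) simp
      also have "3 * n choose (2 * n) = 3 * n choose n"
        by (subst binomial_symmetric) simp_all
      finally show ?thesis
        unfolding c_def integral_central_binomial by (simp add: coeff3_def)
    qed
    show "norm (coeff3 n) \<le> 128 ^ n" for n
      by (rule coeff3_bound)
    show "128 < norm u ^ 1"
      using u by simp
  qed auto
  then show ?thesis
    by (simp add: f3_def P_def)
qed

lemma integral_unit_cube_monomial: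
  "integral (cbox 0 1) (\<lambda>\<theta> :: real ^ 3. torus_char (\<theta> $ 1) ^ a * inverse (torus_char (\<theta> $ 1)) ^ k *
      (torus_char (\<theta> $ 2) ^ b * inverse (torus_char (\<theta> $ 2)) ^ k) *
      (torus_char (\<theta> $ 3) ^ c * inverse (torus_char (\<theta> $ 3)) ^ k)) = (if a = k \<and> b = k \<and> c = k then 1 else 0)"
  by (subst integral_unit_cube_product) (auto intro!: continuous_intros simp: integral_torus_char)

lemma power_sum4:
  fixes x y z :: complex
  shows "(x + (y + (z + 1))) ^ k = (\<Sum>i\<le>k. \<Sum>j\<le>k - i. \<Sum>l\<le>k - i - j.
     of_nat ((k choose i) * (k - i choose j) * (k - i - j choose l)) * (x ^ i * y ^ j * z ^ l))"
  unfolding binomial_ring[of x] binomial_ring[of y] binomial_ring[of z]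
  by (simp add: sum_distrib_left mult_ac)

theorem f4_eq:
  assumes rt: "rt u ^ 4 = u" and u: "norm u > 512"
  shows "f4 rt u = ln (norm u) - Re (eval_fps (Abs_fps (\<lambda>n. coeff4 n / of_nat n)) (inverse u))"
proof -
  define X where "X = (\<lambda>\<theta> :: real ^ 3.
    - ((torus_char (\<theta> $ 1) ^ 4 + (torus_char (\<theta> $ 2) ^ 4 + (torus_char (\<theta> $ 3) ^ 4 + 1))) *
       (inverse (torus_char (\<theta> $ 1)) * inverse (torus_char (\<theta> $ 2)) * inverse (torus_char (\<theta> $ 3)))))"
  define P :: "complex ^ 3 \<Rightarrow> complex" where "P = (\<lambda>v. let x = v $ 1; y = v $ 2; z = v $ 3 in
     x^4 + y^4 + z^4 + 1 + rt u * x * y * z)"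
  have nu: "norm (rt u) ^ 4 = norm u"
    using rt by (metis norm_power)
  have "real 4 * mahler P = ln (norm (rt u) ^ 4) - Re (eval_fps (Abs_fps (\<lambda>n. coeff4 n / of_nat n)) (inverse (rt u ^ 4)))"
  proof (rule mahler_eval[where X = X and B = 4 and A = 512])
    show "continuous_on UNIV X"
      unfolding X_def by (auto intro!: continuous_intros)
    show "norm (X \<theta>) \<le> 4" for \<theta>
    proof -
      have "norm (X \<theta>) = norm (torus_char (\<theta> $ 1) ^ 4 + (torus_char (\<theta> $ 2) ^ 4 + (torus_char (\<theta> $ 3) ^ 4 + 1)))"
        unfolding X_def by (simp add: norm_mult norm_inverse)
      also have "\<dots> \<le> 1 + (1 + (1 + 1))"
        by (intro norm_triangle_le add_mono order_trans[OF norm_triangle_ineq]) (auto simp: norm_power)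
      finally show ?thesis by simp
    qed
    show "norm (rt u) > 4"
      by (rule power_less_imp_less_base[of _ 4]) (use nu u in auto)
    show "norm (P (\<chi> i. torus_char (\<theta> $ i))) = norm (rt u - X \<theta>)" for \<theta>
    proof -
      \<comment> \<open>The polynomial is divided by x y z, which has modulus 1 on the
        torus.\<close>
      have "P (\<chi> i. torus_char (\<theta> $ i)) = (rt u - X \<theta>) * (torus_char (\<theta> $ 1) * torus_char (\<theta> $ 2) * torus_char (\<theta> $ 3))"
        by (simp add: P_def X_def Let_def field_simps)
      then show ?thesis by (simp add: norm_mult)
    qed
    show "integral (cbox 0 1) (\<lambda>\<theta>. X \<theta> ^ k) = (if 4 dvd k then coeff4 (k div 4) else 0)" for k
    proof -
      define e where "e = (\<lambda>i j l. \<lambda>\<theta> :: real ^ 3. torus_char (\<theta> $ 1) ^ (4 * i) * inverse (torus_char (\<theta> $ 1)) ^ k *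
        (torus_char (\<theta> $ 2) ^ (4 * j) * inverse (torus_char (\<theta> $ 2)) ^ k) *
        (torus_char (\<theta> $ 3) ^ (4 * l) * inverse (torus_char (\<theta> $ 3)) ^ k))"
      define m where "m = (\<lambda>i j l. of_nat ((k choose i) * (k - i choose j) * (k - i - j choose l)) :: complex)"
      have ce: "continuous_on (cbox 0 1) (e i j l)" for i j l
        unfolding e_def by (auto intro!: continuous_intros)
      have X: "X \<theta> ^ k = (-1) ^ k * (\<Sum>i\<le>k. \<Sum>j\<le>k - i. \<Sum>l\<le>k - i - j. m i j l * e i j l \<theta>)" for \<theta>
      proof -
        have "X \<theta> ^ k = (-1) ^ k * ((torus_char (\<theta> $ 1) ^ 4 + (torus_char (\<theta> $ 2) ^ 4 + (torus_char (\<theta> $ 3) ^ 4 + 1))) ^ k *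
          (inverse (torus_char (\<theta> $ 1)) * inverse (torus_char (\<theta> $ 2)) * inverse (torus_char (\<theta> $ 3))) ^ k)"
          unfolding X_def by (subst power_minus) (simp only: power_mult_distrib)
        also have "\<dots> = (-1) ^ k * (\<Sum>i\<le>k. \<Sum>j\<le>k - i. \<Sum>l\<le>k - i - j. m i j l * e i j l \<theta>)"
          unfolding power_sum4 sum_distrib_right m_def e_def
          by (intro arg_cong[of _ _ "\<lambda>x. (-1) ^ k * x"] sum.cong refl) (simp add: power_mult_distrib mult_ac flip: power_mult)
        finally show ?thesis .
      qed
      have "((\<lambda>\<theta>. \<Sum>i\<le>k. \<Sum>j\<le>k - i. \<Sum>l\<le>k - i - j. m i j l * e i j l \<theta>) has_integral
         (\<Sum>i\<le>k. \<Sum>j\<le>k - i. \<Sum>l\<le>k - i - j. m i j l * integral (cbox 0 1) (e i j l))) (cbox 0 1)"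
        by (intro has_integral_sum has_integral_mult_right integrable_integral integrable_continuous ce) auto
      then have "integral (cbox 0 1) (\<lambda>\<theta>. X \<theta> ^ k) =
         (-1) ^ k * (\<Sum>i\<le>k. \<Sum>j\<le>k - i. \<Sum>l\<le>k - i - j. m i j l * integral (cbox 0 1) (e i j l))"
        unfolding X integral_mult_right by (simp add: integral_unique)
      \<comment> \<open>The exponent of each variable is 4 i - k, 4 j - k or 4 l - k, so one
        multinomial coefficient survives, for i = j = l = k / 4.\<close>
      also have "\<dots> = (-1) ^ k * (\<Sum>i\<le>k. \<Sum>j\<le>k - i. \<Sum>l\<le>k - i - j. if 4 * i = k \<and> 4 * j = k \<and> 4 * l = k then m i j l else 0)"
        unfolding e_def integral_unit_cube_monomial
        by (intro arg_cong[of _ _ "\<lambda>x. (-1) ^ k * x"] sum.cong refl) auto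
      also have "\<dots> = (if 4 dvd k then coeff4 (k div 4) else 0)"
      proof (cases "4 dvd k")
        case True
        then obtain n where k: "k = 4 * n" by auto
        have l: "(\<Sum>l\<le>k - i - j. if 4 * i = k \<and> 4 * j = k \<and> 4 * l = k then m i j l else 0) =
            (if i = n \<and> j = n then m n n n else 0)" for i j
          by (cases "i = n \<and> j = n") (auto simp: k)
        have j: "(\<Sum>j\<le>k - i. if i = n \<and> j = n then m n n n else 0) = (if i = n then m n n n else 0)" for i
          by (cases "i = n") (auto simp: k)
        have "(\<Sum>i\<le>k. \<Sum>j\<le>k - i. \<Sum>l\<le>k - i - j. if 4 * i = k \<and> 4 * j = k \<and> 4 * l = k then m i j l else 0) = m n n n"
          unfolding l j by (simp add: k)
        also have "\<dots> = coeff4 n"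
          by (simp add: m_def coeff4_def k)
        finally show ?thesis
          by (simp add: k)
      next
        case False
        then show ?thesis by (auto intro!: sum.neutral)
      qed
      finally show ?thesis .
    qed
    show "norm (coeff4 n) \<le> 512 ^ n" for n
      by (rule coeff4_bound)
    show "512 < norm (rt u) ^ 4"
      using nu u by simp
  qed auto
  then show ?thesis
    unfolding nu rt by (simp add: f4_def P_def)
qed

section \<open>Hecke relations and the final identities\<close>

text \<open>Level 4 yields \<open>G (q ^ 4)\<close>; the Hecke relation for the prime 2 later
  exchanges it for \<open>G (- q)\<close> and \<open>G (q ^ 2)\<close>.\<close>

theorem f2_s2:
  fixes sqr :: "complex \<Rightarrow> complex"
  assumes "\<And>u. sqr u ^ 2 = u"
  shows "\<forall>\<^sub>F q in at 0. f2 sqr (s2 q) = (4 * G (q ^ 4) - G q) / 15"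
proof -
  have t: "t4 = fps_X * fexp (fps_const (240 / (of_nat 4 ^ 2 - 1)) * (of_nat 4 * dil 4 (lsig 3) - lsig 3) -
      fps_compose (Abs_fps (\<lambda>n. coeff2 n / of_nat n)) t4)"
    by (rule uniformizer_exp[where c = 64 and \<alpha> = "1/4", OF ab4_nth(3) level4_nth(1) _ _ level4(1-3)])
       (use level4(4) level4_nth coeff_0 coeff_rec(1) in \<open>simp_all add: t4_def\<close>)
  have s: "\<forall>\<^sub>F q in at 0. inverse (s2 q) =
      q * inverse ((euler_phi (q ^ 2) ^ 2 * inverse (euler_phi q * euler_phi (q ^ 4))) ^ 24)"
    using eventually_norm_less[of 1] by (auto simp: eventually_at_filter inverse_s2 elim!: eventually_mono)
  note l = log_uniformizer[OF s2_expansion s t log_series_expansion(1)[OF coeff2_bound], simplified]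
  from l(1) l(2)[of 64] show ?thesis
    by eventually_elim (simp add: f2_eq assms)
qed

theorem f3_s3: "\<forall>\<^sub>F q in at 0. f3 (s3 q) = (3 * G (q ^ 3) - G q) / 8"
proof -
  have t: "t3 = fps_X * fexp (fps_const (240 / (of_nat 3 ^ 2 - 1)) * (of_nat 3 * dil 3 (lsig 3) - lsig 3) -
      fps_compose (Abs_fps (\<lambda>n. coeff3 n / of_nat n)) t3)"
    by (rule uniformizer_exp[where c = 108 and \<alpha> = "2/9", OF Zw3_nth _ _ level3(1-3)])
       (use level3(4) w3_nth_1 coeff_0 coeff_rec(2) in \<open>simp_all add: t3_def\<close>)
  have s: "\<forall>\<^sub>F q in at 0. inverse (s3 q) =
      q * inverse ((27 * q * (euler_phi (q ^ 3) ^ 6 * inverse (euler_phi q ^ 6)) + euler_phi q ^ 6 * inverse (euler_phi (q ^ 3) ^ 6)) ^ 2)"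
    by (intro always_eventually allI inverse_s3)
  note l = log_uniformizer[OF s3_expansion s t log_series_expansion(1)[OF coeff3_bound], simplified]
  from l(1) l(2)[of 128] show ?thesis
    by eventually_elim (simp add: f3_eq)
qed

theorem f4_s4:
  fixes fthr :: "complex \<Rightarrow> complex"
  assumes "\<And>u. fthr u ^ 4 = u"
  shows "\<forall>\<^sub>F q in at 0. f4 fthr (s4 q) = (2 * G (q ^ 2) - G q) / 3"
proof -
  have t: "t2 = fps_X * fexp (fps_const (240 / (of_nat 2 ^ 2 - 1)) * (of_nat 2 * dil 2 (lsig 3) - lsig 3) -
      fps_compose (Abs_fps (\<lambda>n. coeff4 n / of_nat n)) t2)"
    by (rule uniformizer_exp[where c = 256 and \<alpha> = "3/16", OF Z2_nth level2_nth(1) _ _ level2(1-3)])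
       (use level2(4) level2_nth coeff_0 coeff_rec(3) in \<open>simp_all add: t2_def\<close>)
  have s: "\<forall>\<^sub>F q in at 0. inverse (s4 q) =
    q * inverse (euler_phi (q ^ 2) ^ 24 * inverse (euler_phi q ^ 24) *
     (16 * q * (euler_phi q ^ 4 * euler_phi (q ^ 4) ^ 8 * inverse (euler_phi (q ^ 2) ^ 12)) +
      euler_phi (q ^ 2) ^ 12 * inverse (euler_phi q ^ 4 * euler_phi (q ^ 4) ^ 8)) ^ 4)"
    by (intro always_eventually allI inverse_s4)
  note l = log_uniformizer[OF s4_expansion s t log_series_expansion(1)[OF coeff4_bound], simplified]
  from l(1) l(2)[of 512] show ?thesis
    by eventually_elim (simp add: f4_eq assms)
qed

text \<open>The divisors of p n are those of n together with p times those of n; the overlap is p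
  times the divisors of n / p.\<close>

lemma dsig_prime_mult:
  assumes p: "prime p" and n: "n > 0"
  shows "dsig k (p * n) = (1 + of_nat p ^ k) * dsig k n - of_nat p ^ k * (if p dvd n then dsig k (n div p) else 0)"
proof -
  have p0: "p > 0" using p by (rule prime_gt_0_nat)
  let ?D = "\<lambda>n. {d. d dvd n}"
  have fin: "finite (?D n)" using n by simp
  have inj: "inj_on ((*) p) A" for A
    using p0 by (auto simp: inj_on_def)
  have im: "(\<Sum>d\<in>(*) p ` A. of_nat d ^ k) = of_nat p ^ k * (\<Sum>d\<in>A. of_nat d ^ k :: complex)" for A
    by (subst sum.reindex[OF inj]) (simp add: power_mult_distrib sum_distrib_left)
  have un: "?D (p * n) = ?D n \<union> (*) p ` ?D n"
  proof (intro equalityI subsetI)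
    fix d assume "d \<in> ?D (p * n)"
    then have d: "d dvd p * n" by simp
    show "d \<in> ?D n \<union> (*) p ` ?D n"
    proof (cases "p dvd d")
      case True
      then obtain e where "d = p * e" by auto
      then show ?thesis using d p0 by auto
    next
      case False
      then have "coprime d p"
        using p by (metis coprime_commute prime_imp_coprime)
      then show ?thesis using d by (simp add: coprime_dvd_mult_right_iff)
    qed
  qed auto
  have int: "?D n \<inter> (*) p ` ?D n = (if p dvd n then (*) p ` ?D (n div p) else {})"
    using p0 by (auto simp: dvd_def image_def)
  have "dsig k (p * n) = (\<Sum>d\<in>?D n. of_nat d ^ k) + (\<Sum>d\<in>(*) p ` ?D n. of_nat d ^ k)
      - (\<Sum>d\<in>?D n \<inter> (*) p ` ?D n. of_nat d ^ k)"
    unfolding dsig_def un using fin by (subst sum.union_inter[symmetric]) auto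
  also have "\<dots> = (1 + of_nat p ^ k) * dsig k n - of_nat p ^ k * (if p dvd n then dsig k (n div p) else 0)"
    by (cases "p dvd n") (simp_all add: int im dsig_def, simp_all add: algebra_simps)
  finally show ?thesis .
qed

text \<open>Dividing by the index in \<open>lsig\<close> lowers the factor p^3 of the last term to
  p^2.\<close>

lemma lsig_hecke:
  assumes p: "prime p"
  shows "of_nat p * fps_nth (lsig 3) (p * m) =
     of_nat (1 + p ^ 3) * fps_nth (lsig 3) m - of_nat (p ^ 2) * (if p dvd m then fps_nth (lsig 3) (m div p) else 0)"
proof (cases "m = 0")
  case False
  have p0: "p > 0" using p by (rule prime_gt_0_nat)
  have "of_nat p * fps_nth (lsig 3) (p * m) = dsig 3 (p * m) / of_nat m"
    using p0 by (simp add: lsig_def)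
  also have "\<dots> = ((1 + of_nat p ^ 3) * dsig 3 m - of_nat p ^ 3 * (if p dvd m then dsig 3 (m div p) else 0)) / of_nat m"
    using False by (subst dsig_prime_mult[OF p]) simp_all
  also have "\<dots> = of_nat (1 + p ^ 3) * fps_nth (lsig 3) m - of_nat (p ^ 2) * (if p dvd m then fps_nth (lsig 3) (m div p) else 0)"
  proof (cases "p dvd m")
    case True
    then obtain k where "m = p * k" by auto
    with False p0 show ?thesis
      by (simp add: lsig_def field_simps power2_eq_square power3_eq_cube)
  qed (simp add: lsig_def)
  finally show ?thesis .
qed simp

lemma lsig3_expansion: "eval_fps (lsig 3) has_fps_expansion lsig 3"
  using lsig_has_fps_expansion[of 2] by (simp add: eval_nat_numeral)

lemma has_fps_expansion_scale:
  fixes f :: "complex \<Rightarrow> complex"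
  assumes "f has_fps_expansion F"
  shows "(\<lambda>q. f (c * q)) has_fps_expansion fps_compose F (fps_const c * fps_X)"
proof -
  have "(\<lambda>q. c * q) has_fps_expansion fps_const c * fps_X"
    by (rule has_fps_expansion_cmult_left[OF has_fps_expansion_fps_X])
  from has_fps_expansion_compose[OF assms this] show ?thesis
    by (simp add: o_def)
qed

text \<open>A nonzero c and a positive m ensure that the substitution tends to 0 without reaching
  it, so \<open>at 0\<close> is respected.\<close>

lemma eventually_at_0_scale:
  fixes c :: complex
  assumes "\<forall>\<^sub>F q in at 0. P q" and "c \<noteq> 0" "m > 0"
  shows "\<forall>\<^sub>F q in at 0. P (c * q ^ m)"
proof -
  have "filterlim (\<lambda>q :: complex. c * q ^ m) (at 0) (at 0)"
  proof (rule filterlim_atI)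
    have "((\<lambda>q. c * q ^ m) \<longlongrightarrow> c * 0 ^ m) (at (0 :: complex))"
      by (intro tendsto_intros)
    then show "((\<lambda>q. c * q ^ m) \<longlongrightarrow> 0) (at (0 :: complex))"
      using assms(3) by (simp add: power_0_left)
    have "\<forall>\<^sub>F q :: complex in at 0. q \<noteq> 0"
      by (simp add: eventually_at_filter)
    then show "\<forall>\<^sub>F q in at 0. c * q ^ m \<noteq> 0"
      by eventually_elim (simp add: assms(2))
  qed
  then show ?thesis
    using assms(1) by (rule eventually_compose_filterlim[rotated])
qed

lemma eventually_nz_small: "\<forall>\<^sub>F q :: complex in at 0. q \<noteq> 0 \<and> norm q < 1"
  using eventually_norm_less[of 1] by (auto simp: eventually_at_filter elim: eventually_mono)

text \<open>Adding the value at -q keeps twice the even coefficients, to which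
  \<open>lsig_hecke\<close> with p = 2 applies: 9 = 1 + 2^3 and 4 = 2^2. The logarithms balance
  since 2 = 9 * 2 - 4 * 4.\<close>

lemma G_hecke2: "\<forall>\<^sub>F q in at 0. G q + G (- q) = 9 * G (q ^ 2) - 4 * G (q ^ 4)"
proof -
  let ?L = "eval_fps (lsig 3)"
  have eq: "lsig 3 + fps_compose (lsig 3) (fps_const (-1) * fps_X) = 9 * dil 2 (lsig 3) - 4 * dil 4 (lsig 3)"
  proof (rule fps_ext)
    fix n
    show "fps_nth (lsig 3 + fps_compose (lsig 3) (fps_const (-1) * fps_X)) n = fps_nth (9 * dil 2 (lsig 3) - 4 * dil 4 (lsig 3)) n"
    proof (cases "even n")
      case True
      then obtain m where n: "n = 2 * m" by auto
      have "2 * m div 4 = m div 2" "4 dvd 2 * m \<longleftrightarrow> 2 dvd m"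
        by presburger+
      then show ?thesis
        using lsig_hecke[OF two_is_prime_nat, of m] by (simp add: n dil_nth)
    next
      case False
      then have "\<not> 4 dvd n" by presburger
      with False show ?thesis by (simp add: dil_nth)
    qed
  qed
  have l: "(\<lambda>q. ?L q + ?L ((-1) * q)) has_fps_expansion (lsig 3 + fps_compose (lsig 3) (fps_const (-1) * fps_X))"
    by (intro has_fps_expansion_add has_fps_expansion_scale lsig3_expansion)
  have r: "(\<lambda>q. 9 * ?L (q ^ 2) - 4 * ?L (q ^ 4)) has_fps_expansion (9 * dil 2 (lsig 3) - 4 * dil 4 (lsig 3))"
    by (intro has_fps_expansion_diff has_fps_expansion_mult has_fps_expansion_numeral has_fps_expansion_dil lsig3_expansion) simp_all
  have "\<forall>\<^sub>F q in nhds 0. ?L q + ?L ((-1) * q) = 9 * ?L (q ^ 2) - 4 * ?L (q ^ 4)"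
    by (rule has_fps_expansion_eventually_eq[OF l[unfolded eq] r])
  then have "\<forall>\<^sub>F q in at 0. ?L q + ?L (- q) = 9 * ?L (q ^ 2) - 4 * ?L (q ^ 4)"
    by (simp add: eventually_at_filter eventually_mono)
  with eventually_nz_small show ?thesis
  proof eventually_elim
    case (elim q)
    have q: "norm (q ^ 2) < 1" "norm (q ^ 4) < 1" "norm (- q) < 1"
      using elim by (auto intro: norm_power_less_one simp del: norm_power)
    have "Re (?L q) + Re (?L (- q)) = 9 * Re (?L (q ^ 2)) - 4 * Re (?L (q ^ 4))"
      using arg_cong[OF elim(2), of Re] by simp
    moreover have "ln (norm (q ^ 2)) = 2 * ln (norm q)" "ln (norm (q ^ 4)) = 4 * ln (norm q)"
      using elim by (simp_all add: norm_power ln_realpow)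
    ultimately show ?case
      using elim q by (simp add: G_eq)
  qed
qed

definition omega3 :: complex where
  "omega3 = exp (2 * pi * \<i> / 3)"

lemma omega3_cis: "omega3 = cis (2 * pi / 3)"
  by (simp add: omega3_def cis_conv_exp mult_ac)

lemma omega3_cube: "omega3 ^ 3 = 1"
  by (simp add: omega3_cis Complex.DeMoivre)

lemma omega3_ne_1: "omega3 \<noteq> 1"
  by (simp add: omega3_cis complex_eq_iff cos_120)

lemma omega3_sum: "1 + omega3 + omega3 ^ 2 = 0"
proof -
  have "(omega3 - 1) * (1 + omega3 + omega3 ^ 2) = 0"
    using omega3_cube by algebra
  then show ?thesis using omega3_ne_1 by simp
qed

lemma norm_omega3: "norm omega3 = 1"
  by (simp add: omega3_cis)

lemma omega3_square: "exp (4 * pi * \<i> / 3) = omega3 ^ 2"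
  by (simp add: omega3_def mult.assoc flip: exp_of_nat_mult)

text \<open>Summing over the cube roots of unity selects the exponents divisible by 3, and
  \<open>lsig_hecke\<close> with p = 3 supplies 28 = 1 + 3^3 and 9 = 3^2. The logarithms balance
  since 3 = 28 * 3 - 9 * 9.\<close>

lemma G_hecke3: "\<forall>\<^sub>F q in at 0. G q + G (omega3 * q) + G (omega3 ^ 2 * q) = 28 * G (q ^ 3) - 9 * G (q ^ 9)"
proof -
  let ?L = "eval_fps (lsig 3)"
  have eq: "lsig 3 + fps_compose (lsig 3) (fps_const omega3 * fps_X) + fps_compose (lsig 3) (fps_const (omega3 ^ 2) * fps_X)
      = 28 * dil 3 (lsig 3) - 9 * dil 9 (lsig 3)" (is "?l = ?r")
  proof (rule fps_ext)
    fix n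
    have l: "fps_nth ?l n = (1 + omega3 ^ n + omega3 ^ (2 * n)) * fps_nth (lsig 3) n"
      unfolding fps_add_nth fps_nth_compose_linear power_mult by (simp add: algebra_simps)
    show "fps_nth ?l n = fps_nth ?r n"
    proof (cases "3 dvd n")
      case True
      then obtain m where n: "n = 3 * m" by auto
      have "3 * m div 9 = m div 3" "9 dvd 3 * m \<longleftrightarrow> 3 dvd m"
        by presburger+
      moreover have o1: "omega3 ^ n = 1"
        by (simp add: n power_mult omega3_cube)
      moreover have "omega3 ^ (2 * n) = 1"
        by (simp only: mult.commute[of 2 n] power_mult o1 power_one)
      moreover have "prime (3 :: nat)" by simp
      ultimately show ?thesis
        unfolding l using lsig_hecke[of 3 m] by (simp add: n dil_nth)
    next
      case False
      define m where "m = n div 3"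
      from False have "n = 3 * m + 1 \<or> n = 3 * m + 2"
        unfolding m_def by presburger
      then have "1 + omega3 ^ n + omega3 ^ (2 * n) = 0"
      proof
        assume "n = 3 * m + 1"
        moreover have "2 * (3 * m + 1) = 3 * (2 * m) + 2"
          by simp
        ultimately show ?thesis
          using omega3_cube omega3_sum by (simp only: power_add power_mult power_one power_one_right mult_1)
      next
        assume "n = 3 * m + 2"
        moreover have "2 * (3 * m + 2) = 3 * (2 * m + 1) + 1"
          by simp
        ultimately show ?thesis
          using omega3_cube omega3_sum by (simp only: power_add power_mult power_one power_one_right mult_1) (simp add: add_ac)
      qed
      moreover have "\<not> 9 dvd n" using False by presburger
      ultimately show ?thesis unfolding l using False by (simp add: dil_nth)
    qed
  qed
  have l: "(\<lambda>q. ?L q + ?L (omega3 * q) + ?L (omega3 ^ 2 * q)) has_fps_expansion ?l"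
    by (intro has_fps_expansion_add has_fps_expansion_scale lsig3_expansion)
  have r: "(\<lambda>q. 28 * ?L (q ^ 3) - 9 * ?L (q ^ 9)) has_fps_expansion ?r"
    by (intro has_fps_expansion_diff has_fps_expansion_mult has_fps_expansion_numeral has_fps_expansion_dil lsig3_expansion) simp_all
  have "\<forall>\<^sub>F q in nhds 0. ?L q + ?L (omega3 * q) + ?L (omega3 ^ 2 * q) = 28 * ?L (q ^ 3) - 9 * ?L (q ^ 9)"
    by (rule has_fps_expansion_eventually_eq[OF l[unfolded eq] r])
  then have "\<forall>\<^sub>F q in at 0. ?L q + ?L (omega3 * q) + ?L (omega3 ^ 2 * q) = 28 * ?L (q ^ 3) - 9 * ?L (q ^ 9)"
    by (simp add: eventually_at_filter eventually_mono)
  with eventually_nz_small show ?thesis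
  proof eventually_elim
    case (elim q)
    have q: "norm (q ^ 3) < 1" "norm (q ^ 9) < 1"
      using elim by (auto intro: norm_power_less_one simp del: norm_power)
    have n: "norm (omega3 * q) = norm q" "norm (omega3 ^ 2 * q) = norm q"
      by (simp_all add: norm_mult norm_power norm_omega3)
    have nz: "omega3 * q \<noteq> 0" "omega3 ^ 2 * q \<noteq> 0"
      using elim norm_omega3 by auto
    have "Re (?L q) + Re (?L (omega3 * q)) + Re (?L (omega3 ^ 2 * q)) = 28 * Re (?L (q ^ 3)) - 9 * Re (?L (q ^ 9))"
      using arg_cong[OF elim(2), of Re] by simp
    moreover have "ln (norm (q ^ 3)) = 3 * ln (norm q)" "ln (norm (q ^ 9)) = 9 * ln (norm q)"
      using elim by (simp_all add: norm_power ln_realpow)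
    moreover have "G (omega3 * q) = - ln (norm q) - 240 * Re (?L (omega3 * q))"
      "G (omega3 ^ 2 * q) = - ln (norm q) - 240 * Re (?L (omega3 ^ 2 * q))"
      using G_eq[OF _ nz(1)] G_eq[OF _ nz(2)] elim unfolding n by simp_all
    ultimately show ?case
      using elim q by (simp add: G_eq)
  qed
qed

text \<open>The root functions are arbitrary, with no continuity assumed, so every choice of roots
  is covered; the punctured filter \<open>at 0\<close> expresses small nonzero q.\<close>

theorem theorem2:
  fixes sqr fthr :: "complex \<Rightarrow> complex"
  assumes "\<And>u. sqr u ^ 2 = u"
    and "\<And>u. fthr u ^ 4 = u"
  shows
    "(\<forall>\<^sub>F q in at 0.
        f2 sqr (s2 q) = - (2/15) * G q - (1/15) * G (- q) + (3/5) * G (q^2) \<and>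
        f3 (s3 q) = - (1/8) * G q + (3/8) * G (q^3) \<and>
        f4 fthr (s4 q) = - (1/3) * G q + (2/3) * G (q^2)) \<and>
     (\<forall>\<^sub>F q in at 0.
        G q = - 19 * f2 sqr (s2 q) - 4 * f2 sqr (s2 (- q))
              + 24 * f2 sqr (s2 (q^2)) - 12 * f2 sqr (s2 (- (q^2))) \<and>
        G q = - (19/2) * f3 (s3 q) - (3/2) * f3 (s3 (exp (2 * pi * \<i> / 3) * q))
              - (3/2) * f3 (s3 (exp (4 * pi * \<i> / 3) * q)) + (9/2) * f3 (s3 (q^3)) \<and>
        G q = - 5 * f4 fthr (s4 q) - 2 * f4 fthr (s4 (- q)) + 4 * f4 fthr (s4 (q^2)))"
proof (intro conjI)
  note e2 = f2_s2[of sqr, OF assms(1)] and e4 = f4_s4[of fthr, OF assms(2)]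
  show "\<forall>\<^sub>F q in at 0.
        f2 sqr (s2 q) = - (2/15) * G q - (1/15) * G (- q) + (3/5) * G (q^2) \<and>
        f3 (s3 q) = - (1/8) * G q + (3/8) * G (q^3) \<and>
        f4 fthr (s4 q) = - (1/3) * G q + (2/3) * G (q^2)"
    using e2 f3_s3 e4 G_hecke2
  proof eventually_elim
    case (elim q)
    then show ?case
      by (intro conjI) (simp_all add: field_simps)
  qed
  have om: "omega3 \<noteq> 0"
    using norm_omega3 by auto
  have a1: "\<forall>\<^sub>F q in at 0. f2 sqr (s2 (- q)) = (4 * G (q ^ 4) - G (- q)) / 15"
    by (rule eventually_mono[OF eventually_at_0_scale[OF e2, of "-1" 1]]) simp_all
  have a2: "\<forall>\<^sub>F q in at 0. f2 sqr (s2 (q ^ 2)) = (4 * G (q ^ 8) - G (q ^ 2)) / 15"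
    by (rule eventually_mono[OF eventually_at_0_scale[OF e2, of 1 2]]) (simp_all flip: power_mult)
  have a3: "\<forall>\<^sub>F q in at 0. f2 sqr (s2 (- (q ^ 2))) = (4 * G (q ^ 8) - G (- (q ^ 2))) / 15"
    by (rule eventually_mono[OF eventually_at_0_scale[OF e2, of "-1" 2]]) (simp_all flip: power_mult)
  have h2: "\<forall>\<^sub>F q in at 0. G (q ^ 2) + G (- (q ^ 2)) = 9 * G (q ^ 4) - 4 * G (q ^ 8)"
    by (rule eventually_mono[OF eventually_at_0_scale[OF G_hecke2, of 1 2]]) (simp_all flip: power_mult)
  have b1: "\<forall>\<^sub>F q in at 0. f3 (s3 (omega3 * q)) = (3 * G (q ^ 3) - G (omega3 * q)) / 8"
    by (rule eventually_mono[OF eventually_at_0_scale[OF f3_s3 om, of 1]]) (simp_all add: power_mult_distrib omega3_cube)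
  have "(omega3 ^ 2) ^ 3 = 1"
    using omega3_cube by algebra
  then have b2: "\<forall>\<^sub>F q in at 0. f3 (s3 (omega3 ^ 2 * q)) = (3 * G (q ^ 3) - G (omega3 ^ 2 * q)) / 8"
    using om by (intro eventually_mono[OF eventually_at_0_scale[OF f3_s3, of "omega3 ^ 2" 1]])
      (simp_all add: power_mult_distrib)
  have b3: "\<forall>\<^sub>F q in at 0. f3 (s3 (q ^ 3)) = (3 * G (q ^ 9) - G (q ^ 3)) / 8"
    by (rule eventually_mono[OF eventually_at_0_scale[OF f3_s3, of 1 3]]) (simp_all flip: power_mult)
  have c1: "\<forall>\<^sub>F q in at 0. f4 fthr (s4 (- q)) = (2 * G (q ^ 2) - G (- q)) / 3"
    by (rule eventually_mono[OF eventually_at_0_scale[OF e4, of "-1" 1]]) simp_all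
  have c2: "\<forall>\<^sub>F q in at 0. f4 fthr (s4 (q ^ 2)) = (2 * G (q ^ 4) - G (q ^ 2)) / 3"
    by (rule eventually_mono[OF eventually_at_0_scale[OF e4, of 1 2]]) (simp_all flip: power_mult)
  show "\<forall>\<^sub>F q in at 0.
        G q = - 19 * f2 sqr (s2 q) - 4 * f2 sqr (s2 (- q))
              + 24 * f2 sqr (s2 (q^2)) - 12 * f2 sqr (s2 (- (q^2))) \<and>
        G q = - (19/2) * f3 (s3 q) - (3/2) * f3 (s3 (exp (2 * pi * \<i> / 3) * q))
              - (3/2) * f3 (s3 (exp (4 * pi * \<i> / 3) * q)) + (9/2) * f3 (s3 (q^3)) \<and>
        G q = - 5 * f4 fthr (s4 q) - 2 * f4 fthr (s4 (- q)) + 4 * f4 fthr (s4 (q^2))"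
    \<comment> \<open>Every f-value becomes a combination of G-values, and the rest is linear
      elimination. The f2 relation uses the Hecke relation of the prime 2 at q and at q^2, the f4
      relation uses it at q, and the f3 relation uses that of the prime 3.\<close>
    unfolding omega3_square omega3_def[symmetric]
    using G_hecke2 h2 G_hecke3 e2 a1 a2 a3 f3_s3 b1 b2 b3 e4 c1 c2
  proof eventually_elim
    case (elim q)
    then show ?case
      by (intro conjI) (simp_all add: field_simps)
  qed
qed

end
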